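(* The Open Colouring Axiom $\mathsf{OCA}$ implies that the measure algebra cannot be embedded into the Boolean algebra $\mathcal{P}(\mathbb{N})/\mathrm{fin}$; that is, assuming $\mathsf{OCA}$ there is no injective Boolean algebra homomorphism from the measure algebra into $\mathcal{P}(\mathbb{N})/\mathrm{fin}$.
   Context: The measure algebra is the quotient of the $\sigma$-algebra of Borel subsets of the real line by the ideal of Borel sets of Lebesgue measure zero. $\mathcal{P}(\mathbb{N})/\mathrm{fin}$ is the quotient of the power set algebra of $\mathbb{N}$ by the ideal of finite sets. An embedding is an injective homomorphism of Boolean algebras. The Open Colouring Axiom ($\mathsf{OCA}$) is the statement: if $X$ is a separable metrizable space and $[X]^2=K_0\cup K_1$ is a partition of the set of two-element subsets of $X$ in which $K_0$ is open (i.e. $\{(x,y): x\ne y, \{x,y\}\in K_0\}$ is open in $X\times X$), then either $X$ has an uncountable $K_0$-homogeneous subset $Y$ (i.e. $[Y]^2\subseteq K_0$), or $X$ is the union of countably many $K_1$-homogeneous subsets (sets $Z$ with $[Z]^2\subseteq K_1$). *)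

theory Defs
  imports "HOL-Analysis.Analysis" "HOL-Library.Ramsey"
begin

section \<open>The Open Colouring Axiom\<close>

definition open_colouring_property :: "'a topology \<Rightarrow> bool" where
  "open_colouring_property X \<longleftrightarrow>
    (\<forall>K0 K1. K0 \<union> K1 = [topspace X]\<^bsup>2\<^esup> \<and> K0 \<inter> K1 = {} \<and>
        openin (prod_topology X X) {(x, y). x \<noteq> y \<and> {x, y} \<in> K0} \<longrightarrow>
      (\<exists>Y. Y \<subseteq> topspace X \<and> uncountable Y \<and> [Y]\<^bsup>2\<^esup> \<subseteq> K0) \<or>
      (\<exists>\<Z>. countable \<Z> \<and> \<Union>\<Z> = topspace X \<and> (\<forall>Z\<in>\<Z>. [Z]\<^bsup>2\<^esup> \<subseteq> K1)))"

text \<open>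
  A formula cannot quantify over types, so the spaces range over all topologies whose underlying
  set is a set of reals; these topologies need not be related to the usual one. As a separable
  metrizable space has at most continuum many points, this covers all such spaces up to
  homeomorphism. See \<open>OCA_imp_open_colouring_property\<close> below for spaces over an arbitrary type.
\<close>

definition OCA :: bool where
  "OCA \<longleftrightarrow> (\<forall>X :: real topology.
    separable_space X \<and> metrizable_space X \<longrightarrow> open_colouring_property X)"

lemma open_colouring_property_homeomorphic:
  assumes "X homeomorphic_space Y" and Y: "open_colouring_property Y"
  shows "open_colouring_property X"
  unfolding open_colouring_property_def
proof (intro allI impI, elim conjE)
  fix K0 K1
  assume K: "K0 \<union> K1 = [topspace X]\<^bsup>2\<^esup>" and disj: "K0 \<inter> K1 = {}"
    and op: "openin (prod_topology X X) {(x, y). x \<noteq> y \<and> {x, y} \<in> K0}"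
  obtain f g where f: "continuous_map X Y f" and g: "continuous_map Y X g"
    and gf: "\<And>x. x \<in> topspace X \<Longrightarrow> g (f x) = x" and fg: "\<And>y. y \<in> topspace Y \<Longrightarrow> f (g y) = y"
    using assms(1) unfolding homeomorphic_space_def homeomorphic_maps_def by blast
  have fX: "f x \<in> topspace Y" if "x \<in> topspace X" for x
    using f that by (auto simp: continuous_map_def)
  have gY: "g y \<in> topspace X" if "y \<in> topspace Y" for y
    using g that by (auto simp: continuous_map_def)
  define L where "L K = {e \<in> [topspace Y]\<^bsup>2\<^esup>. g ` e \<in> K}" for K
  have geq: "g x = g y \<longleftrightarrow> x = y" if "x \<in> topspace Y" "y \<in> topspace Y" for x y
    using fg that by metis
  have "L K0 \<union> L K1 = [topspace Y]\<^bsup>2\<^esup>"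
  proof
    show "[topspace Y]\<^bsup>2\<^esup> \<subseteq> L K0 \<union> L K1"
    proof
      fix e assume e: "e \<in> [topspace Y]\<^bsup>2\<^esup>"
      then obtain x y where "e = {x, y}" "x \<in> topspace Y" "y \<in> topspace Y" "x \<noteq> y"
        by (auto simp: nsets_2_eq)
      then have "g ` e \<in> [topspace X]\<^bsup>2\<^esup>"
        by (simp add: gY geq)
      with e K show "e \<in> L K0 \<union> L K1"
        by (auto simp: L_def)
    qed
  qed (auto simp: L_def)
  moreover have "L K0 \<inter> L K1 = {}"
    using disj by (auto simp: L_def)
  moreover have "openin (prod_topology Y Y) {(x, y). x \<noteq> y \<and> {x, y} \<in> L K0}"
  proof -
    have "continuous_map (prod_topology Y Y) (prod_topology X X) (\<lambda>p. (g (fst p), g (snd p)))"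
      by (intro continuous_map_pairedI continuous_map_compose[OF continuous_map_fst g, unfolded o_def]
          continuous_map_compose[OF continuous_map_snd g, unfolded o_def])
    from openin_continuous_map_preimage[OF this op]
    have "openin (prod_topology Y Y) {p \<in> topspace (prod_topology Y Y).
        (g (fst p), g (snd p)) \<in> {(x, y). x \<noteq> y \<and> {x, y} \<in> K0}}" .
    also have "{p \<in> topspace (prod_topology Y Y).
        (g (fst p), g (snd p)) \<in> {(x, y). x \<noteq> y \<and> {x, y} \<in> K0}} =
        {(x, y). x \<noteq> y \<and> {x, y} \<in> L K0}"
      by (auto simp: L_def geq)
    finally show ?thesis .
  qed
  ultimately consider
      (unc) V where "V \<subseteq> topspace Y" "uncountable V" "[V]\<^bsup>2\<^esup> \<subseteq> L K0"
    | (cnt) \<Z> where "countable \<Z>" "\<Union>\<Z> = topspace Y" "\<forall>Z\<in>\<Z>. [Z]\<^bsup>2\<^esup> \<subseteq> L K1"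
    using Y unfolding open_colouring_property_def by meson
  then show "(\<exists>V. V \<subseteq> topspace X \<and> uncountable V \<and> [V]\<^bsup>2\<^esup> \<subseteq> K0) \<or>
      (\<exists>\<Z>. countable \<Z> \<and> \<Union>\<Z> = topspace X \<and> (\<forall>Z\<in>\<Z>. [Z]\<^bsup>2\<^esup> \<subseteq> K1))"
  proof cases
    case unc
    have im: "[g ` V]\<^bsup>2\<^esup> \<subseteq> K0"
    proof
      fix e assume "e \<in> [g ` V]\<^bsup>2\<^esup>"
      then obtain x y where "e = {g x, g y}" "x \<in> V" "y \<in> V" "x \<noteq> y"
        by (auto simp: nsets_2_eq)
      moreover from this have "{x, y} \<in> L K0"
        using unc(3) by (meson doubleton_in_nsets_2 subsetD)
      ultimately show "e \<in> K0"
        by (simp add: L_def)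
    qed
    have "inj_on g V"
      using geq unc(1) unfolding inj_on_def by blast
    then have "uncountable (g ` V)"
      using unc(2) countable_image_inj_on[of g V] by argo
    moreover have "g ` V \<subseteq> topspace X"
      using gY unc(1) by auto
    ultimately show ?thesis
      using im by (intro disjI1 exI[of _ "g ` V"] conjI)
  next
    case cnt
    have "[g ` Z]\<^bsup>2\<^esup> \<subseteq> K1" if "Z \<in> \<Z>" for Z
    proof
      fix e assume "e \<in> [g ` Z]\<^bsup>2\<^esup>"
      then obtain x y where "e = {g x, g y}" "x \<in> Z" "y \<in> Z" "x \<noteq> y"
        by (auto simp: nsets_2_eq)
      moreover from this have "{x, y} \<in> L K1"
        using cnt(3) that by (meson doubleton_in_nsets_2 subsetD)
      ultimately show "e \<in> K1"
        by (simp add: L_def)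
    qed
    moreover have "\<Union>((`) g ` \<Z>) = topspace X"
    proof -
      have "\<Union>((`) g ` \<Z>) = g ` topspace Y"
        using cnt(2) by blast
      also have "\<dots> = topspace X"
        using gY fX gf by force
      finally show ?thesis .
    qed
    moreover have "countable ((`) g ` \<Z>)"
      using cnt(1) by blast
    ultimately show ?thesis
      by (intro disjI2 exI[of _ "(`) g ` \<Z>"] conjI) auto
  qed
qed

lemma separable_metrizable_lepoll_real:
  assumes "separable_space X" "metrizable_space X"
  shows "topspace X \<lesssim> (UNIV :: real set)"
proof -
  obtain M d where M: "Metric_space M d" and X: "X = Metric_space.mtopology M d"
    using assms(2) unfolding metrizable_space_def by blast
  interpret Metric_space M d by (fact M)
  obtain D where D: "countable D" "D \<subseteq> topspace X" "X closure_of D = topspace X"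
    using assms(1) unfolding separable_space_def by blast
  have dense: "\<exists>c\<in>D. d x c < r" if "x \<in> M" "r > 0" for x r
  proof -
    have "x \<in> mtopology closure_of D"
      using D(3) that(1) X by simp
    then show ?thesis
      using that unfolding metric_closure_of by (fastforce simp: in_mball)
  qed
  define F where "F x = {(c, n :: nat). c \<in> D \<and> d x c < inverse (Suc n)}" for x
  have "inj_on F M"
  proof (rule inj_onI, rule ccontr)
    fix x y assume xy: "x \<in> M" "y \<in> M" "F x = F y" "x \<noteq> y"
    then have "d x y > 0" by simp
    then obtain n :: nat where n: "inverse (Suc n) < d x y / 2"
      using reals_Archimedean by (metis half_gt_zero)
    obtain c where c: "c \<in> D" "d x c < inverse (Suc n)"
      using dense[OF xy(1), of "inverse (Suc n)"] by auto
    then have "(c, n) \<in> F y"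
      using xy(3) by (auto simp: F_def)
    then have "d y c < inverse (Suc n)"
      by (simp add: F_def)
    moreover have "d x y \<le> d x c + d y c"
      using triangle[of x c y] xy(1,2) c(1) D(2) X by (auto simp: commute)
    ultimately show False
      using c(2) n by linarith
  qed
  moreover have "F ` M \<subseteq> Pow (D \<times> (UNIV :: nat set))"
    by (auto simp: F_def)
  ultimately have "M \<lesssim> Pow (D \<times> (UNIV :: nat set))"
    unfolding lepoll_def by blast
  also have "D \<times> (UNIV :: nat set) \<lesssim> (UNIV :: nat set)"
    using D(1) by (metis countable_SIGMA countableI_type countable_def lepoll_def subset_UNIV)
  then have "Pow (D \<times> (UNIV :: nat set)) \<lesssim> Pow (UNIV :: nat set)"
    unfolding lepoll_def by (meson PowD PowI image_Pow_mono image_subset_iff inj_on_image_Pow)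
  also have "Pow (UNIV :: nat set) \<lesssim> (UNIV :: real set)"
    using nat_sets_eqpoll_reals eqpoll_imp_lepoll by simp
  finally show ?thesis
    using X by simp
qed

theorem OCA_imp_open_colouring_property:
  fixes X :: "'a topology"
  assumes OCA and X: "separable_space X" "metrizable_space X"
  shows "open_colouring_property X"
proof -
  obtain f :: "'a \<Rightarrow> real" where f: "inj_on f (topspace X)"
    using separable_metrizable_lepoll_real[OF X] unfolding lepoll_def by blast
  define g where "g = inv_into (topspace X) f"
  define Y where "Y = pullback_topology (f ` topspace X) g X"
  have gf: "g (f x) = x" if "x \<in> topspace X" for x
    using f that by (simp add: g_def)
  have topY: "topspace Y = f ` topspace X"
    using gf by (auto simp: Y_def topspace_pullback_topology)
  have "homeomorphic_maps X Y f g"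
    unfolding homeomorphic_maps_def
  proof (intro conjI)
    show "continuous_map Y X g"
      unfolding Y_def using continuous_map_pullback[OF continuous_map_id] by simp
    show "continuous_map X Y f"
      unfolding continuous_map_def
    proof (intro conjI allI impI)
      fix U assume "openin Y U"
      then obtain V where V: "openin X V" "U = g -` V \<inter> f ` topspace X"
        unfolding Y_def openin_pullback_topology by blast
      have "f x \<in> U \<longleftrightarrow> x \<in> V" if "x \<in> topspace X" for x
        using that gf by (simp add: V(2))
      then have "{x \<in> topspace X. f x \<in> U} = V"
        using openin_subset[OF V(1)] by blast
      then show "openin X {x \<in> topspace X. f x \<in> U}"
        using V(1) by simp
    qed (auto simp: topY)
  qed (auto simp: topY gf)
  then have hom: "X homeomorphic_space Y"
    unfolding homeomorphic_space_def by blast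
  then have "separable_space Y" "metrizable_space Y"
    using X homeomorphic_separable_space homeomorphic_metrizable_space by blast+
  then show ?thesis
    using \<open>OCA\<close> open_colouring_property_homeomorphic[OF hom] by (simp add: OCA_def)
qed


section \<open>The Boolean algebras\<close>

text \<open>
  Factoring an algebra of sets by an ideal identifies two sets whose symmetric difference
  is in the ideal.
\<close>

definition borel_null_eq :: "real set \<Rightarrow> real set \<Rightarrow> bool" where
  "borel_null_eq A B \<longleftrightarrow> A \<in> sets borel \<and> B \<in> sets borel \<and> sym_diff A B \<in> null_sets lborel"

lemma null_lborel_mono: "A \<in> null_sets lborel \<Longrightarrow> B \<in> sets borel \<Longrightarrow> B \<subseteq> A \<Longrightarrow> B \<in> null_sets lborel"
  by (metis null_sets_subset sets_lborel)

lemma part_equivp_borel_null_eq: "part_equivp borel_null_eq"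
proof (rule part_equivpI)
  show "\<exists>A. borel_null_eq A A"
    by (intro exI[of _ "{}"]) (simp add: borel_null_eq_def)
  show "symp borel_null_eq"
    by (auto simp: borel_null_eq_def symp_def Un_commute)
  show "transp borel_null_eq"
  proof (rule transpI)
    fix A B C assume *: "borel_null_eq A B" "borel_null_eq B C"
    then have "sym_diff A B \<union> sym_diff B C \<in> null_sets lborel"
      by (auto simp: borel_null_eq_def)
    then have "sym_diff A C \<in> null_sets lborel"
      by (rule null_lborel_mono) (use * in \<open>auto simp: borel_null_eq_def\<close>)
    with * show "borel_null_eq A C"
      by (simp add: borel_null_eq_def)
  qed
qed

quotient_type measure_algebra = "real set" / partial: borel_null_eq
  by (rule part_equivp_borel_null_eq)

definition fin_eq :: "nat set \<Rightarrow> nat set \<Rightarrow> bool" where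
  "fin_eq A B \<longleftrightarrow> finite (sym_diff A B)"

lemma equivp_fin_eq: "equivp fin_eq"
proof (rule equivpI)
  show "transp fin_eq"
  proof (rule transpI)
    fix A B C assume "fin_eq A B" "fin_eq B C"
    then have "finite (sym_diff A B \<union> sym_diff B C)"
      by (simp add: fin_eq_def)
    then show "fin_eq A C"
      unfolding fin_eq_def by (rule rev_finite_subset) auto
  qed
qed (auto simp: fin_eq_def reflp_def symp_def Un_commute)

quotient_type pow_nat_mod_fin = "nat set" / fin_eq
  by (rule equivp_fin_eq)

instantiation measure_algebra :: boolean_algebra
begin

lift_definition bot_measure_algebra :: measure_algebra is "{}"
  by (simp add: borel_null_eq_def)

lift_definition top_measure_algebra :: measure_algebra is UNIV
  by (simp add: borel_null_eq_def)

lift_definition uminus_measure_algebra :: "measure_algebra \<Rightarrow> measure_algebra" is "\<lambda>A. - A"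
  by (auto simp: borel_null_eq_def Un_commute Diff_eq Int_commute)

lift_definition inf_measure_algebra :: "measure_algebra \<Rightarrow> measure_algebra \<Rightarrow> measure_algebra" is "(\<inter>)"
proof -
  fix A A' B B' assume *: "borel_null_eq A A'" "borel_null_eq B B'"
  then have "sym_diff A A' \<union> sym_diff B B' \<in> null_sets lborel"
    by (auto simp: borel_null_eq_def)
  then have "sym_diff (A \<inter> B) (A' \<inter> B') \<in> null_sets lborel"
    by (rule null_lborel_mono) (use * in \<open>auto simp: borel_null_eq_def\<close>)
  with * show "borel_null_eq (A \<inter> B) (A' \<inter> B')"
    by (auto simp: borel_null_eq_def)
qed

lift_definition sup_measure_algebra :: "measure_algebra \<Rightarrow> measure_algebra \<Rightarrow> measure_algebra" is "(\<union>)"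
proof -
  fix A A' B B' assume *: "borel_null_eq A A'" "borel_null_eq B B'"
  then have "sym_diff A A' \<union> sym_diff B B' \<in> null_sets lborel"
    by (auto simp: borel_null_eq_def)
  then have "sym_diff (A \<union> B) (A' \<union> B') \<in> null_sets lborel"
    by (rule null_lborel_mono) (use * in \<open>auto simp: borel_null_eq_def\<close>)
  with * show "borel_null_eq (A \<union> B) (A' \<union> B')"
    by (auto simp: borel_null_eq_def)
qed

definition minus_measure_algebra :: "measure_algebra \<Rightarrow> measure_algebra \<Rightarrow> measure_algebra" where
  "minus_measure_algebra a b = inf a (- b)"

definition less_eq_measure_algebra :: "measure_algebra \<Rightarrow> measure_algebra \<Rightarrow> bool" where
  "less_eq_measure_algebra a b \<longleftrightarrow> inf a b = a"

definition less_measure_algebra :: "measure_algebra \<Rightarrow> measure_algebra \<Rightarrow> bool" where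
  "less_measure_algebra a b \<longleftrightarrow> a \<le> b \<and> a \<noteq> b"

instance
proof -
  have comm: "inf a b = inf b a" "sup a b = sup b a" for a b :: measure_algebra
    by (transfer, simp add: borel_null_eq_def Int_commute Un_commute)+
  have assoc: "inf (inf a b) c = inf a (inf b c)" "sup (sup a b) c = sup a (sup b c)"
    for a b c :: measure_algebra
    by (transfer, simp add: borel_null_eq_def Int_assoc Un_assoc)+
  have idem: "inf a a = a" for a :: measure_algebra
    by transfer (simp add: borel_null_eq_def)
  have absorb: "inf a (sup a b) = a" "sup a (inf a b) = a" for a b :: measure_algebra
    by (transfer, simp add: borel_null_eq_def Int_absorb2 Un_absorb2)+
  have distrib: "sup a (inf b c) = inf (sup a b) (sup a c)" for a b c :: measure_algebra
    by transfer (simp add: borel_null_eq_def Un_Int_distrib)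
  have bounds: "inf bot a = bot" "inf a top = a" for a :: measure_algebra
    by (transfer, simp add: borel_null_eq_def)+
  have compl: "inf a (- a) = bot" "sup a (- a) = top" for a :: measure_algebra
    by (transfer, simp add: borel_null_eq_def)+
  have sup_inf: "inf a b = a \<longleftrightarrow> sup a b = b" for a b :: measure_algebra
    by (metis absorb comm)
  show "OFCLASS(measure_algebra, boolean_algebra_class)"
    by intro_classes
      (unfold less_eq_measure_algebra_def less_measure_algebra_def minus_measure_algebra_def,
       (metis comm assoc idem absorb sup_inf bounds compl distrib)+)
qed

end

instantiation pow_nat_mod_fin :: boolean_algebra
begin

lift_definition bot_pow_nat_mod_fin :: pow_nat_mod_fin is "{}" .

lift_definition top_pow_nat_mod_fin :: pow_nat_mod_fin is UNIV .

lift_definition uminus_pow_nat_mod_fin :: "pow_nat_mod_fin \<Rightarrow> pow_nat_mod_fin" is "\<lambda>A. - A"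
  by (auto simp: fin_eq_def Diff_eq Int_commute)

lift_definition inf_pow_nat_mod_fin :: "pow_nat_mod_fin \<Rightarrow> pow_nat_mod_fin \<Rightarrow> pow_nat_mod_fin" is "(\<inter>)"
proof -
  fix A A' B B' assume "fin_eq A A'" "fin_eq B B'"
  then have "finite (sym_diff A A' \<union> sym_diff B B')"
    by (simp add: fin_eq_def)
  then show "fin_eq (A \<inter> B) (A' \<inter> B')"
    unfolding fin_eq_def by (rule rev_finite_subset) auto
qed

lift_definition sup_pow_nat_mod_fin :: "pow_nat_mod_fin \<Rightarrow> pow_nat_mod_fin \<Rightarrow> pow_nat_mod_fin" is "(\<union>)"
proof -
  fix A A' B B' assume "fin_eq A A'" "fin_eq B B'"
  then have "finite (sym_diff A A' \<union> sym_diff B B')"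
    by (simp add: fin_eq_def)
  then show "fin_eq (A \<union> B) (A' \<union> B')"
    unfolding fin_eq_def by (rule rev_finite_subset) auto
qed

definition minus_pow_nat_mod_fin :: "pow_nat_mod_fin \<Rightarrow> pow_nat_mod_fin \<Rightarrow> pow_nat_mod_fin" where
  "minus_pow_nat_mod_fin a b = inf a (- b)"

definition less_eq_pow_nat_mod_fin :: "pow_nat_mod_fin \<Rightarrow> pow_nat_mod_fin \<Rightarrow> bool" where
  "less_eq_pow_nat_mod_fin a b \<longleftrightarrow> inf a b = a"

definition less_pow_nat_mod_fin :: "pow_nat_mod_fin \<Rightarrow> pow_nat_mod_fin \<Rightarrow> bool" where
  "less_pow_nat_mod_fin a b \<longleftrightarrow> a \<le> b \<and> a \<noteq> b"

instance
proof -
  have comm: "inf a b = inf b a" "sup a b = sup b a" for a b :: pow_nat_mod_fin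
    by (transfer, simp add: fin_eq_def Int_commute Un_commute)+
  have assoc: "inf (inf a b) c = inf a (inf b c)" "sup (sup a b) c = sup a (sup b c)"
    for a b c :: pow_nat_mod_fin
    by (transfer, simp add: fin_eq_def Int_assoc Un_assoc)+
  have idem: "inf a a = a" for a :: pow_nat_mod_fin
    by transfer (simp add: fin_eq_def)
  have absorb: "inf a (sup a b) = a" "sup a (inf a b) = a" for a b :: pow_nat_mod_fin
    by (transfer, simp add: fin_eq_def Int_absorb2 Un_absorb2)+
  have distrib: "sup a (inf b c) = inf (sup a b) (sup a c)" for a b c :: pow_nat_mod_fin
    by transfer (simp add: fin_eq_def Un_Int_distrib)
  have bounds: "inf bot a = bot" "inf a top = a" for a :: pow_nat_mod_fin
    by (transfer, simp add: fin_eq_def)+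
  have compl: "inf a (- a) = bot" "sup a (- a) = top" for a :: pow_nat_mod_fin
    by (transfer, simp add: fin_eq_def)+
  have sup_inf: "inf a b = a \<longleftrightarrow> sup a b = b" for a b :: pow_nat_mod_fin
    by (metis absorb comm)
  show "OFCLASS(pow_nat_mod_fin, boolean_algebra_class)"
    by intro_classes
      (unfold less_eq_pow_nat_mod_fin_def less_pow_nat_mod_fin_def minus_pow_nat_mod_fin_def,
       (metis comm assoc idem absorb sup_inf bounds compl distrib)+)
qed

end


section \<open>Embeddings\<close>

definition boolean_algebra_hom :: "('a::boolean_algebra \<Rightarrow> 'b::boolean_algebra) \<Rightarrow> bool" where
  "boolean_algebra_hom h \<longleftrightarrow>
    h bot = bot \<and> h top = top \<and> (\<forall>a. h (- a) = - h a) \<and>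
    (\<forall>a b. h (inf a b) = inf (h a) (h b)) \<and> (\<forall>a b. h (sup a b) = sup (h a) (h b))"

definition boolean_algebra_embedding :: "('a::boolean_algebra \<Rightarrow> 'b::boolean_algebra) \<Rightarrow> bool" where
  "boolean_algebra_embedding h \<longleftrightarrow> boolean_algebra_hom h \<and> inj h"

end

theory Submission
  imports Defs
begin

text \<open>
  Lift an embedding to \<open>\<Phi>\<close>, mapping Borel sets to subsets of \<open>\<nat>\<close>, and cut the line into the columns
  \<open>[n, n + 1)\<close>. For a sequence of columns, each divided into finitely many dyadic intervals, the Open
  Colouring Axiom yields an infinite subsequence on which \<open>\<Phi>\<close> is completely additive: modulo finite
  sets, \<open>\<Phi> Z\<close> consists of the \<open>k\<close> whose assigned interval \<open>h k\<close> is contained in \<open>Z\<close>. Here the axiom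
  gives countably many functions, continuous by the choice of the colouring, that together cover
  the lifting; a diagonal argument and Baire category do the rest.

  The divisions along the branches of the tree of finite sequences are indexed by \<open>f : \<nat> \<rightarrow> \<nat>\<close>, the
  \<open>n\<close>-th column depending on \<open>f\<close> restricted to \<open>n\<close> and being divided according to \<open>f n\<close>. A second
  application of the axiom sorts all \<open>f\<close> into countably many classes such that, within one class, the
  intervals assigned to any \<open>k\<close> are nested. Hence countably many small intervals, of total length
  less than one in every column, capture all sufficiently short assigned intervals. Let \<open>K\<close> be
  the complement of their union. As \<open>K\<close> has positive measure in every column, some branch \<open>f\<close> passes
  only through \<open>k\<close> in \<open>\<Phi> K\<close> and divides finely enough for their intervals to be captured. The union
  of these intervals is disjoint from \<open>K\<close> although its image under \<open>\<Phi>\<close> meets \<open>\<Phi> K\<close> in an infinite set.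
\<close>

section \<open>The Open Colouring Axiom for coded sets\<close>

text \<open>Read as points of \<open>nat \<Rightarrow> real\<close>, the codes form a separable
  metrizable space. By \<open>op\<close>, finitely many coordinates secure \<open>R\<close> near
  each pair, so \<open>R\<close> is an open colouring. Both colourings used later are given in this
  form.\<close>

lemma OCA_coding:
  fixes \<phi> :: "'a \<Rightarrow> nat \<Rightarrow> 'v::countable" and R :: "'a \<Rightarrow> 'a \<Rightarrow> bool"
  assumes OCA and inj: "inj_on \<phi> X"
    and sym: "\<And>p q. R p q \<Longrightarrow> R q p" and irrefl: "\<And>p. \<not> R p p"
    and op: "\<And>p q. \<lbrakk>p \<in> X; q \<in> X; R p q\<rbrakk> \<Longrightarrow> \<exists>N. \<forall>p'\<in>X. \<forall>q'\<in>X.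
        (\<forall>i\<le>N. \<phi> p' i = \<phi> p i) \<longrightarrow> (\<forall>i\<le>N. \<phi> q' i = \<phi> q i) \<longrightarrow> R p' q'"
    and no_hom: "\<And>Y. \<lbrakk>Y \<subseteq> X; uncountable Y; \<And>p q. \<lbrakk>p \<in> Y; q \<in> Y; p \<noteq> q\<rbrakk> \<Longrightarrow> R p q\<rbrakk> \<Longrightarrow> False"
  obtains Z :: "nat \<Rightarrow> 'a set" where "X = (\<Union>n. Z n)" "\<And>n p q. \<lbrakk>p \<in> Z n; q \<in> Z n\<rbrakk> \<Longrightarrow> \<not> R p q"
proof -
  define \<psi> :: "'a \<Rightarrow> nat \<Rightarrow> real" where "\<psi> p = (\<lambda>i. real (to_nat (\<phi> p i)))" for p
  have \<psi>_eq: "\<psi> p i = \<psi> q i \<longleftrightarrow> \<phi> p i = \<phi> q i" for p q i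
    by (simp add: \<psi>_def)
  have inj\<psi>: "inj_on \<psi> X"
    using inj by (auto simp: inj_on_def fun_eq_iff \<psi>_eq)
  define T where "T = top_of_set (\<psi> ` X)"
  have T: "topspace T = \<psi> ` X"
    by (simp add: T_def)
  define K0 where "K0 = {{\<psi> p, \<psi> q} | p q. p \<in> X \<and> q \<in> X \<and> R p q}"
  have K0_iff: "{\<psi> p, \<psi> q} \<in> K0 \<longleftrightarrow> R p q" if "p \<in> X" "q \<in> X" for p q
    using that sym by (auto simp: K0_def doubleton_eq_iff inj_on_eq_iff[OF inj\<psi>])
  have "metrizable_space T"
    unfolding T_def by (intro metrizable_space_subtopology metrizable_space_euclidean)
  moreover have "second_countable T"
    unfolding T_def by (intro second_countable_subtopology)
      (metis ex_countable_basis second_countable_def open_openin topological_basisE topological_basis_open)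
  then have "separable_space T"
    by (rule second_countable_imp_separable_space)
  ultimately have ocp: "open_colouring_property T"
    using OCA_imp_open_colouring_property[OF \<open>OCA\<close>] by blast
  have sub: "K0 \<subseteq> [topspace T]\<^bsup>2\<^esup>"
    using irrefl by (auto simp: K0_def T inj_on_eq_iff[OF inj\<psi>])
  \<comment> \<open>The values of \<open>\<psi>\<close> are natural numbers, so an interval of
    radius 1/2 about one of them contains no other; cylinders are therefore relatively open.\<close>
  have cyl: "openin T {z \<in> \<psi> ` X. \<forall>i\<le>N. z i = \<psi> p i}" for p N
  proof -
    have "open ((\<lambda>z :: nat \<Rightarrow> real. z i) -` {\<psi> p i - 1/2 <..< \<psi> p i + 1/2})" for i
      by (intro open_vimage continuous_on_product_coordinates open_greaterThanLessThan)
    then have "open {z :: nat \<Rightarrow> real. z i \<in> {\<psi> p i - 1/2 <..< \<psi> p i + 1/2}}" for i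
      by (simp add: vimage_def)
    then have "open (\<Inter>i\<in>{..N}. {z :: nat \<Rightarrow> real. z i \<in> {\<psi> p i - 1/2 <..< \<psi> p i + 1/2}})"
      by (intro open_INT) auto
    moreover have "{z \<in> \<psi> ` X. \<forall>i\<le>N. z i = \<psi> p i} =
        \<psi> ` X \<inter> (\<Inter>i\<in>{..N}. {z. z i \<in> {\<psi> p i - 1/2 <..< \<psi> p i + 1/2}})"
    proof -
      have "real m \<in> {real n - 1/2 <..< real n + 1/2} \<longleftrightarrow> real m = real n" for m n
        using nat_less_real_le[of m n] nat_less_real_le[of n m] by (cases m n rule: linorder_cases) auto
      then have "\<psi> q i \<in> {\<psi> p i - 1/2 <..< \<psi> p i + 1/2} \<longleftrightarrow> \<psi> q i = \<psi> p i" for q i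
        unfolding \<psi>_def .
      then show ?thesis
        by (auto simp del: greaterThanLessThan_iff)
    qed
    ultimately show ?thesis
      unfolding T_def by (auto simp: openin_open)
  qed
  have "openin (prod_topology T T) {(x, y). x \<noteq> y \<and> {x, y} \<in> K0}"
    unfolding openin_prod_topology_alt
  proof (intro allI impI)
    fix x y assume "(x, y) \<in> {(x, y). x \<noteq> y \<and> {x, y} \<in> K0}"
    then have xy: "{x, y} \<in> K0"
      by simp
    then obtain p q where pq: "p \<in> X" "q \<in> X" "x = \<psi> p" "y = \<psi> q"
      unfolding K0_def by (auto simp: doubleton_eq_iff)
    with xy K0_iff have "R p q"
      by simp
    from op[OF pq(1,2) this] obtain N where N: "\<And>p' q'. \<lbrakk>p' \<in> X; q' \<in> X;
        \<forall>i\<le>N. \<phi> p' i = \<phi> p i; \<forall>i\<le>N. \<phi> q' i = \<phi> q i\<rbrakk> \<Longrightarrow> R p' q'"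
      by blast
    define U where "U p = {z \<in> \<psi> ` X. \<forall>i\<le>N. z i = \<psi> p i}" for p
    have "U p \<times> U q \<subseteq> {(x, y). x \<noteq> y \<and> {x, y} \<in> K0}"
    proof clarify
      fix a b assume "a \<in> U p" "b \<in> U q"
      then obtain p' q' where "p' \<in> X" "q' \<in> X" "a = \<psi> p'" "b = \<psi> q'"
        "\<forall>i\<le>N. \<phi> p' i = \<phi> p i" "\<forall>i\<le>N. \<phi> q' i = \<phi> q i"
        by (auto simp: U_def \<psi>_eq)
      moreover from this N have "R p' q'"
        by blast
      moreover from this irrefl have "p' \<noteq> q'"
        by blast
      ultimately show "a \<noteq> b \<and> {a, b} \<in> K0"
        using K0_iff by (simp add: inj_on_eq_iff[OF inj\<psi>])
    qed
    then show "\<exists>U V. openin T U \<and> openin T V \<and> x \<in> U \<and> y \<in> V \<and>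
        U \<times> V \<subseteq> {(x, y). x \<noteq> y \<and> {x, y} \<in> K0}"
      using cyl pq by (intro exI[of _ "U p"] exI[of _ "U q"]) (auto simp: U_def)
  qed
  then consider
      (unc) Y where "Y \<subseteq> topspace T" "uncountable Y" "[Y]\<^bsup>2\<^esup> \<subseteq> K0"
    | (cnt) \<Z> where "countable \<Z>" "\<Union>\<Z> = topspace T" "\<forall>Z\<in>\<Z>. [Z]\<^bsup>2\<^esup> \<subseteq> [topspace T]\<^bsup>2\<^esup> - K0"
    using ocp[unfolded open_colouring_property_def, rule_format, of K0 "[topspace T]\<^bsup>2\<^esup> - K0"] sub
    by blast
  then show thesis
  proof cases
    case unc
    define Y' where "Y' = {p \<in> X. \<psi> p \<in> Y}"
    have "\<psi> ` Y' = Y"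
      using unc(1) T by (auto simp: Y'_def)
    then have "uncountable Y'"
      using unc(2) by (metis countable_image)
    moreover have "R p q" if "p \<in> Y'" "q \<in> Y'" "p \<noteq> q" for p q
    proof -
      have "{\<psi> p, \<psi> q} \<in> [Y]\<^bsup>2\<^esup>"
        using that by (auto simp: Y'_def inj_on_eq_iff[OF inj\<psi>])
      with unc(3) have "{\<psi> p, \<psi> q} \<in> K0" ..
      then show ?thesis
        using K0_iff that by (simp add: Y'_def)
    qed
    ultimately have False
      using no_hom[of Y'] by (auto simp: Y'_def)
    then show thesis ..
  next
    case cnt
    \<comment> \<open>Inserting the empty set keeps the family nonempty, so that
      \<open>from_nat_into\<close> enumerates it even when \<open>\<Z>\<close> is empty.\<close>
    define Z where "Z n = {p \<in> X. \<psi> p \<in> from_nat_into (insert {} \<Z>) n}" for n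
    have ran: "range (from_nat_into (insert {} \<Z>)) = insert {} \<Z>"
      using cnt(1) by (intro range_from_nat_into) auto
    show thesis
    proof
      have "p \<in> (\<Union>n. Z n)" if "p \<in> X" for p
      proof -
        have "\<psi> p \<in> \<Union>\<Z>"
          using cnt(2) T \<open>p \<in> X\<close> by simp
        then obtain W where "W \<in> \<Z>" "\<psi> p \<in> W" ..
        then have "W \<in> range (from_nat_into (insert {} \<Z>))"
          unfolding ran by simp
        then obtain n where "from_nat_into (insert {} \<Z>) n = W"
          by auto
        with \<open>p \<in> X\<close> \<open>\<psi> p \<in> W\<close> show ?thesis
          by (auto simp: Z_def)
      qed
      then show "X = (\<Union>n. Z n)"
        by (auto simp: Z_def)
    next
      fix n p q assume pq: "p \<in> Z n" "q \<in> Z n"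
      show "\<not> R p q"
      proof
        assume "R p q"
        with irrefl have "p \<noteq> q" by blast
        define W where "W = from_nat_into (insert {} \<Z>) n"
        have W: "p \<in> X" "q \<in> X" "\<psi> p \<in> W" "\<psi> q \<in> W"
          using pq by (simp_all add: Z_def W_def)
        have "W \<in> insert {} \<Z>"
          unfolding W_def by (rule from_nat_into) simp
        with W have "W \<in> \<Z>"
          by (metis emptyE insertE)
        moreover have "{\<psi> p, \<psi> q} \<in> [W]\<^bsup>2\<^esup>"
          using W \<open>p \<noteq> q\<close> by (simp add: inj_on_eq_iff[OF inj\<psi>])
        ultimately have "{\<psi> p, \<psi> q} \<notin> K0"
          using cnt(3) by (meson DiffD2 subsetD)
        with K0_iff[OF W(1,2)] \<open>R p q\<close> show False
          by simp
      qed
    qed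
  qed
qed

section \<open>Fusion in products of finite sets\<close>

definition agree :: "nat \<Rightarrow> (nat \<Rightarrow> 'a) \<Rightarrow> (nat \<Rightarrow> 'a) \<Rightarrow> bool" where
  "agree l y y' \<longleftrightarrow> (\<forall>n<l. y n = y' n)"

lemma agree_refl [simp]: "agree l y y"
  by (simp add: agree_def)

lemma agree_sym: "agree l y y' \<Longrightarrow> agree l y' y"
  by (simp add: agree_def)

lemma agree_trans: "agree l y y' \<Longrightarrow> agree l y' y'' \<Longrightarrow> agree l y y''"
  by (simp add: agree_def)

text \<open>With discrete factors \<open>A n\<close>, the points agreeing with \<open>y\<close>
  below \<open>l\<close> form a basic open set of the product. The formula thus says that, within
  the product, \<open>D\<close> contains a dense open set.\<close>

definition dense_interior :: "(nat \<Rightarrow> 'a set) \<Rightarrow> (nat \<Rightarrow> 'a) set \<Rightarrow> bool" where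
  "dense_interior A D \<longleftrightarrow> (\<forall>y\<in>Pi UNIV A. \<forall>l. \<exists>y'\<in>Pi UNIV A. agree l y y' \<and>
     (\<exists>l'. \<forall>y''\<in>Pi UNIV A. agree l' y' y'' \<longrightarrow> y'' \<in> D))"

text \<open>Density of \<open>H\<close> in the basic open set that \<open>y\<close> and
  \<open>l\<close> determine.\<close>

definition dense_above :: "(nat \<Rightarrow> 'a set) \<Rightarrow> (nat \<Rightarrow> 'a) set \<Rightarrow> (nat \<Rightarrow> 'a) \<Rightarrow> nat \<Rightarrow> bool" where
  "dense_above A H y l \<longleftrightarrow> (\<forall>y'\<in>Pi UNIV A. agree l y y' \<longrightarrow>
     (\<forall>l'. \<exists>y''\<in>Pi UNIV A \<inter> H. agree l' y' y''))"

text \<open>The finitely many possible values on \<open>G\<close> are handled one after another;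
  each time the part outside \<open>G\<close> is lengthened until the points with these values on
  \<open>G\<close> are in \<open>D\<close>. Thus the coordinates in \<open>G\<close> stay
  free.\<close>

lemma dense_interior_finite_free:
  assumes finA: "\<And>n. finite (A n)" and D: "dense_interior A D"
    and z: "z \<in> Pi UNIV A" and G: "G \<subseteq> {..<l}"
  shows "\<exists>z'\<in>Pi UNIV A. agree l z z' \<and> (\<exists>l'\<ge>l. \<forall>y\<in>Pi UNIV A.
      (\<forall>n<l'. n \<notin> G \<longrightarrow> y n = z' n) \<longrightarrow> y \<in> D)"
proof -
  have "finite G"
    using G finite_subset by blast
  then have fin: "finite (PiE G A)"
    using finA by (intro finite_PiE)
  \<comment> \<open>\<open>Q\<close> holds the assignments of values on \<open>G\<close> that are
    already handled.\<close>
  have "\<exists>z'\<in>Pi UNIV A. agree l z z' \<and> (\<exists>l'\<ge>l. \<forall>y\<in>Pi UNIV A.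
      (\<forall>n<l'. n \<notin> G \<longrightarrow> y n = z' n) \<longrightarrow> restrict y G \<in> Q \<longrightarrow> y \<in> D)"
    if "finite Q" "Q \<subseteq> PiE G A" for Q
    using that
  proof (induction Q rule: finite_induct)
    case empty
    show ?case
      using z by (intro bexI[of _ z]) auto
  next
    case (insert q Q)
    then have "Q \<subseteq> PiE G A"
      by simp
    from insert.IH[OF this] obtain z' l' where z': "z' \<in> Pi UNIV A" "agree l z z'" "l \<le> l'"
      and IH: "\<And>y. \<lbrakk>y \<in> Pi UNIV A; \<forall>n<l'. n \<notin> G \<longrightarrow> y n = z' n; restrict y G \<in> Q\<rbrakk> \<Longrightarrow> y \<in> D"
      by blast
    define y0 where "y0 n = (if n \<in> G then q n else z' n)" for n
    have "y0 \<in> Pi UNIV A"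
      using z' insert.prems by (auto simp: y0_def PiE_def Pi_def)
    with D obtain y1 l1 where y1: "y1 \<in> Pi UNIV A" "agree l' y0 y1"
      "\<And>y. \<lbrakk>y \<in> Pi UNIV A; agree l1 y1 y\<rbrakk> \<Longrightarrow> y \<in> D"
      unfolding dense_interior_def by blast
    \<comment> \<open>Outside \<open>G\<close> the new point follows \<open>y1\<close>. On
      \<open>G\<close> it returns to \<open>z'\<close>, since agreement with \<open>z\<close> below
      \<open>l\<close> concerns these coordinates as well.\<close>
    define z2 where "z2 n = (if n \<in> G then z' n else y1 n)" for n
    have z2_z': "z2 n = z' n" if "n < l'" for n
      using y1(2) that by (auto simp: z2_def agree_def y0_def)
    have "z2 \<in> Pi UNIV A"
      using z' y1 by (auto simp: z2_def Pi_def)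
    moreover have "agree l z z2"
      using z' z2_z' by (auto simp: agree_def)
    moreover have "y \<in> D" if y: "y \<in> Pi UNIV A" "\<forall>n<max l' l1. n \<notin> G \<longrightarrow> y n = z2 n"
      "restrict y G \<in> insert q Q" for y
    proof (cases "restrict y G = q")
      case True
      have "y n = y1 n" if "n < l1" for n
      proof (cases "n \<in> G")
        case T: True
        then have "n < l'"
          using G z'(3) by auto
        then have "y0 n = y1 n"
          using y1(2) by (simp add: agree_def)
        then have "y1 n = q n"
          using T by (simp add: y0_def)
        moreover have "restrict y G n = q n"
          using True by simp
        ultimately show ?thesis
          using T by simp
      next
        case False
        with y(2) that show ?thesis
          by (simp add: z2_def)
      qed
      then show ?thesis
        using y1(3)[OF y(1)] by (simp add: agree_def)
    next
      case False
      with y z2_z' show ?thesis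
        by (intro IH) auto
    qed
    moreover have "l \<le> max l' l1"
      using z'(3) by simp
    ultimately show ?case
      by blast
  qed
  from this[OF fin] obtain z' l' where "z' \<in> Pi UNIV A" "agree l z z'" "l \<le> l'"
    "\<And>y. \<lbrakk>y \<in> Pi UNIV A; \<forall>n<l'. n \<notin> G \<longrightarrow> y n = z' n; restrict y G \<in> PiE G A\<rbrakk> \<Longrightarrow> y \<in> D"
    by auto
  moreover have "restrict y G \<in> PiE G A" if "y \<in> Pi UNIV A" for y
    using that by auto
  ultimately show ?thesis
    by (intro bexI[of _ z'] conjI exI[of _ l']) auto
qed

text \<open>Stage \<open>r\<close> secures \<open>D r\<close> for all values on the coordinates
  freed so far, then frees one more coordinate of \<open>f\<close> beyond everything fixed. In the
  limit an infinite set stays free, which strengthens the Baire category theorem.\<close>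

lemma fusion:
  assumes finA: "\<And>n. finite (A n)" and D: "\<And>r::nat. dense_interior A (D r)"
    and f: "infinite (f :: nat set)" and z0: "z0 \<in> Pi UNIV A"
  obtains z g where "z \<in> Pi UNIV A" "g \<subseteq> f" "infinite g"
    "\<And>y r. \<lbrakk>y \<in> Pi UNIV A; \<And>n. n \<notin> g \<Longrightarrow> y n = z n\<rbrakk> \<Longrightarrow> y \<in> D r"
proof -
  \<comment> \<open>In a state \<open>(z, l, G)\<close>, \<open>z\<close> is settled at the
    coordinates below \<open>l\<close> outside \<open>G\<close>, and \<open>G\<close> contains the
    free coordinates chosen so far.\<close>
  define P where "P = (\<lambda>(z, l, G). z \<in> Pi UNIV A \<and> G \<subseteq> {..<l} \<inter> f)"
  define Q where "Q = (\<lambda>r (z, l :: nat, G) (z', l', G'). agree l z z' \<and> l < l' \<and> G' \<inter> {..<l} = G \<and>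
      G \<subseteq> G' \<and> (\<exists>c\<ge>l. c \<in> G') \<and> (\<forall>y\<in>Pi UNIV A. (\<forall>n<l'. n \<notin> G' \<longrightarrow> y n = z' n) \<longrightarrow> y \<in> D r))"
  have ex: "\<exists>s'. P s' \<and> Q r s s'" if "P s" for r s
  proof -
    obtain z l G where s: "s = (z, l, G)"
      by (cases s)
    with that have "z \<in> Pi UNIV A" "G \<subseteq> {..<l}" "G \<subseteq> f"
      by (auto simp: P_def)
    from dense_interior_finite_free[OF finA D[of r] this(1,2)]
    obtain z' l' where z': "z' \<in> Pi UNIV A" "agree l z z'" "l \<le> l'"
      "\<And>y. \<lbrakk>y \<in> Pi UNIV A; \<forall>n<l'. n \<notin> G \<longrightarrow> y n = z' n\<rbrakk> \<Longrightarrow> y \<in> D r"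
      by blast
    obtain c where c: "c \<ge> l'" "c \<in> f"
      using f infinite_nat_iff_unbounded_le by blast
    have "P (z', Suc c, insert c G)"
      using z' c \<open>G \<subseteq> {..<l}\<close> \<open>G \<subseteq> f\<close> by (auto simp: P_def)
    moreover have "Q r s (z', Suc c, insert c G)"
      using z' c \<open>G \<subseteq> {..<l}\<close> by (auto simp: Q_def s intro!: exI[of _ c])
    ultimately show ?thesis
      by blast
  qed
  have "P (z0, 0, {})"
    using z0 by (simp add: P_def)
  then obtain S where PS: "\<And>r. P (S r)" and QS: "\<And>r. Q r (S r) (S (Suc r))"
    using dependent_nat_choice[of "\<lambda>_. P" Q] ex by blast
  define zz where "zz r = fst (S r)" for r
  define ll where "ll r = fst (snd (S r))" for r
  define gg where "gg r = snd (snd (S r))" for r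
  have S: "S r = (zz r, ll r, gg r)" for r
    by (simp add: zz_def ll_def gg_def)
  have P': "zz r \<in> Pi UNIV A" "gg r \<subseteq> {..<ll r}" "gg r \<subseteq> f" for r
    using PS[of r] by (auto simp: S P_def)
  have Q': "agree (ll r) (zz r) (zz (Suc r))" "ll r < ll (Suc r)" "gg (Suc r) \<inter> {..<ll r} = gg r"
    "gg r \<subseteq> gg (Suc r)" "\<exists>c\<ge>ll r. c \<in> gg (Suc r)"
    "\<And>y. \<lbrakk>y \<in> Pi UNIV A; \<forall>n<ll (Suc r). n \<notin> gg (Suc r) \<longrightarrow> y n = zz (Suc r) n\<rbrakk> \<Longrightarrow> y \<in> D r" for r
    using QS[of r] by (auto simp: S Q_def)
  have ll: "strict_mono ll"
    using Q'(2) by (simp add: strict_mono_Suc_iff)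
  then have ll_ge: "r \<le> ll r" for r
    by (rule strict_mono_imp_increasing)
  have coh: "agree (ll r) (zz r) (zz (r + k)) \<and> gg (r + k) \<inter> {..<ll r} = gg r" for r k
  proof (induction k)
    case (Suc k)
    have "ll r \<le> ll (r + k)"
      using ll by (simp add: strict_mono_less_eq)
    then show ?case
      using Suc Q'(1)[of "r + k"] Q'(3)[of "r + k"] by (auto simp: agree_def)
  qed (use P' in auto)
  \<comment> \<open>Coordinate \<open>n\<close> no longer changes from stage \<open>Suc n\<close>
    on, since \<open>n < ll (Suc n)\<close>.\<close>
  define z where "z n = zz (Suc n) n" for n
  define g where "g = (\<Union>r. gg r)"
  have z_eq: "z n = zz r n" if "n < ll r" for n r
  proof (cases "r \<le> Suc n")
    case True
    then show ?thesis
      using coh[of r "Suc n - r"] that by (simp add: z_def agree_def)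
  next
    case False
    moreover have "n < ll (Suc n)"
      using ll_ge[of "Suc n"] by simp
    ultimately show ?thesis
      using coh[of "Suc n" "r - Suc n"] by (simp add: z_def agree_def)
  qed
  have g_eq: "g \<inter> {..<ll r} = gg r" for r
  proof -
    have "gg r' \<inter> {..<ll r} \<subseteq> gg r" for r'
    proof (cases "r \<le> r'")
      case True
      then show ?thesis
        using coh[of r "r' - r"] by auto
    next
      case False
      then have "r' \<le> r" by simp
      then show ?thesis
        using coh[of r' "r - r'"] by auto
    qed
    then show ?thesis
      using P'(2) by (auto simp: g_def)
  qed
  show thesis
  proof
    show "z \<in> Pi UNIV A"
      using P'(1) by (auto simp: z_def Pi_def)
    show "g \<subseteq> f"
      using P'(3) by (auto simp: g_def)
    have "\<exists>c\<ge>n. c \<in> g" for n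
    proof -
      obtain c where "c \<ge> ll n" "c \<in> gg (Suc n)"
        using Q'(5) by blast
      then show ?thesis
        using ll_ge[of n] by (intro exI[of _ c]) (auto simp: g_def)
    qed
    then show "infinite g"
      using infinite_nat_iff_unbounded_le by blast
    fix y r assume y: "y \<in> Pi UNIV A" "\<And>n. n \<notin> g \<Longrightarrow> y n = z n"
    have "y n = zz (Suc r) n" if "n < ll (Suc r)" "n \<notin> gg (Suc r)" for n
    proof -
      have "n \<notin> g"
        using g_eq[of "Suc r"] that by auto
      then show ?thesis
        using y(2) z_eq that by simp
    qed
    then show "y \<in> D r"
      using Q'(6)[OF y(1)] by blast
  qed
qed

lemma not_dense_interior_compl:
  assumes "\<And>y l. y \<in> Pi UNIV A \<Longrightarrow> \<not> dense_above A H y l"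
  shows "dense_interior A (- H)"
  using assms unfolding dense_interior_def dense_above_def by blast

text \<open>Baire category: if every \<open>H j\<close> were nowhere dense, the complements would
  contain dense open sets, and fusion would give a point outside all of them.\<close>

lemma somewhere_dense:
  assumes finA: "\<And>n. finite (A n)" and ne: "Pi UNIV A \<noteq> {}" and cov: "Pi UNIV A \<subseteq> (\<Union>j::nat. H j)"
  obtains j y l where "y \<in> Pi UNIV A" "dense_above A (H j) y l"
proof (rule ccontr)
  assume "\<not> thesis"
  with that have D: "dense_interior A (- H j)" for j
    by (intro not_dense_interior_compl) blast
  obtain z0 where z0: "z0 \<in> Pi UNIV A"
    using ne by blast
  obtain z g where z: "z \<in> Pi UNIV A"
    and zg: "\<And>y r. \<lbrakk>y \<in> Pi UNIV A; \<And>n. n \<notin> g \<Longrightarrow> y n = z n\<rbrakk> \<Longrightarrow> y \<in> - H r"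
    by (rule fusion[where A = A and D = "\<lambda>j. - H j", OF finA D infinite_UNIV_nat z0]) blast
  have "z \<in> - H r" for r
    using z by (rule zg) simp
  with cov z show False
    by blast
qed

text \<open>If no piece works, extending the partial points one after the other, always leaving an
  infinite free set, produces a point that lies in none of the pieces.\<close>

lemma extendible_piece:
  assumes z0: "z0 \<in> Pi UNIV A" and g0: "infinite (g0 :: nat set)"
    and cov: "\<And>y. \<lbrakk>y \<in> Pi UNIV A; \<And>n. n \<notin> g0 \<Longrightarrow> y n = z0 n\<rbrakk> \<Longrightarrow> \<exists>j::nat. y \<in> H j"
  obtains j z c where "z \<in> Pi UNIV A" "\<And>n. n \<notin> g0 \<Longrightarrow> z n = z0 n" "infinite c" "c \<subseteq> g0"
    "\<And>x e. \<lbrakk>x \<in> Pi UNIV A; \<And>n. n \<notin> c \<Longrightarrow> x n = z n; infinite e; e \<subseteq> c\<rbrakk> \<Longrightarrow>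
        \<exists>y\<in>Pi UNIV A \<inter> H j. \<forall>n. n \<notin> e \<longrightarrow> y n = x n"
proof (rule ccontr)
  assume contra: "\<not> thesis"
  note extendible = that
  \<comment> \<open>A state consists of a point and an infinite set of coordinates still to be
    fixed. Step \<open>j\<close> fixes more coordinates in such a way that no choice on the rest
    leads into \<open>H j\<close>.\<close>
  define P where "P = (\<lambda>(z, c). z \<in> Pi UNIV A \<and> (\<forall>n. n \<notin> g0 \<longrightarrow> z n = z0 n) \<and> infinite c \<and> c \<subseteq> g0)"
  define Q where "Q = (\<lambda>j (z, c) (x, e). (\<forall>n. n \<notin> c \<longrightarrow> x n = z n) \<and> e \<subseteq> c \<and>
      \<not> (\<exists>y\<in>Pi UNIV A \<inter> H j. \<forall>n. n \<notin> e \<longrightarrow> y n = x n))"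
  have ex: "\<exists>s'. P s' \<and> Q j s s'" if "P s" for j s
  proof -
    obtain z c where s: "s = (z, c)"
      by (cases s)
    with that have zc: "z \<in> Pi UNIV A" "\<And>n. n \<notin> g0 \<Longrightarrow> z n = z0 n" "infinite c" "c \<subseteq> g0"
      by (auto simp: P_def)
    then obtain x e where xe: "x \<in> Pi UNIV A" "\<And>n. n \<notin> c \<Longrightarrow> x n = z n" "infinite e" "e \<subseteq> c"
      "\<not> (\<exists>y\<in>Pi UNIV A \<inter> H j. \<forall>n. n \<notin> e \<longrightarrow> y n = x n)"
      using contra extendible[of z c j] by blast
    have "x n = z0 n" if "n \<notin> g0" for n
      using that xe(2)[of n] zc(2)[of n] zc(4) by auto
    with xe zc(4) have "P (x, e)" "Q j s (x, e)"
      by (auto simp: P_def Q_def s)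
    then show ?thesis
      by blast
  qed
  have "P (z0, g0)"
    using z0 g0 by (simp add: P_def)
  then obtain S where S0: "\<And>r. P (S r)" and QS: "\<And>r. Q r (S r) (S (Suc r))"
    using dependent_nat_choice[of "\<lambda>_. P" Q] ex by blast
  define zz where "zz r = fst (S r)" for r
  define cc where "cc r = snd (S r)" for r
  have S: "S r = (zz r, cc r)" for r
    by (simp add: zz_def cc_def)
  have P': "zz r \<in> Pi UNIV A" "\<And>n. n \<notin> g0 \<Longrightarrow> zz r n = z0 n" "cc r \<subseteq> g0" for r
    using S0[of r] by (auto simp: S P_def)
  have Q': "\<And>n. n \<notin> cc r \<Longrightarrow> zz (Suc r) n = zz r n" "cc (Suc r) \<subseteq> cc r"
    "\<not> (\<exists>y\<in>Pi UNIV A \<inter> H r. \<forall>n. n \<notin> cc (Suc r) \<longrightarrow> y n = zz (Suc r) n)" for r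
    using QS[of r] by (auto simp: S Q_def)
  have step: "zz (r + k) n = zz r n \<and> n \<notin> cc (r + k)" if "n \<notin> cc r" for r k n
    by (induction k) (use that Q' in auto)
  \<comment> \<open>Each coordinate takes the value with which it was first fixed; coordinates that
    are never fixed take the value of \<open>z0\<close>.\<close>
  define y where "y n = (if \<exists>r. n \<notin> cc r then zz (LEAST r. n \<notin> cc r) n else z0 n)" for n
  have y_eq: "y n = zz r n" if "n \<notin> cc r" for n r
  proof -
    define m where "m = (LEAST r. n \<notin> cc r)"
    have "n \<notin> cc m" "m \<le> r"
      unfolding m_def using that LeastI[of "\<lambda>r. n \<notin> cc r"] Least_le[of "\<lambda>r. n \<notin> cc r"] by blast+
    then have "zz r n = zz m n"
      using step[of n m "r - m"] by simp
    with that show ?thesis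
      by (auto simp: y_def m_def)
  qed
  have "y \<in> Pi UNIV A"
    using P'(1) z0 by (auto simp: y_def Pi_def)
  moreover have "y n = z0 n" if "n \<notin> g0" for n
    using y_eq[of n 0] P'(2)[OF that, of 0] P'(3)[of 0] that by auto
  ultimately obtain j where "y \<in> H j"
    using cov by blast
  then show False
    using Q'(3)[of j] y_eq[of _ "Suc j"] \<open>y \<in> Pi UNIV A\<close> by blast
qed

section \<open>Homomorphisms modulo finite sets\<close>

text \<open>"Eventually in \<open>k\<close>" expresses equality modulo finite sets, so
  \<open>\<Psi>\<close> lifts a map into P(N)/fin that preserves bottom, meets and joins. Top is
  left out because the liftings considered are cut down to a part of the line.\<close>

definition fin_hom :: "('s set \<Rightarrow> nat set) \<Rightarrow> bool" where
  "fin_hom \<Psi> \<longleftrightarrow> (\<forall>\<^sub>F k in sequentially. k \<notin> \<Psi> {}) \<and>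
     (\<forall>x y. \<forall>\<^sub>F k in sequentially. k \<in> \<Psi> (x \<inter> y) \<longleftrightarrow> k \<in> \<Psi> x \<and> k \<in> \<Psi> y) \<and>
     (\<forall>x y. \<forall>\<^sub>F k in sequentially. k \<in> \<Psi> (x \<union> y) \<longleftrightarrow> k \<in> \<Psi> x \<or> k \<in> \<Psi> y)"

lemma fin_homD:
  assumes "fin_hom \<Psi>"
  shows fin_hom_empty: "\<forall>\<^sub>F k in sequentially. k \<notin> \<Psi> {}"
    and fin_hom_Int: "\<forall>\<^sub>F k in sequentially. k \<in> \<Psi> (x \<inter> y) \<longleftrightarrow> k \<in> \<Psi> x \<and> k \<in> \<Psi> y"
    and fin_hom_Un: "\<forall>\<^sub>F k in sequentially. k \<in> \<Psi> (x \<union> y) \<longleftrightarrow> k \<in> \<Psi> x \<or> k \<in> \<Psi> y"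
  using assms unfolding fin_hom_def by blast+

lemma fin_hom_mono:
  assumes "fin_hom \<Psi>" "x \<subseteq> y"
  shows "\<forall>\<^sub>F k in sequentially. k \<in> \<Psi> x \<longrightarrow> k \<in> \<Psi> y"
  using fin_hom_Int[OF assms(1), of x y] by eventually_elim (use assms(2) in \<open>auto simp: Int_absorb2\<close>)

lemma fin_hom_disjoint:
  assumes "fin_hom \<Psi>" "x \<inter> y = {}"
  shows "\<forall>\<^sub>F k in sequentially. \<not> (k \<in> \<Psi> x \<and> k \<in> \<Psi> y)"
  using fin_hom_Int[OF assms(1), of x y] fin_hom_empty[OF assms(1)]
  by eventually_elim (use assms(2) in auto)

section \<open>Partitions into three sets and principal ultrafilters\<close>

definition exactly_one :: "bool \<Rightarrow> bool \<Rightarrow> bool \<Rightarrow> bool" where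
  "exactly_one a b c \<longleftrightarrow> a \<and> \<not> b \<and> \<not> c \<or> \<not> a \<and> b \<and> \<not> c \<or> \<not> a \<and> \<not> b \<and> c"

definition partition3 :: "'s set \<Rightarrow> 's set \<Rightarrow> 's set \<Rightarrow> 's set \<Rightarrow> bool" where
  "partition3 T P Q R \<longleftrightarrow> P \<union> Q \<union> R = T \<and> P \<inter> Q = {} \<and> P \<inter> R = {} \<and> Q \<inter> R = {}"

text \<open>The predicates may differ, as each will carry its own fixed initial part. Partitions
  with empty members show that they agree on subsets of \<open>T\<close>, whence \<open>e1\<close>
  is an ultrafilter on \<open>T\<close>; the finite member \<open>F\<close> makes it
  principal.\<close>

lemma partition3_principal:
  assumes part: "\<And>P Q R. partition3 T P Q R \<Longrightarrow> exactly_one (e1 P) (e2 Q) (e3 R)"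
    and e1: "\<not> e1 {}" "e1 T" and F: "finite F" "F \<subseteq> T" "e1 F"
  shows "\<exists>s\<in>T. \<forall>Z\<subseteq>T. e1 Z \<longleftrightarrow> s \<in> Z"
proof -
  have e23: "\<not> e2 {}" "\<not> e3 {}"
    using part[of T "{}" "{}"] e1 by (auto simp: partition3_def exactly_one_def)
  have e1_e3: "e1 Z \<longleftrightarrow> \<not> e3 (T - Z)" and e1_e2: "e1 Z \<longleftrightarrow> \<not> e2 (T - Z)"
    and e2_e3: "e2 Z \<longleftrightarrow> \<not> e3 (T - Z)" if "Z \<subseteq> T" for Z
  proof -
    have "partition3 T Z {} (T - Z)" "partition3 T Z (T - Z) {}" "partition3 T {} Z (T - Z)"
      using that by (auto simp: partition3_def)
    then show "e1 Z \<longleftrightarrow> \<not> e3 (T - Z)" "e1 Z \<longleftrightarrow> \<not> e2 (T - Z)" "e2 Z \<longleftrightarrow> \<not> e3 (T - Z)"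
      using part e1 e23 unfolding exactly_one_def by blast+
  qed
  have e2: "e2 Z \<longleftrightarrow> e1 Z" if "Z \<subseteq> T" for Z
    using e1_e3 e2_e3 that by blast
  have e3: "e3 Z \<longleftrightarrow> e1 Z" if "Z \<subseteq> T" for Z
    using e1_e3[of "T - Z"] e1_e2[of "T - Z"] e2[of Z] that by (simp add: double_diff)
  have e1_Un: "e1 (P \<union> Q) \<longleftrightarrow> e1 P \<or> e1 Q" and e1_disj: "\<not> (e1 P \<and> e1 Q)"
    if "P \<inter> Q = {}" "P \<subseteq> T" "Q \<subseteq> T" for P Q
  proof -
    have "partition3 T P Q (T - (P \<union> Q))"
      using that by (auto simp: partition3_def)
    from part[OF this] have "exactly_one (e1 P) (e1 Q) (e3 (T - (P \<union> Q)))"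
      using e2[OF that(3)] by simp
    moreover have "e1 (P \<union> Q) \<longleftrightarrow> \<not> e3 (T - (P \<union> Q))"
      using e1_e3[of "P \<union> Q"] that by simp
    ultimately show "e1 (P \<union> Q) \<longleftrightarrow> e1 P \<or> e1 Q" "\<not> (e1 P \<and> e1 Q)"
      by (auto simp: exactly_one_def)
  qed
  have "\<exists>s\<in>F. e1 {s}"
    using F
  proof (induction F rule: finite_induct)
    case (insert s F)
    then show ?case
      using e1_Un[of "{s}" F] by auto
  qed (use e1 in simp)
  then obtain s where s: "s \<in> T" "e1 {s}"
    using F(2) by blast
  have "e1 Z \<longleftrightarrow> s \<in> Z" if "Z \<subseteq> T" for Z
  proof
    assume "e1 Z"
    show "s \<in> Z"
    proof (rule ccontr)
      assume "s \<notin> Z"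
      then show False
        using e1_disj[of "{s}" Z] s that \<open>e1 Z\<close> by simp
    qed
  next
    assume "s \<in> Z"
    then show "e1 Z"
      using e1_Un[of "{s}" "Z - {s}"] s that by (simp add: insert_absorb subset_iff)
  qed
  with s(1) show ?thesis
    by blast
qed

text \<open>By the Baire category theorem, the lifting respects all partitions into three sets that extend
  a fixed finite one. Hence, for almost every \<open>k\<close>, the sets \<open>Z\<close> with \<open>k \<in> \<Theta> Z\<close> form an
  ultrafilter, which is principal by continuity.\<close>

lemma continuous_lifting_principal:
  fixes B :: "nat \<Rightarrow> 's set" and \<Theta> \<Psi> :: "'s set \<Rightarrow> nat set"
  defines "S \<equiv> \<Union>n. B n"
  assumes hom: "fin_hom \<Psi>" and finB: "\<And>n. finite (B n)"
    and disj: "\<And>n m. n \<noteq> m \<Longrightarrow> B n \<inter> B m = {}"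
    and lift: "\<And>Z. Z \<subseteq> S \<Longrightarrow> \<forall>\<^sub>F k in sequentially. k \<in> \<Psi> Z \<longleftrightarrow> k \<in> \<Theta> Z \<and> k \<in> \<Psi> S"
    and cont: "\<And>k. \<exists>M. \<forall>Z Z'. Z \<subseteq> S \<longrightarrow> Z' \<subseteq> S \<longrightarrow> (\<forall>n<M. Z \<inter> B n = Z' \<inter> B n) \<longrightarrow>
        (k \<in> \<Theta> Z \<longleftrightarrow> k \<in> \<Theta> Z')"
  obtains l \<Omega> h where "\<And>Z. Z \<subseteq> (\<Union>n\<in>{l..}. B n) \<Longrightarrow>
      \<forall>\<^sub>F k in sequentially. k \<in> \<Psi> Z \<longleftrightarrow> k \<in> \<Omega> \<and> h k \<in> Z"
proof -
  \<comment> \<open>Points of the product of the \<open>A n\<close> are the partitions of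
    \<open>S\<close> into three sets, given block by block; \<open>V1\<close>, \<open>V2\<close> and
    \<open>V3\<close> recover the three sets.\<close>
  define A where "A n = {(p, q, r). partition3 (B n) p q r}" for n
  define V1 where "V1 v = (\<Union>n. fst (v n))" for v :: "nat \<Rightarrow> 's set \<times> 's set \<times> 's set"
  define V2 where "V2 v = (\<Union>n. fst (snd (v n)))" for v :: "nat \<Rightarrow> 's set \<times> 's set \<times> 's set"
  define V3 where "V3 v = (\<Union>n. snd (snd (v n)))" for v :: "nat \<Rightarrow> 's set \<times> 's set \<times> 's set"
  have finA: "finite (A n)" for n
  proof (rule finite_subset)
    show "A n \<subseteq> Pow (B n) \<times> Pow (B n) \<times> Pow (B n)"
      by (auto simp: A_def partition3_def)
  qed (use finB in simp)
  have vn: "fst (v n) \<union> fst (snd (v n)) \<union> snd (snd (v n)) = B n"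
    "fst (v n) \<inter> fst (snd (v n)) = {}" "fst (v n) \<inter> snd (snd (v n)) = {}"
    "fst (snd (v n)) \<inter> snd (snd (v n)) = {}" if "v \<in> Pi UNIV A" for v n
  proof -
    have "v n \<in> A n"
      using that by auto
    then show "fst (v n) \<union> fst (snd (v n)) \<union> snd (snd (v n)) = B n"
      "fst (v n) \<inter> fst (snd (v n)) = {}" "fst (v n) \<inter> snd (snd (v n)) = {}"
      "fst (snd (v n)) \<inter> snd (snd (v n)) = {}"
      by (auto simp: A_def partition3_def split: prod.splits)
  qed
  have V_sub: "V1 v \<subseteq> S" "V2 v \<subseteq> S" "V3 v \<subseteq> S" if "v \<in> Pi UNIV A" for v
    using vn(1)[OF that] by (auto simp: V1_def V2_def V3_def S_def)
  have V_B: "V1 v \<inter> B n = fst (v n)" "V2 v \<inter> B n = fst (snd (v n))" "V3 v \<inter> B n = snd (snd (v n))"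
    if v: "v \<in> Pi UNIV A" for v n
  proof -
    have *: "(\<Union>m. x m) \<inter> B n = x n" if x: "\<And>m. x m \<subseteq> B m" for x :: "nat \<Rightarrow> 's set"
    proof -
      have "m = n" if "a \<in> x m" "a \<in> B n" for a m
        using that x[of m] disj[of m n] by blast
      then show ?thesis
        using x[of n] by blast
    qed
    show "V1 v \<inter> B n = fst (v n)" "V2 v \<inter> B n = fst (snd (v n))" "V3 v \<inter> B n = snd (snd (v n))"
      unfolding V1_def V2_def V3_def by (rule *; use vn(1)[OF v] in blast)+
  qed
  have V_part: "partition3 S (V1 v) (V2 v) (V3 v)" if v: "v \<in> Pi UNIV A" for v
  proof -
    have "x \<in> V1 v \<union> V2 v \<union> V3 v \<and> \<not> (x \<in> V1 v \<and> x \<in> V2 v) \<and> \<not> (x \<in> V1 v \<and> x \<in> V3 v) \<and>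
        \<not> (x \<in> V2 v \<and> x \<in> V3 v)" if "x \<in> S" for x
    proof -
      obtain n where "x \<in> B n"
        using \<open>x \<in> S\<close> by (auto simp: S_def)
      then have "x \<in> V1 v \<longleftrightarrow> x \<in> fst (v n)" "x \<in> V2 v \<longleftrightarrow> x \<in> fst (snd (v n))"
        "x \<in> V3 v \<longleftrightarrow> x \<in> snd (snd (v n))"
        using V_B[OF v, of n] by blast+
      then show ?thesis
        using vn[OF v, of n] \<open>x \<in> B n\<close> by blast
    qed
    then show ?thesis
      using V_sub[OF v] unfolding partition3_def by blast
  qed
  define one where "one v k = exactly_one (k \<in> \<Theta> (V1 v)) (k \<in> \<Theta> (V2 v)) (k \<in> \<Theta> (V3 v))" for v k
  have ev_one: "\<forall>\<^sub>F k in sequentially. k \<in> \<Psi> S \<longrightarrow> one v k" if v: "v \<in> Pi UNIV A" for v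
  proof -
    have S: "S = V1 v \<union> (V2 v \<union> V3 v)" and D: "V1 v \<inter> V2 v = {}" "V1 v \<inter> V3 v = {}" "V2 v \<inter> V3 v = {}"
      using V_part[OF v] unfolding partition3_def by auto
    have "\<forall>\<^sub>F k in sequentially. k \<in> \<Psi> S \<longleftrightarrow> k \<in> \<Psi> (V1 v) \<or> k \<in> \<Psi> (V2 v) \<or> k \<in> \<Psi> (V3 v)"
      using fin_hom_Un[OF hom, of "V1 v" "V2 v \<union> V3 v"] fin_hom_Un[OF hom, of "V2 v" "V3 v"]
      unfolding S[symmetric] by eventually_elim blast
    with fin_hom_disjoint[OF hom D(1)] fin_hom_disjoint[OF hom D(2)] fin_hom_disjoint[OF hom D(3)]
      lift[OF V_sub(1)[OF v]] lift[OF V_sub(2)[OF v]] lift[OF V_sub(3)[OF v]]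
    show ?thesis
      unfolding one_def exactly_one_def by eventually_elim blast
  qed
  define D where "D m = {v. \<exists>k\<ge>m. k \<in> \<Psi> S \<and> \<not> one v k}" for m
  \<comment> \<open>Otherwise fusion would produce a single partition at which
    \<open>\<Theta>\<close> fails for arbitrarily large \<open>k\<close>, against
    \<open>ev_one\<close>.\<close>
  have "\<exists>m. \<not> dense_interior A (D m)"
  proof (rule ccontr)
    assume "\<not> ?thesis"
    then have D: "dense_interior A (D m)" for m
      by blast
    have z0: "(\<lambda>n. (B n, {}, {})) \<in> Pi UNIV A"
      by (auto simp: A_def partition3_def)
    obtain v g where v: "v \<in> Pi UNIV A" and
      vg: "\<And>y m. \<lbrakk>y \<in> Pi UNIV A; \<And>n. n \<notin> g \<Longrightarrow> y n = v n\<rbrakk> \<Longrightarrow> y \<in> D m"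
      by (rule fusion[where A = A and D = D, OF finA D infinite_UNIV_nat z0]) blast
    have "v \<in> D m" for m
      using v by (rule vg) simp
    then show False
      using ev_one[OF v] by (auto simp: D_def eventually_sequentially)
  qed
  then obtain m v0 l where v0: "v0 \<in> Pi UNIV A"
    and nd: "\<And>v l'. \<lbrakk>v \<in> Pi UNIV A; agree l v0 v\<rbrakk> \<Longrightarrow> \<exists>v'\<in>Pi UNIV A. agree l' v v' \<and> v' \<notin> D m"
    unfolding dense_interior_def by blast
  \<comment> \<open>By continuity \<open>one v k\<close> involves only finitely many blocks, and it
    holds on a dense set of points that agree with \<open>v0\<close> below \<open>l\<close>. Hence
    it holds for all of them.\<close>
  have one: "one v k" if v: "v \<in> Pi UNIV A" "agree l v0 v" and k: "k \<ge> m" "k \<in> \<Psi> S" for v k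
  proof -
    obtain M where M: "\<And>Z Z'. \<lbrakk>Z \<subseteq> S; Z' \<subseteq> S; \<forall>n<M. Z \<inter> B n = Z' \<inter> B n\<rbrakk> \<Longrightarrow>
        k \<in> \<Theta> Z \<longleftrightarrow> k \<in> \<Theta> Z'"
      using cont[of k] by blast
    obtain v' where v': "v' \<in> Pi UNIV A" "agree M v v'" "v' \<notin> D m"
      using nd[OF v] by blast
    then have "one v' k"
      using k by (auto simp: D_def)
    moreover have "k \<in> \<Theta> (V1 v) \<longleftrightarrow> k \<in> \<Theta> (V1 v')" "k \<in> \<Theta> (V2 v) \<longleftrightarrow> k \<in> \<Theta> (V2 v')"
      "k \<in> \<Theta> (V3 v) \<longleftrightarrow> k \<in> \<Theta> (V3 v')"
      by (rule M; use V_sub v(1) v'(1,2) V_B in \<open>simp add: agree_def\<close>)+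
    ultimately show ?thesis
      by (simp add: one_def)
  qed
  define T where "T = (\<Union>n\<in>{l..}. B n)"
  define s1 where "s1 = (\<Union>n<l. fst (v0 n))"
  define s2 where "s2 = (\<Union>n<l. fst (snd (v0 n)))"
  define s3 where "s3 = (\<Union>n<l. snd (snd (v0 n)))"
  have part: "exactly_one (k \<in> \<Theta> (s1 \<union> P)) (k \<in> \<Theta> (s2 \<union> Q)) (k \<in> \<Theta> (s3 \<union> R))"
    if PQR: "partition3 T P Q R" and k: "k \<ge> m" "k \<in> \<Psi> S" for P Q R k
  proof -
    define v where "v n = (if n < l then v0 n else (P \<inter> B n, Q \<inter> B n, R \<inter> B n))" for n
    have TB: "B n \<subseteq> T" if "\<not> n < l" for n
      using that unfolding T_def by (intro UN_upper) simp
    have "v n \<in> A n" for n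
    proof (cases "n < l")
      case False
      have "partition3 (B n) (P \<inter> B n) (Q \<inter> B n) (R \<inter> B n)"
        using PQR TB[OF False] unfolding partition3_def by blast
      with False show ?thesis
        by (simp add: v_def A_def)
    qed (use v0 in \<open>auto simp: v_def\<close>)
    then have "v \<in> Pi UNIV A"
      by auto
    moreover have "agree l v0 v"
      by (simp add: agree_def v_def)
    ultimately have "one v k"
      using one k by blast
    have U: "(\<Union>n. if n < l then x n else y \<inter> B n) = (\<Union>n<l. x n) \<union> y"
      if y: "y \<subseteq> T" for x and y :: "'s set"
    proof (intro equalityI subsetI)
      fix a assume "a \<in> (\<Union>n. if n < l then x n else y \<inter> B n)"
      then obtain n where "a \<in> (if n < l then x n else y \<inter> B n)"
        by blast
      then show "a \<in> (\<Union>n<l. x n) \<union> y"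
        by (cases "n < l") auto
    next
      fix a assume "a \<in> (\<Union>n<l. x n) \<union> y"
      then consider n where "n < l" "a \<in> x n" | n where "l \<le> n" "a \<in> y \<inter> B n"
        using y by (auto simp: T_def)
      then obtain n where "a \<in> (if n < l then x n else y \<inter> B n)"
        by (metis leD)
      then show "a \<in> (\<Union>n. if n < l then x n else y \<inter> B n)"
        by blast
    qed
    have sub: "P \<subseteq> T" "Q \<subseteq> T" "R \<subseteq> T"
      using PQR by (auto simp: partition3_def)
    have "V1 v = s1 \<union> P" "V2 v = s2 \<union> Q" "V3 v = s3 \<union> R"
      unfolding V1_def V2_def V3_def s1_def s2_def s3_def
      unfolding U[OF sub(1), symmetric] U[OF sub(2), symmetric] U[OF sub(3), symmetric]
      by (intro SUP_cong refl; simp add: v_def)+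
    with \<open>one v k\<close> show ?thesis
      by (simp add: one_def)
  qed
  have s1: "s1 \<subseteq> S" "s1 \<inter> T = {}" "T \<subseteq> S"
  proof -
    show "s1 \<subseteq> S" "T \<subseteq> S"
      using vn(1)[OF v0] by (auto simp: s1_def S_def T_def)
    have "fst (v0 n) \<inter> B n' = {}" if "n < l" "l \<le> n'" for n n'
      using vn(1)[OF v0, of n] disj[of n n'] that by auto
    then show "s1 \<inter> T = {}"
      by (auto simp: s1_def T_def)
  qed
  \<comment> \<open>These are the \<open>k\<close> to which \<open>partition3_principal\<close>
    applies: with \<open>s1\<close> adjoined, the empty set is rejected and \<open>T\<close>
    accepted. They are almost all \<open>k\<close> in \<open>\<Psi> T\<close>.\<close>
  define \<Omega> where "\<Omega> = {k. k \<ge> m \<and> k \<in> \<Psi> S \<and> k \<in> \<Psi> T \<and> k \<notin> \<Theta> s1 \<and> k \<in> \<Theta> (s1 \<union> T)}"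
  have "\<forall>k\<in>\<Omega>. \<exists>s\<in>T. \<forall>Z\<subseteq>T. k \<in> \<Theta> (s1 \<union> Z) \<longleftrightarrow> s \<in> Z"
  proof
    fix k assume k: "k \<in> \<Omega>"
    obtain M where M: "\<And>Z Z'. \<lbrakk>Z \<subseteq> S; Z' \<subseteq> S; \<forall>n<M. Z \<inter> B n = Z' \<inter> B n\<rbrakk> \<Longrightarrow>
        k \<in> \<Theta> Z \<longleftrightarrow> k \<in> \<Theta> Z'"
      using cont[of k] by blast
    \<comment> \<open>By continuity at \<open>k\<close>, \<open>s1 \<union> T\<close> and the
      smaller \<open>s1 \<union> F\<close> are not distinguished; this provides the finite
      member.\<close>
    define F where "F = T \<inter> (\<Union>n<M. B n)"
    have "finite F"
      using finB by (auto simp: F_def)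
    moreover have "F \<subseteq> T"
      by (simp add: F_def)
    moreover have "k \<in> \<Theta> (s1 \<union> F)"
      using M[of "s1 \<union> T" "s1 \<union> F"] s1 k \<open>F \<subseteq> T\<close> by (fastforce simp: \<Omega>_def F_def)
    ultimately show "\<exists>s\<in>T. \<forall>Z\<subseteq>T. k \<in> \<Theta> (s1 \<union> Z) \<longleftrightarrow> s \<in> Z"
      using part k
      by (intro partition3_principal[of T "\<lambda>Z. k \<in> \<Theta> (s1 \<union> Z)" "\<lambda>Z. k \<in> \<Theta> (s2 \<union> Z)"
            "\<lambda>Z. k \<in> \<Theta> (s3 \<union> Z)" F])
        (auto simp: \<Omega>_def)
  qed
  then obtain h where h: "\<And>k Z. \<lbrakk>k \<in> \<Omega>; Z \<subseteq> T\<rbrakk> \<Longrightarrow> k \<in> \<Theta> (s1 \<union> Z) \<longleftrightarrow> h k \<in> Z"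
    by metis
  show thesis
  proof (rule that[of l \<Omega> h])
    fix Z assume "Z \<subseteq> (\<Union>n\<in>{l..}. B n)"
    then have Z: "Z \<subseteq> T"
      by (simp add: T_def)
    \<comment> \<open>Intersecting with \<open>T\<close> removes the auxiliary part
      \<open>s1\<close> again.\<close>
    have eq: "(s1 \<union> Z) \<inter> T = Z" "(s1 \<union> T) \<inter> T = T"
      using s1 Z by auto
    have sub: "s1 \<union> Z \<subseteq> S" "s1 \<union> T \<subseteq> S"
      using s1 Z by auto
    show "\<forall>\<^sub>F k in sequentially. k \<in> \<Psi> Z \<longleftrightarrow> k \<in> \<Omega> \<and> h k \<in> Z"
      using lift[OF sub(1)] lift[OF sub(2)] lift[OF s1(1)] fin_hom_mono[OF hom s1(3)]
        fin_hom_Int[OF hom, of "s1 \<union> Z" T] fin_hom_Int[OF hom, of "s1 \<union> T" T]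
        fin_hom_disjoint[OF hom s1(2)] eventually_ge_at_top[of m]
      by eventually_elim (use h[OF _ Z] in \<open>auto simp: \<Omega>_def eq\<close>)
  qed
qed

section \<open>Splitting infinite index sets and reading off blocks\<close>

lemma infinite_split:
  assumes "infinite (c :: nat set)"
  obtains d f where "d \<union> f = c" "d \<inter> f = {}" "infinite d" "infinite f"
proof
  let ?e = "enumerate c"
  have inj: "inj ?e"
    using strict_mono_enumerate[OF assms] by (rule strict_mono_imp_inj_on)
  have inf: "infinite {n :: nat. even n}" "infinite {n :: nat. odd n}"
    unfolding infinite_nat_iff_unbounded_le
    by (metis dvd_triv_left le_add2 mem_Collect_eq mult_2)
      (metis even_mult_iff even_plus_one_iff even_numeral le_add2 le_add1 le_trans mem_Collect_eq mult_2)
  show "?e ` {n. even n} \<union> ?e ` {n. odd n} = c"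
    using range_enumerate[OF assms] by auto
  show "?e ` {n. even n} \<inter> ?e ` {n. odd n} = {}"
    using inj by (auto simp: inj_eq)
  show "infinite (?e ` {n. even n})" "infinite (?e ` {n. odd n})"
    using inf inj by (auto simp: finite_image_iff inj_on_subset)
qed

lemma Un_blocks_Int:
  assumes "\<And>n m. n \<noteq> m \<Longrightarrow> B n \<inter> B m = {}" "y \<in> Pi UNIV (\<lambda>n. Pow (B n))"
  shows "(\<Union>n. y n) \<inter> B n = y n"
proof -
  have y: "y m \<subseteq> B m" for m
    using assms(2) by auto
  have "m = n" if "a \<in> y m" "a \<in> B n" for a m
    using that y[of m] assms(1)[of m n] by blast
  then show ?thesis
    using y[of n] by blast
qed

section \<open>From piecewise continuous to completely additive liftings\<close>

text \<open>Half of the free coordinates, \<open>d\<close>, carry the set to be lifted; the other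
  half, \<open>f\<close>, are spent on moving points into \<open>Y\<close>, where
  \<open>\<Psi>\<close> is continuous. This gives a continuous lifting on a final part of
  \<open>d\<close>, to which \<open>continuous_lifting_principal\<close> applies.\<close>

lemma extendible_piece_lifting:
  fixes B :: "nat \<Rightarrow> 's set" and \<Psi> :: "'s set \<Rightarrow> nat set" and Y :: "(nat \<Rightarrow> 's set) set"
  defines "A \<equiv> \<lambda>n. Pow (B n)" and "S \<equiv> \<Union>n. B n"
  assumes hom: "fin_hom \<Psi>" and finB: "\<And>n. finite (B n)"
    and disj: "\<And>n m. n \<noteq> m \<Longrightarrow> B n \<inter> B m = {}"
    and z: "z \<in> Pi UNIV A" and c: "infinite (c :: nat set)"
    and ext: "\<And>x e. \<lbrakk>x \<in> Pi UNIV A; \<And>n. n \<notin> c \<Longrightarrow> x n = z n; infinite e; e \<subseteq> c\<rbrakk> \<Longrightarrow>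
        \<exists>y\<in>Pi UNIV A \<inter> Y. \<forall>n. n \<notin> e \<longrightarrow> y n = x n"
    and cont: "\<And>k. k \<in> \<Psi> S \<Longrightarrow> \<exists>M. \<forall>y\<in>Pi UNIV A \<inter> Y. \<forall>y'\<in>Pi UNIV A \<inter> Y.
        (\<forall>n. n \<notin> c \<longrightarrow> y n = z n \<and> y' n = z n) \<longrightarrow> agree M y y' \<longrightarrow>
        (k \<in> \<Psi> (\<Union>n. y n) \<longleftrightarrow> k \<in> \<Psi> (\<Union>n. y' n))"
  obtains c' \<Omega> h where "infinite (c' :: nat set)" "\<And>Z. Z \<subseteq> (\<Union>n\<in>c'. B n) \<Longrightarrow>
      \<forall>\<^sub>F k in sequentially. k \<in> \<Psi> Z \<longleftrightarrow> k \<in> \<Omega> \<and> h k \<in> Z"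
proof -
  define Sec where "Sec = {y \<in> Pi UNIV A. \<forall>n. n \<notin> c \<longrightarrow> y n = z n}"
  have A_iff: "s \<in> A n \<longleftrightarrow> s \<subseteq> B n" for s n
    by (simp add: A_def)
  have zA: "z n \<in> A n" for n
    using z by auto
  have "\<exists>M. k \<in> \<Psi> S \<longrightarrow> (\<forall>y\<in>Sec \<inter> Y. \<forall>y'\<in>Sec \<inter> Y. agree M y y' \<longrightarrow>
        (k \<in> \<Psi> (\<Union>n. y n) \<longleftrightarrow> k \<in> \<Psi> (\<Union>n. y' n)))" for k
  proof (cases "k \<in> \<Psi> S")
    case True
    from cont[OF this] obtain M where "\<forall>y\<in>Pi UNIV A \<inter> Y. \<forall>y'\<in>Pi UNIV A \<inter> Y.
        (\<forall>n. n \<notin> c \<longrightarrow> y n = z n \<and> y' n = z n) \<longrightarrow> agree M y y' \<longrightarrow>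
        (k \<in> \<Psi> (\<Union>n. y n) \<longleftrightarrow> k \<in> \<Psi> (\<Union>n. y' n))" ..
    then show ?thesis
      by (intro exI[of _ M]) (simp add: Sec_def)
  qed simp
  then obtain M where M: "\<And>k y y'. \<lbrakk>k \<in> \<Psi> S; y \<in> Sec \<inter> Y; y' \<in> Sec \<inter> Y; agree (M k) y y'\<rbrakk> \<Longrightarrow>
        k \<in> \<Psi> (\<Union>n. y n) \<longleftrightarrow> k \<in> \<Psi> (\<Union>n. y' n)"
    by metis
  \<comment> \<open>This extends the continuous behaviour on \<open>Sec \<inter> Y\<close> to all
    points: \<open>k\<close> is decided by the points of \<open>Sec \<inter> Y\<close> that agree
    with \<open>y\<close> below \<open>M k\<close>.\<close>
  define \<Theta> where "\<Theta> y = {k \<in> \<Psi> S. \<exists>y'\<in>Sec \<inter> Y. agree (M k) y y' \<and> k \<in> \<Psi> (\<Union>n. y' n)}" for y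
  have \<Theta>_Y: "k \<in> \<Theta> y \<longleftrightarrow> k \<in> \<Psi> S \<and> k \<in> \<Psi> (\<Union>n. y n)" if "y \<in> Sec \<inter> Y" for y k
    using M[of k y] that agree_refl[of "M k" y] unfolding \<Theta>_def by blast
  have \<Theta>_cont: "k \<in> \<Theta> y \<longleftrightarrow> k \<in> \<Theta> y'" if "agree (M k) y y'" for y y' k
    using agree_trans[of "M k"] agree_sym[OF that] that unfolding \<Theta>_def by blast
  obtain d f where df: "d \<union> f = c" "d \<inter> f = {}" "infinite d" "infinite f"
    by (rule infinite_split[OF c])
  define Sd where "Sd = (\<Union>n\<in>d. B n)"
  \<comment> \<open>The product of the \<open>A' n\<close> consists of the pairs of points that
    coincide on \<open>d\<close>, vary independently on \<open>f\<close> and equal \<open>z\<close>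
    off \<open>c\<close>.\<close>
  define A' where "A' n = (if n \<in> d then {(s, s) | s. s \<in> A n} else if n \<in> f then A n \<times> A n
      else {(z n, z n)})" for n
  have A'D: "fst (u n) \<in> A n" "snd (u n) \<in> A n" "n \<notin> f \<Longrightarrow> fst (u n) = snd (u n)"
    "n \<notin> c \<Longrightarrow> u n = (z n, z n)" if "u \<in> Pi UNIV A'" for u n
  proof -
    have "u n \<in> A' n"
      using that by auto
    then show "fst (u n) \<in> A n" "snd (u n) \<in> A n" "n \<notin> f \<Longrightarrow> fst (u n) = snd (u n)"
      "n \<notin> c \<Longrightarrow> u n = (z n, z n)"
      using zA[of n] df(1) by (auto simp: A'_def split: if_splits)
  qed
  \<comment> \<open>Pairs from the product have the same trace on \<open>Sd\<close>. If both
    components are in \<open>Y\<close>, then \<open>\<Theta>\<close> separates them at only finitely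
    many \<open>k\<close> in \<open>\<Psi> Sd\<close>. As fusion leaves infinitely many coordinates
    of \<open>f\<close> free for moving both components into \<open>Y\<close>, some
    \<open>D m\<close> lacks a dense interior.\<close>
  define D where "D m = {u. \<exists>k\<ge>m. k \<in> \<Psi> Sd \<and> \<not> (k \<in> \<Theta> (fst \<circ> u) \<longleftrightarrow> k \<in> \<Theta> (snd \<circ> u))}" for m
  have "\<exists>m. \<not> dense_interior A' (D m)"
  proof (rule ccontr)
    assume "\<not> ?thesis"
    then have D: "dense_interior A' (D m)" for m
      by blast
    have finA': "finite (A' n)" for n
    proof (rule finite_subset)
      show "A' n \<subseteq> insert (z n, z n) (A n \<times> A n)"
        by (auto simp: A'_def)
    qed (use finB in \<open>simp add: A_def\<close>)
    have u0: "(\<lambda>n. (z n, z n)) \<in> Pi UNIV A'"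
      using zA by (auto simp: A'_def)
    obtain u g where u: "u \<in> Pi UNIV A'" and g: "g \<subseteq> f" "infinite g" and
      ug: "\<And>v m. \<lbrakk>v \<in> Pi UNIV A'; \<And>n. n \<notin> g \<Longrightarrow> v n = u n\<rbrakk> \<Longrightarrow> v \<in> D m"
      by (rule fusion[where A = A' and D = D, OF finA' D df(4) u0]) blast
    have "g \<subseteq> c"
      using g df by blast
    have "fst \<circ> u \<in> Pi UNIV A" "snd \<circ> u \<in> Pi UNIV A"
      using A'D[OF u] by auto
    moreover have "(fst \<circ> u) n = z n" "(snd \<circ> u) n = z n" if "n \<notin> c" for n
      using A'D(4)[OF u that] by auto
    ultimately obtain y y' where y: "y \<in> Pi UNIV A \<inter> Y" "y' \<in> Pi UNIV A \<inter> Y"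
      and yu: "\<And>n. n \<notin> g \<Longrightarrow> y n = fst (u n)" "\<And>n. n \<notin> g \<Longrightarrow> y' n = snd (u n)"
      using ext[OF _ _ g(2) \<open>g \<subseteq> c\<close>, of "fst \<circ> u"] ext[OF _ _ g(2) \<open>g \<subseteq> c\<close>, of "snd \<circ> u"]
      by auto
    have "y n = z n \<and> y' n = z n" if "n \<notin> c" for n
    proof -
      have "n \<notin> g"
        using that \<open>g \<subseteq> c\<close> by auto
      then show ?thesis
        using yu A'D(4)[OF u that] by simp
    qed
    with y have Sec: "y \<in> Sec \<inter> Y" "y' \<in> Sec \<inter> Y"
      by (simp_all add: Sec_def)
    define v where "v n = (y n, y' n)" for n
    have yy': "y n = y' n" if "n \<in> d" for n
    proof -
      have "n \<notin> g" "n \<notin> f"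
        using that g df by auto
      then show ?thesis
        using yu A'D(3)[OF u] by simp
    qed
    have "v n \<in> A' n" for n
    proof -
      have "y n \<in> A n" "y' n \<in> A n"
        using y by auto
      moreover have "y n = z n \<and> y' n = z n" if "n \<notin> c"
        using Sec that by (auto simp: Sec_def)
      ultimately show ?thesis
        using yy' df(1) by (auto simp: A'_def v_def)
    qed
    moreover have "v n = u n" if "n \<notin> g" for n
      using yu that by (simp add: v_def)
    ultimately have "v \<in> D m" for m
      using ug by blast
    moreover have "fst \<circ> v = y" "snd \<circ> v = y'"
      by (auto simp: v_def)
    ultimately have "\<forall>m. \<exists>k\<ge>m. k \<in> \<Psi> Sd \<and> \<not> (k \<in> \<Theta> y \<longleftrightarrow> k \<in> \<Theta> y')"
      by (auto simp: D_def)
    then have fr: "\<exists>\<^sub>F k in sequentially. k \<in> \<Psi> Sd \<and> \<not> (k \<in> \<Theta> y \<longleftrightarrow> k \<in> \<Theta> y')"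
      by (simp add: frequently_sequentially)
    have "(\<Union>n. y n) \<inter> B n = (\<Union>n. y' n) \<inter> B n" if "n \<in> d" for n
      using Un_blocks_Int[of B y n, OF disj] Un_blocks_Int[of B y' n, OF disj] yy'[OF that] y
      by (simp add: A_def)
    then have eq: "(\<Union>n. y n) \<inter> Sd = (\<Union>n. y' n) \<inter> Sd"
      unfolding Sd_def by blast
    have "\<forall>\<^sub>F k in sequentially. k \<in> \<Psi> Sd \<longrightarrow> (k \<in> \<Theta> y \<longleftrightarrow> k \<in> \<Theta> y')"
      using fin_hom_Int[OF hom, of "\<Union>n. y n" Sd] fin_hom_Int[OF hom, of "\<Union>n. y' n" Sd]
      unfolding \<Theta>_Y[OF Sec(1)] \<Theta>_Y[OF Sec(2)] eq by eventually_elim blast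
    with fr show False
      by (simp add: frequently_def)
  qed
  then obtain m u0 l where u0: "u0 \<in> Pi UNIV A'"
    and nd: "\<And>u l'. \<lbrakk>u \<in> Pi UNIV A'; agree l u0 u\<rbrakk> \<Longrightarrow> \<exists>u'\<in>Pi UNIV A'. agree l' u u' \<and> u' \<notin> D m"
    unfolding dense_interior_def by blast
  have same: "k \<in> \<Theta> (fst \<circ> u) \<longleftrightarrow> k \<in> \<Theta> (snd \<circ> u)"
    if u: "u \<in> Pi UNIV A'" "agree l u0 u" and k: "k \<ge> m" "k \<in> \<Psi> Sd" for u k
  proof -
    obtain u' where u': "agree (M k) u u'" "u' \<notin> D m"
      using nd[OF u] by blast
    then have "k \<in> \<Theta> (fst \<circ> u') \<longleftrightarrow> k \<in> \<Theta> (snd \<circ> u')"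
      using k by (auto simp: D_def)
    moreover have "agree (M k) (fst \<circ> u) (fst \<circ> u')" "agree (M k) (snd \<circ> u) (snd \<circ> u')"
      using u'(1) by (simp_all add: agree_def)
    ultimately show ?thesis
      using \<Theta>_cont by blast
  qed
  define d' where "d' = d \<inter> {l..}"
  define B' where "B' n = (if n \<in> d' then B n else {})" for n
  define S' where "S' = (\<Union>n. B' n)"
  \<comment> \<open>A standard point carrying \<open>Z\<close> on \<open>d'\<close>. Below
    \<open>l\<close> it follows the second component of \<open>u0\<close>, while its partner
    \<open>x\<close> will follow the first, so that the pair passes through
    \<open>u0\<close>.\<close>
  define w where "w Z n = (if n \<in> d' then Z \<inter> B n else if n < l then snd (u0 n) else z n)" for Z n
  have inf_cut: "infinite (e \<inter> {r..})" if "infinite e" for e :: "nat set" and r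
  proof
    assume "finite (e \<inter> {r..})"
    then have "finite (e \<inter> {r..} \<union> {..<r})"
      by simp
    moreover have "e \<subseteq> e \<inter> {r..} \<union> {..<r}"
      by auto
    ultimately show False
      using that finite_subset by blast
  qed
  have lift: "\<forall>\<^sub>F k in sequentially. k \<in> \<Psi> Z \<longleftrightarrow> k \<in> \<Theta> (w Z) \<and> k \<in> \<Psi> S'" if Z: "Z \<subseteq> S'" for Z
  proof -
    define x where "x n = (if n \<in> d' then Z \<inter> B n else if n < l then fst (u0 n) else z n)" for n
    \<comment> \<open>Only coordinates of \<open>f\<close> from \<open>l\<close> on are used for
      moving \<open>x\<close> into \<open>Y\<close>, because the pair must agree with
      \<open>u0\<close> below \<open>l\<close>.\<close>
    define e where "e = f \<inter> {l..}"
    have e: "infinite e" "e \<subseteq> c"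
      using inf_cut df by (auto simp: e_def)
    have "x \<in> Pi UNIV A"
      using A'D[OF u0] zA by (auto simp: x_def A_iff)
    moreover have xz: "x n = z n" if "n \<notin> c" for n
      using that A'D(4)[OF u0 that] df by (auto simp: x_def d'_def)
    ultimately obtain y where y: "y \<in> Pi UNIV A \<inter> Y" and yx: "\<And>n. n \<notin> e \<Longrightarrow> y n = x n"
      using ext[OF _ _ e] by blast
    have "y n = z n" if "n \<notin> c" for n
      using yx[of n] xz[OF that] e(2) that by auto
    with y have Sec: "y \<in> Sec \<inter> Y"
      by (simp add: Sec_def)
    define u where "u n = (y n, w Z n)" for n
    have "u n \<in> A' n" for n
    proof -
      consider "n \<in> d'" | "n \<in> d" "n < l" | "n \<in> f" | "n \<notin> c"
        using df by (cases "n < l") (auto simp: d'_def)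
      then show ?thesis
      proof cases
        case 1
        then have "n \<notin> e" "n \<in> d"
          using df by (auto simp: d'_def e_def)
        with 1 yx[of n] show ?thesis
          by (simp add: A'_def u_def x_def w_def A_iff)
      next
        case 2
        then have "n \<notin> e" "n \<notin> d'" "n \<notin> f"
          using df by (auto simp: d'_def e_def)
        with 2 yx[of n] A'D(1,3)[OF u0, of n] show ?thesis
          by (simp add: A'_def u_def x_def w_def)
      next
        case 3
        then have "n \<notin> d" "n \<notin> d'"
          using df by (auto simp: d'_def)
        moreover have "y n \<in> A n"
          using y by auto
        ultimately show ?thesis
          using 3 A'D(2)[OF u0, of n] zA[of n] by (simp add: A'_def u_def w_def)
      next
        case 4
        then have "n \<notin> d" "n \<notin> f" "n \<notin> d'" "y n = z n"
          using df Sec by (auto simp: d'_def Sec_def)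
        then show ?thesis
          using A'D(4)[OF u0 4] by (simp add: A'_def u_def w_def)
      qed
    qed
    then have "u \<in> Pi UNIV A'"
      by auto
    moreover have "agree l u0 u"
      unfolding agree_def
    proof (intro allI impI)
      fix n assume "n < l"
      then have "n \<notin> e" "n \<notin> d'"
        by (auto simp: e_def d'_def)
      with yx[of n] \<open>n < l\<close> show "u0 n = u n"
        by (simp add: u_def x_def w_def)
    qed
    moreover have "fst \<circ> u = y" "snd \<circ> u = w Z"
      by (auto simp: u_def)
    ultimately have same': "k \<in> \<Theta> y \<longleftrightarrow> k \<in> \<Theta> (w Z)" if "k \<ge> m" "k \<in> \<Psi> Sd" for k
      using same[of u k] that by simp
    have yB': "(\<Union>n. y n) \<inter> B' n = Z \<inter> B' n" for n
    proof (cases "n \<in> d'")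
      case True
      then have "n \<notin> e"
        using df by (auto simp: d'_def e_def)
      then have "y n = Z \<inter> B n"
        using yx True by (simp add: x_def)
      then show ?thesis
        using Un_blocks_Int[of B y n, OF disj] y True by (simp add: A_def B'_def)
    qed (simp add: B'_def)
    have "(\<Union>n. y n) \<inter> S' = Z \<inter> S'"
      unfolding S'_def Int_UN_distrib yB' ..
    then have eq: "(\<Union>n. y n) \<inter> S' = Z"
      using Z by (simp add: Int_absorb2)
    have "B' n \<subseteq> Sd" for n
      unfolding Sd_def by (cases "n \<in> d'") (auto simp: B'_def d'_def)
    moreover have "B' n \<subseteq> S" for n
      unfolding S_def by (cases "n \<in> d'") (auto simp: B'_def)
    ultimately have sub: "S' \<subseteq> Sd" "S' \<subseteq> S"
      unfolding S'_def by (simp_all add: UN_least)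
    show ?thesis
      using fin_hom_Int[OF hom, of "\<Union>n. y n" S', unfolded eq] fin_hom_mono[OF hom sub(1)]
        fin_hom_mono[OF hom sub(2)] eventually_ge_at_top[of m]
    proof eventually_elim
      case (elim k)
      show ?case
      proof (cases "k \<in> \<Psi> S'")
        case True
        with elim have "k \<in> \<Theta> (w Z) \<longleftrightarrow> k \<in> \<Psi> S \<and> k \<in> \<Psi> (\<Union>n. y n)"
          using same'[of k] \<Theta>_Y[OF Sec, of k] by argo
        with True elim show ?thesis
          by argo
      next
        case False
        with elim show ?thesis
          by argo
      qed
    qed
  qed
  have finB': "finite (B' n)" and disj': "n \<noteq> n' \<Longrightarrow> B' n \<inter> B' n' = {}" for n n'
    using finB disj[of n n'] by (auto simp: B'_def)
  have cont': "\<exists>M. \<forall>Z Z'. Z \<subseteq> \<Union>(range B') \<longrightarrow> Z' \<subseteq> \<Union>(range B') \<longrightarrow>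
      (\<forall>n<M. Z \<inter> B' n = Z' \<inter> B' n) \<longrightarrow> (k \<in> \<Theta> (w Z) \<longleftrightarrow> k \<in> \<Theta> (w Z'))" for k
  proof (intro exI[of _ "M k"] allI impI)
    fix Z Z' assume ZZ': "\<forall>n<M k. Z \<inter> B' n = Z' \<inter> B' n"
    have "w Z n = w Z' n" if "n < M k" for n
      using ZZ'[rule_format, OF that] by (simp add: w_def B'_def split: if_splits)
    then have "agree (M k) (w Z) (w Z')"
      by (simp add: agree_def)
    then show "k \<in> \<Theta> (w Z) \<longleftrightarrow> k \<in> \<Theta> (w Z')"
      by (rule \<Theta>_cont)
  qed
  obtain l2 \<Omega> h where h: "\<And>Z. Z \<subseteq> (\<Union>n\<in>{l2..}. B' n) \<Longrightarrow>
      \<forall>\<^sub>F k in sequentially. k \<in> \<Psi> Z \<longleftrightarrow> k \<in> \<Omega> \<and> h k \<in> Z"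
    using continuous_lifting_principal[of \<Psi> B' "\<lambda>Z. \<Theta> (w Z)", OF hom finB' disj' lift[unfolded S'_def] cont']
    by blast
  show thesis
  proof (rule that[of "d' \<inter> {l2..}" \<Omega> h])
    show "infinite (d' \<inter> {l2..})"
      using inf_cut df(3) by (simp add: d'_def)
    fix Z assume "Z \<subseteq> (\<Union>n\<in>d' \<inter> {l2..}. B n)"
    moreover have "(\<Union>n\<in>d' \<inter> {l2..}. B n) \<subseteq> (\<Union>n\<in>{l2..}. B' n)"
      by (fastforce simp: B'_def)
    ultimately show "\<forall>\<^sub>F k in sequentially. k \<in> \<Psi> Z \<longleftrightarrow> k \<in> \<Omega> \<and> h k \<in> Z"
      using h by blast
  qed
qed

text \<open>Continuity is available only where \<open>Y j\<close> is dense, so fusion first passes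
  to a section each of whose points is, for every \<open>j\<close>, either away from
  \<open>Y j\<close> or in a region where \<open>Y j\<close> is dense. For an extendible piece the
  second case occurs.\<close>

lemma piecewise_continuous_lifting:
  fixes B :: "nat \<Rightarrow> 's set" and \<Psi> :: "'s set \<Rightarrow> nat set" and Y :: "nat \<Rightarrow> (nat \<Rightarrow> 's set) set"
  defines "A \<equiv> \<lambda>n. Pow (B n)" and "S \<equiv> \<Union>n. B n"
  assumes hom: "fin_hom \<Psi>" and finB: "\<And>n. finite (B n)"
    and disj: "\<And>n m. n \<noteq> m \<Longrightarrow> B n \<inter> B m = {}"
    and cov: "Pi UNIV A \<subseteq> (\<Union>j. Y j)"
    and cont: "\<And>j y0 l k. \<lbrakk>y0 \<in> Pi UNIV A; dense_above A (Y j) y0 l; k \<in> \<Psi> S\<rbrakk> \<Longrightarrow>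
        \<exists>M. \<forall>y\<in>Pi UNIV A \<inter> Y j. \<forall>y'\<in>Pi UNIV A \<inter> Y j. agree l y0 y \<longrightarrow> agree l y0 y' \<longrightarrow>
        agree M y y' \<longrightarrow> (k \<in> \<Psi> (\<Union>n. y n) \<longleftrightarrow> k \<in> \<Psi> (\<Union>n. y' n))"
  obtains c \<Omega> h where "infinite (c :: nat set)" "\<And>Z. Z \<subseteq> (\<Union>n\<in>c. B n) \<Longrightarrow>
      \<forall>\<^sub>F k in sequentially. k \<in> \<Psi> Z \<longleftrightarrow> k \<in> \<Omega> \<and> h k \<in> Z"
proof -
  define D where "D j = {y. \<exists>l. (\<forall>y'\<in>Pi UNIV A. agree l y y' \<longrightarrow> y' \<notin> Y j) \<or> dense_above A (Y j) y l}" for j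
  have D: "dense_interior A (D j)" for j
    unfolding dense_interior_def
  proof (intro ballI allI)
    fix y l assume y: "y \<in> Pi UNIV A"
    show "\<exists>y'\<in>Pi UNIV A. agree l y y' \<and> (\<exists>l'. \<forall>y''\<in>Pi UNIV A. agree l' y' y'' \<longrightarrow> y'' \<in> D j)"
    proof (cases "dense_above A (Y j) y l")
      case True
      then have "dense_above A (Y j) y'' l" if "agree l y y''" for y''
        using agree_trans[OF that] unfolding dense_above_def by blast
      then have "\<forall>y''\<in>Pi UNIV A. agree l y y'' \<longrightarrow> y'' \<in> D j"
        unfolding D_def by blast
      then show ?thesis
        using y agree_refl by blast
    next
      case False
      then obtain y1 l1 where y1: "y1 \<in> Pi UNIV A" "agree l y y1"
        "\<And>y''. \<lbrakk>y'' \<in> Pi UNIV A; y'' \<in> Y j\<rbrakk> \<Longrightarrow> \<not> agree l1 y1 y''"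
        unfolding dense_above_def by blast
      then have "\<forall>y''\<in>Pi UNIV A. agree l1 y1 y'' \<longrightarrow> y'' \<in> D j"
        using agree_trans[of l1 y1] unfolding D_def by blast
      with y1 show ?thesis
        by blast
    qed
  qed
  have finA: "finite (A n)" for n
    using finB by (simp add: A_def)
  have "(\<lambda>_. {}) \<in> Pi UNIV A"
    by (simp add: A_def)
  then obtain z0 g0 where z0: "z0 \<in> Pi UNIV A" and g0: "infinite g0" and
    zg: "\<And>y j. \<lbrakk>y \<in> Pi UNIV A; \<And>n. n \<notin> g0 \<Longrightarrow> y n = z0 n\<rbrakk> \<Longrightarrow> y \<in> D j"
    by (rule fusion[where A = A and D = D, OF finA D infinite_UNIV_nat]) blast
  have "\<exists>j. y \<in> Y j" if "y \<in> Pi UNIV A" for y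
    using cov that by blast
  then obtain j z c where z: "z \<in> Pi UNIV A" "\<And>n. n \<notin> g0 \<Longrightarrow> z n = z0 n" and c: "infinite c" "c \<subseteq> g0"
    and ext: "\<And>x e. \<lbrakk>x \<in> Pi UNIV A; \<And>n. n \<notin> c \<Longrightarrow> x n = z n; infinite e; e \<subseteq> c\<rbrakk> \<Longrightarrow>
        \<exists>y\<in>Pi UNIV A \<inter> Y j. \<forall>n. n \<notin> e \<longrightarrow> y n = x n"
    by (rule extendible_piece[where H = Y, OF z0 g0]) blast+
  obtain y1 where y1: "y1 \<in> Pi UNIV A" "y1 \<in> Y j" "\<And>n. n \<notin> c \<Longrightarrow> y1 n = z n"
    using ext[OF z(1) refl c(1) subset_refl] by blast
  have "y1 n = z0 n" if "n \<notin> g0" for n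
    using y1(3)[of n] z(2)[OF that] c(2) that by auto
  then have "y1 \<in> D j"
    using zg y1(1) by blast
  \<comment> \<open>As \<open>y1\<close> itself is in \<open>Y j\<close>, the first alternative in
    \<open>D j\<close> is impossible.\<close>
  then obtain l where l: "dense_above A (Y j) y1 l"
    using y1 agree_refl unfolding D_def by blast
  \<comment> \<open>With the coordinates below \<open>l\<close> fixed, all points considered stay in
    the region around \<open>y1\<close> where \<open>cont\<close> gives continuity.\<close>
  define c1 where "c1 = c - {..<l}"
  have c1: "infinite c1" "c1 \<subseteq> c"
    using c(1) by (auto simp: c1_def)
  show thesis
  proof (rule extendible_piece_lifting[of \<Psi> B y1 c1 "Y j", OF hom finB disj _ c1(1)])
    show "y1 \<in> Pi UNIV (\<lambda>n. Pow (B n))"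
      using y1(1) by (simp add: A_def)
  next
    fix x e assume x: "x \<in> Pi UNIV (\<lambda>n. Pow (B n))" "\<And>n. n \<notin> c1 \<Longrightarrow> x n = y1 n" and e: "infinite e" "e \<subseteq> c1"
    have "x n = z n" if "n \<notin> c" for n
      using x(2)[of n] y1(3)[OF that] c1(2) that by auto
    then show "\<exists>y\<in>Pi UNIV (\<lambda>n. Pow (B n)) \<inter> Y j. \<forall>n. n \<notin> e \<longrightarrow> y n = x n"
      using ext[of x e] x(1) e c1(2) by (auto simp: A_def)
  next
    fix k assume "k \<in> \<Psi> (\<Union>n. B n)"
    then have "k \<in> \<Psi> S"
      by (simp add: S_def)
    from cont[OF y1(1) l this] obtain M where M: "\<forall>y\<in>Pi UNIV A \<inter> Y j. \<forall>y'\<in>Pi UNIV A \<inter> Y j.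
        agree l y1 y \<longrightarrow> agree l y1 y' \<longrightarrow> agree M y y' \<longrightarrow>
        (k \<in> \<Psi> (\<Union>n. y n) \<longleftrightarrow> k \<in> \<Psi> (\<Union>n. y' n))" ..
    have c1_agree: "agree l y1 y" if "\<And>n. n \<notin> c1 \<Longrightarrow> y n = y1 n" for y
      using that by (simp add: agree_def c1_def)
    show "\<exists>M. \<forall>y\<in>Pi UNIV (\<lambda>n. Pow (B n)) \<inter> Y j. \<forall>y'\<in>Pi UNIV (\<lambda>n. Pow (B n)) \<inter> Y j.
        (\<forall>n. n \<notin> c1 \<longrightarrow> y n = y1 n \<and> y' n = y1 n) \<longrightarrow> agree M y y' \<longrightarrow>
        (k \<in> \<Psi> (\<Union>n. y n) \<longleftrightarrow> k \<in> \<Psi> (\<Union>n. y' n))"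
    proof (intro exI[of _ M] ballI impI)
      fix y y' assume "y \<in> Pi UNIV (\<lambda>n. Pow (B n)) \<inter> Y j" "y' \<in> Pi UNIV (\<lambda>n. Pow (B n)) \<inter> Y j"
        "\<forall>n. n \<notin> c1 \<longrightarrow> y n = y1 n \<and> y' n = y1 n" "agree M y y'"
      then show "k \<in> \<Psi> (\<Union>n. y n) \<longleftrightarrow> k \<in> \<Psi> (\<Union>n. y' n)"
        unfolding A_def[symmetric] by (intro M[rule_format] c1_agree) blast+
    qed
  qed (assumption | rule that)+
qed

section \<open>Local additivity\<close>

text \<open>The number of the node that \<open>a\<close> passes at level \<open>n\<close> in the
  tree of finite sequences. Two branches share exactly the nodes up to the level where they split,
  that level included.\<close>

definition nd :: "(nat \<Rightarrow> 'v::countable) \<Rightarrow> nat \<Rightarrow> nat" where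
  "nd a n = to_nat (map a [0..<n])"

lemma map_upt_eq_iff: "map a [0..<n] = map a' [0..<m] \<longleftrightarrow> n = m \<and> (\<forall>i<n. a i = a' i)"
proof
  assume "map a [0..<n] = map a' [0..<m]"
  moreover from this have "n = m"
    by (metis diff_zero length_map length_upt)
  ultimately show "n = m \<and> (\<forall>i<n. a i = a' i)"
    by auto
qed auto

lemma nd_eq_iff: "nd a n = nd a' m \<longleftrightarrow> n = m \<and> (\<forall>i<n. a i = a' i)"
  unfolding nd_def by (simp add: map_upt_eq_iff)

definition fcode :: "'a::countable set \<Rightarrow> nat" where
  "fcode X = set_encode (to_nat ` X)"

lemma fcode_eq_iff: "finite X \<Longrightarrow> finite Y \<Longrightarrow> fcode X = fcode Y \<longleftrightarrow> X = Y"
  unfolding fcode_def by (simp add: set_encode_eq inj_image_eq_iff)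

section \<open>Uncountable families and branches\<close>

lemma uncountable_pigeonhole:
  fixes g :: "'a \<Rightarrow> 'c::countable"
  assumes "uncountable Y"
  obtains p q where "p \<in> Y" "q \<in> Y" "p \<noteq> q" "g p = g q"
proof -
  have "\<not> inj_on (to_nat \<circ> g) Y"
    using assms countableI by blast
  then show thesis
    using that by (auto simp: inj_on_def)
qed

lemma uncountable_UNIV_nat_bool: "uncountable (UNIV :: (nat \<Rightarrow> bool) set)"
proof
  assume "countable (UNIV :: (nat \<Rightarrow> bool) set)"
  then have "range (from_nat_into UNIV) = (UNIV :: (nat \<Rightarrow> bool) set)"
    by (intro range_from_nat_into) auto
  then obtain n where "from_nat_into UNIV n = (\<lambda>m. \<not> (from_nat_into UNIV m :: nat \<Rightarrow> bool) m)"
    by (metis UNIV_I imageE)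
  then show False
    by (metis (mono_tags, lifting))
qed

lemma least_difference:
  assumes "a \<noteq> (a' :: nat \<Rightarrow> 'b)"
  obtains d where "a d \<noteq> a' d" "\<And>i. i < d \<Longrightarrow> a i = a' i"
proof -
  have "\<exists>i. a i \<noteq> a' i"
    using assms by auto
  then show thesis
    using that[of "LEAST i. a i \<noteq> a' i"] LeastI_ex not_less_Least by (metis (mono_tags, lifting))
qed

text \<open>The blocks lie on the nodes of the binary tree. The colouring compares a subset of the blocks
  along one branch with a coherent subset along another one. A homogeneous uncountable set glues
  together to a single set \<open>D\<close>, and \<open>\<Psi> D\<close> decides all values up to finitely many.\<close>

lemma continuity_along_branch:
  fixes \<Psi> :: "'s::countable set \<Rightarrow> nat set" and I :: "nat \<Rightarrow> 's set"
  defines "A \<equiv> \<lambda>(a :: nat \<Rightarrow> bool) n. Pow (I (nd a n))"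
  assumes OCA and hom: "fin_hom \<Psi>" and finI: "\<And>n. finite (I n)"
    and disj: "\<And>n m. n \<noteq> m \<Longrightarrow> I n \<inter> I m = {}"
  obtains a :: "nat \<Rightarrow> bool" and Y :: "nat \<Rightarrow> (nat \<Rightarrow> 's set) set" where
    "Pi UNIV (A a) \<subseteq> (\<Union>j. Y j)"
    "\<And>j y0 l k. \<lbrakk>y0 \<in> Pi UNIV (A a); dense_above (A a) (Y j) y0 l; k \<in> \<Psi> (\<Union>n. I (nd a n))\<rbrakk> \<Longrightarrow>
        \<exists>M. \<forall>y\<in>Pi UNIV (A a) \<inter> Y j. \<forall>y'\<in>Pi UNIV (A a) \<inter> Y j. agree l y0 y \<longrightarrow> agree l y0 y' \<longrightarrow>
        agree M y y' \<longrightarrow> (k \<in> \<Psi> (\<Union>n. y n) \<longleftrightarrow> k \<in> \<Psi> (\<Union>n. y' n))"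
proof -
  define U where "U y = (\<Union>n. y n)" for y :: "nat \<Rightarrow> 's set"
  define S where "S a = (\<Union>n. I (nd a n))" for a :: "nat \<Rightarrow> bool"
  define X where "X = {(a, y). y \<in> Pi UNIV (A a)}"
  define coh where "coh a a' y y' \<longleftrightarrow> (\<forall>n. (\<forall>i<n. a i = a' i) \<longrightarrow> y n = y' n)"
    for a a' :: "nat \<Rightarrow> bool" and y y' :: "nat \<Rightarrow> 's set"
  \<comment> \<open>If \<open>U y\<close> and \<open>U y'\<close> are the traces of one set
    \<open>D\<close> on \<open>S a\<close> and \<open>S a'\<close>, both sides reduce, for large
    \<open>k\<close>, to membership in \<open>\<Psi> D\<close>, \<open>\<Psi> (S a)\<close> and
    \<open>\<Psi> (S a')\<close>.\<close>
  define R where "R = (\<lambda>(a, y) (a', y'). a \<noteq> a' \<and> coh a a' y y' \<and>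
      (\<exists>k. \<not> (k \<in> \<Psi> (S a') \<and> k \<in> \<Psi> (U y) \<longleftrightarrow> k \<in> \<Psi> (S a) \<and> k \<in> \<Psi> (U y'))))"
  define \<phi> where "\<phi> = (\<lambda>(a, y) i. (a i, fcode (y i), i \<in> \<Psi> (S a), i \<in> \<Psi> (U y)))"
  have XD: "y n \<subseteq> I (nd a n)" "finite (y n)" if "(a, y) \<in> X" for a y n
  proof -
    show "y n \<subseteq> I (nd a n)"
      using that by (auto simp: X_def A_def)
    then show "finite (y n)"
      using finI finite_subset by blast
  qed
  have inj: "inj_on \<phi> X"
  proof (rule inj_onI)
    fix p q assume pq: "p \<in> X" "q \<in> X" "\<phi> p = \<phi> q"
    obtain a y a' y' where p: "p = (a, y)" "q = (a', y')"
      by (cases p, cases q) auto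
    have "a i = a' i" "fcode (y i) = fcode (y' i)" for i
      using fun_cong[OF pq(3), of i] by (simp_all add: p \<phi>_def)
    moreover have "finite (y i)" "finite (y' i)" for i
      using XD pq p by blast+
    ultimately show "p = q"
      by (simp add: p fun_eq_iff fcode_eq_iff)
  qed
  have sym: "R q p" if "R p q" for p q
    using that by (cases p, cases q) (auto simp: R_def coh_def eq_commute)
  have irr: "\<not> R p p" for p
    by (cases p) (simp add: R_def)
  have op: "\<exists>N. \<forall>p'\<in>X. \<forall>q'\<in>X. (\<forall>i\<le>N. \<phi> p' i = \<phi> p i) \<longrightarrow> (\<forall>i\<le>N. \<phi> q' i = \<phi> q i) \<longrightarrow> R p' q'"
    if pq: "p \<in> X" "q \<in> X" "R p q" for p q
  proof -
    obtain a y a' y' where p: "p = (a, y)" "q = (a', y')"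
      by (cases p, cases q) auto
    with pq(3) have ne: "a \<noteq> a'" and coh: "coh a a' y y'" and
      ex: "\<exists>k. \<not> (k \<in> \<Psi> (S a') \<and> k \<in> \<Psi> (U y) \<longleftrightarrow> k \<in> \<Psi> (S a) \<and> k \<in> \<Psi> (U y'))"
      by (simp_all add: R_def)
    from ex obtain k where k: "\<not> (k \<in> \<Psi> (S a') \<and> k \<in> \<Psi> (U y) \<longleftrightarrow> k \<in> \<Psi> (S a) \<and> k \<in> \<Psi> (U y'))" ..
    obtain i0 where i0: "a i0 \<noteq> a' i0"
      by (rule least_difference[OF ne])
    \<comment> \<open>At \<open>i0\<close> the branches differ, so no node above level
      \<open>i0\<close> is common; coordinate \<open>k\<close> of the codes preserves the
      disagreement at \<open>k\<close>.\<close>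
    show ?thesis
    proof (intro exI[of _ "max i0 k"] ballI impI)
      fix p' q' assume X': "p' \<in> X" "q' \<in> X" and
        eq: "\<forall>i\<le>max i0 k. \<phi> p' i = \<phi> p i" "\<forall>i\<le>max i0 k. \<phi> q' i = \<phi> q i"
      obtain b w b' w' where p': "p' = (b, w)" "q' = (b', w')"
        by (cases p', cases q') auto
      have fin: "finite (y i)" "finite (y' i)" "finite (w i)" "finite (w' i)" for i
        using XD(2) pq p X' p' by blast+
      have eqs: "b i = a i" "b' i = a' i" "w i = y i" "w' i = y' i" if "i \<le> i0" for i
        using eq that fin by (auto simp: \<phi>_def p p' fcode_eq_iff le_max_iff_disj)
      have "coh b b' w w'"
        unfolding coh_def
      proof (intro allI impI)
        fix n assume n: "\<forall>i<n. b i = b' i"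
        then have "n \<le> i0"
          using i0 eqs[of i0] by (metis le_refl not_le)
        with n eqs have "\<forall>i<n. a i = a' i"
          by (metis less_le_trans less_imp_le)
        then have "y n = y' n"
          using coh by (simp add: coh_def)
        then show "w n = w' n"
          using eqs[OF \<open>n \<le> i0\<close>] by simp
      qed
      moreover have "b \<noteq> b'"
        using i0 eqs[of i0] by auto
      moreover have "\<phi> p' k = \<phi> p k" "\<phi> q' k = \<phi> q k"
        using eq by simp_all
      then have "k \<in> \<Psi> (S b) \<longleftrightarrow> k \<in> \<Psi> (S a)" "k \<in> \<Psi> (U w) \<longleftrightarrow> k \<in> \<Psi> (U y)"
        "k \<in> \<Psi> (S b') \<longleftrightarrow> k \<in> \<Psi> (S a')" "k \<in> \<Psi> (U w') \<longleftrightarrow> k \<in> \<Psi> (U y')"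
        by (simp_all add: \<phi>_def p p')
      with k have "\<not> (k \<in> \<Psi> (S b') \<and> k \<in> \<Psi> (U w) \<longleftrightarrow> k \<in> \<Psi> (S b) \<and> k \<in> \<Psi> (U w'))"
        by simp
      ultimately show "R p' q'"
        unfolding R_def p' by auto
    qed
  qed
  have no_hom: False if Y: "Y \<subseteq> X" "uncountable Y" and RY: "\<And>p q. \<lbrakk>p \<in> Y; q \<in> Y; p \<noteq> q\<rbrakk> \<Longrightarrow> R p q" for Y
  proof -
    define D where "D = (\<Union>p\<in>Y. U (snd p))"
    have D: "D \<inter> S a = U y" if "(a, y) \<in> Y" for a y
    proof
      show "U y \<subseteq> D \<inter> S a"
        using that XD(1)[of a y] Y(1) unfolding D_def S_def U_def by fastforce
      show "D \<inter> S a \<subseteq> U y"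
      proof
        fix s assume "s \<in> D \<inter> S a"
        then obtain a' y' n m where s: "(a', y') \<in> Y" "s \<in> y' m" "s \<in> I (nd a n)"
          by (auto simp: D_def S_def U_def)
        then have "s \<in> I (nd a' m)"
          using XD(1)[of a' y' m] Y(1) by blast
        then have "nd a n = nd a' m"
          using disj s(3) by blast
        then have "n = m" "\<forall>i<n. a i = a' i"
          by (simp_all add: nd_eq_iff)
        moreover have "(a, y) = (a', y') \<or> coh a a' y y'"
          using RY[OF that s(1)] by (auto simp: R_def)
        ultimately have "y n = y' m"
          by (auto simp: coh_def)
        with s(2) show "s \<in> U y"
          by (auto simp: U_def)
      qed
    qed
    have "\<exists>m. \<forall>k\<ge>m. k \<in> \<Psi> (U (snd p)) \<longleftrightarrow> k \<in> \<Psi> D \<and> k \<in> \<Psi> (S (fst p))" if "p \<in> Y" for p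
      using fin_hom_Int[OF hom, of D "S (fst p)"] D[of "fst p" "snd p"] that
      by (simp add: eventually_sequentially)
    then obtain m where m: "\<And>p k. \<lbrakk>p \<in> Y; k \<ge> m p\<rbrakk> \<Longrightarrow> k \<in> \<Psi> (U (snd p)) \<longleftrightarrow> k \<in> \<Psi> D \<and> k \<in> \<Psi> (S (fst p))"
      by metis
    \<comment> \<open>Two members with the same bound and the same values below it cannot disagree
      at any \<open>k\<close>: below the bound the values are equal, above it
      \<open>\<Psi> D\<close> decides.\<close>
    define g where "g p = (m p, map (\<lambda>k. (k \<in> \<Psi> (U (snd p)), k \<in> \<Psi> (S (fst p)))) [0..<m p])" for p
    obtain p q where pq: "p \<in> Y" "q \<in> Y" "p \<noteq> q" "g p = g q"
      using uncountable_pigeonhole[OF Y(2)] by blast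
    have mpq: "m p = m q" and
      lt: "\<And>k. k < m p \<Longrightarrow> (k \<in> \<Psi> (U (snd p)) \<longleftrightarrow> k \<in> \<Psi> (U (snd q))) \<and> (k \<in> \<Psi> (S (fst p)) \<longleftrightarrow> k \<in> \<Psi> (S (fst q)))"
      using pq(4) by (auto simp: g_def map_upt_eq_iff)
    have "k \<in> \<Psi> (S (fst q)) \<and> k \<in> \<Psi> (U (snd p)) \<longleftrightarrow> k \<in> \<Psi> (S (fst p)) \<and> k \<in> \<Psi> (U (snd q))" for k
      using lt[of k] m[OF pq(1), of k] m[OF pq(2), of k] mpq by (cases "k < m p") auto
    then show False
      using RY[OF pq(1-3)] by (auto simp: R_def split: prod.splits)
  qed
  have "\<exists>Z. X = (\<Union>j::nat. Z j) \<and> (\<forall>j p q. p \<in> Z j \<longrightarrow> q \<in> Z j \<longrightarrow> \<not> R p q)"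
  proof (rule OCA_coding[OF \<open>OCA\<close> inj sym irr op no_hom])
    fix Z :: "nat \<Rightarrow> ((nat \<Rightarrow> bool) \<times> (nat \<Rightarrow> 's set)) set"
    assume "X = (\<Union>j. Z j)" "\<And>j p q. \<lbrakk>p \<in> Z j; q \<in> Z j\<rbrakk> \<Longrightarrow> \<not> R p q"
    then show ?thesis
      by (intro exI[of _ Z]) simp
  qed
  then obtain Z where Z1: "X = (\<Union>j::nat. Z j)" and Z2: "\<forall>j p q. p \<in> Z j \<longrightarrow> q \<in> Z j \<longrightarrow> \<not> R p q"
    by (elim exE conjE)
  note Z = Z1 Z2[rule_format]
  define Y where "Y a j = {y. (a, y) \<in> Z j}" for a j
  define bad where "bad a j y0 l k \<longleftrightarrow> y0 \<in> Pi UNIV (A a) \<and> dense_above (A a) (Y a j) y0 l \<and> k \<in> \<Psi> (S a) \<and>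
      (\<forall>M. \<exists>y\<in>Pi UNIV (A a) \<inter> Y a j. \<exists>y'\<in>Pi UNIV (A a) \<inter> Y a j. agree l y0 y \<and> agree l y0 y' \<and>
        agree M y y' \<and> k \<in> \<Psi> (U y) \<and> k \<notin> \<Psi> (U y'))" for a j y0 l k
  \<comment> \<open>Two bad branches with the same finite data would contradict each other: two
    points of the first that disagree about \<open>k\<close> are both compared with one point of the
    second, obtained by density. As there are uncountably many branches, some branch is not
    bad.\<close>
  have "countable {a. \<exists>j y0 l k. bad a j y0 l k}" (is "countable ?Bad")
  proof (rule ccontr)
    assume unc: "uncountable ?Bad"
    have "\<forall>a\<in>?Bad. \<exists>j y0 l k. bad a j y0 l k"
      by simp
    then obtain fj fy fl fk where f: "\<And>a. a \<in> ?Bad \<Longrightarrow> bad a (fj a) (fy a) (fl a) (fk a)"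
      by metis
    define g where "g a = (fj a, fl a, fk a, map a [0..<fl a], map (\<lambda>n. fcode (fy a n)) [0..<fl a])" for a
    obtain a a' where aa: "a \<in> ?Bad" "a' \<in> ?Bad" "a \<noteq> a'" "g a = g a'"
      using uncountable_pigeonhole[OF unc] by blast
    define j l k y0 y0' where defs: "j = fj a" "l = fl a" "k = fk a" "y0 = fy a" "y0' = fy a'"
    have bad: "bad a j y0 l k" "bad a' j y0' l k"
      using f[OF aa(1)] f[OF aa(2)] aa(4) by (simp_all add: defs g_def)
    have eq_l: "a n = a' n" "fcode (y0 n) = fcode (y0' n)" if "n < l" for n
      using aa(4) that by (auto simp: g_def map_upt_eq_iff defs)
    obtain d where d: "a d \<noteq> a' d" "\<And>i. i < d \<Longrightarrow> a i = a' i"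
      using least_difference[OF aa(3)] by blast
    have "l \<le> d"
      using d(1) eq_l(1) not_le by blast
    have nd_eq: "nd a n = nd a' n" if "n \<le> d" for n
      using d(2) that by (simp add: nd_eq_iff)
    obtain y y' where y: "y \<in> Pi UNIV (A a) \<inter> Y a j" "y' \<in> Pi UNIV (A a) \<inter> Y a j" "agree l y0 y"
      "agree (Suc d) y y'" "k \<in> \<Psi> (U y)" "k \<notin> \<Psi> (U y')"
      using bad(1) unfolding bad_def by blast
    \<comment> \<open>Level \<open>d\<close> is the last one whose node lies on both branches, so
      \<open>y\<close> is copied up to and including \<open>d\<close>; the empty set is an
      admissible value above it.\<close>
    define x where "x n = (if n \<le> d then y n else {})" for n
    have "y n \<subseteq> I (nd a n)" for n
      using y(1) by (auto simp: A_def)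
    then have "x n \<subseteq> I (nd a' n)" for n
      using nd_eq[of n] by (simp add: x_def) metis
    then have "x \<in> Pi UNIV (A a')"
      by (simp add: A_def)
    moreover have "agree l y0' x"
      unfolding agree_def
    proof (intro allI impI)
      fix n assume n: "n < l"
      have "(a, y0) \<in> X" "(a', y0') \<in> X"
        using bad by (auto simp: bad_def X_def)
      then have "y0 n = y0' n"
        using eq_l(2)[OF n] XD(2) by (simp add: fcode_eq_iff)
      then show "y0' n = x n"
        using y(3) n \<open>l \<le> d\<close> by (simp add: x_def agree_def)
    qed
    ultimately obtain x' where x': "x' \<in> Pi UNIV (A a')" "x' \<in> Y a' j" "agree (Suc d) x x'"
      using bad(2) unfolding bad_def dense_above_def by blast
    have x'_y: "x' n = y n" "x' n = y' n" if "n \<le> d" for n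
      using x'(3) y(4) that by (auto simp: agree_def x_def)
    have n_le: "n \<le> d" if "\<forall>i<n. a i = a' i" for n
      using that d(1) not_le by blast
    have "coh a a' y x'" "coh a a' y' x'"
      unfolding coh_def using x'_y n_le by metis+
    moreover have "\<not> R (a, y) (a', x')" "\<not> R (a, y') (a', x')"
      using Z(2) y(1,2) x'(2) by (auto simp: Y_def)
    ultimately have "k \<in> \<Psi> (S a') \<and> k \<in> \<Psi> (U y) \<longleftrightarrow> k \<in> \<Psi> (S a) \<and> k \<in> \<Psi> (U x')"
      "k \<in> \<Psi> (S a') \<and> k \<in> \<Psi> (U y') \<longleftrightarrow> k \<in> \<Psi> (S a) \<and> k \<in> \<Psi> (U x')"
      using aa(3) by (auto simp: R_def)
    moreover have "k \<in> \<Psi> (S a)" "k \<in> \<Psi> (S a')"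
      using bad by (auto simp: bad_def)
    ultimately show False
      using y(5,6) by simp
  qed
  then have "?Bad \<noteq> UNIV"
    using uncountable_UNIV_nat_bool by metis
  then obtain a where a: "\<And>j y0 l k. \<not> bad a j y0 l k"
    by blast
  show thesis
  proof (rule that[of a "Y a"])
    show "Pi UNIV (A a) \<subseteq> (\<Union>j. Y a j)"
    proof
      fix y assume "y \<in> Pi UNIV (A a)"
      then have "(a, y) \<in> (\<Union>j. Z j)"
        unfolding Z(1)[symmetric] by (simp add: X_def)
      then show "y \<in> (\<Union>j. Y a j)"
        by (simp add: Y_def)
    qed
    fix j y0 l k assume y0: "y0 \<in> Pi UNIV (A a)" "dense_above (A a) (Y a j) y0 l" "k \<in> \<Psi> (\<Union>n. I (nd a n))"
    then obtain M where M: "\<And>y y'. \<lbrakk>y \<in> Pi UNIV (A a) \<inter> Y a j; y' \<in> Pi UNIV (A a) \<inter> Y a j; agree l y0 y;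
        agree l y0 y'; agree M y y'\<rbrakk> \<Longrightarrow> k \<in> \<Psi> (U y) \<Longrightarrow> k \<in> \<Psi> (U y')"
      using a[of j y0 l k] unfolding bad_def S_def by blast
    show "\<exists>M. \<forall>y\<in>Pi UNIV (A a) \<inter> Y a j. \<forall>y'\<in>Pi UNIV (A a) \<inter> Y a j. agree l y0 y \<longrightarrow> agree l y0 y' \<longrightarrow>
        agree M y y' \<longrightarrow> (k \<in> \<Psi> (\<Union>n. y n) \<longleftrightarrow> k \<in> \<Psi> (\<Union>n. y' n))"
      unfolding U_def[symmetric]
    proof (intro exI[of _ M] ballI impI)
      fix y y' assume yy': "y \<in> Pi UNIV (A a) \<inter> Y a j" "y' \<in> Pi UNIV (A a) \<inter> Y a j"
        "agree l y0 y" "agree l y0 y'" "agree M y y'"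
      show "k \<in> \<Psi> (U y) \<longleftrightarrow> k \<in> \<Psi> (U y')"
        using M[OF yy'] M[OF yy'(2,1,4,3) agree_sym[OF yy'(5)]] by (rule iffI)
    qed
  qed
qed

text \<open>The given blocks are distributed over the nodes of the binary tree, and only blocks
  along one well-behaved branch are kept.\<close>

theorem local_additivity:
  fixes \<Psi> :: "'s::countable set \<Rightarrow> nat set" and I :: "nat \<Rightarrow> 's set"
  assumes OCA and hom: "fin_hom \<Psi>" and finI: "\<And>n. finite (I n)"
    and disj: "\<And>n m. n \<noteq> m \<Longrightarrow> I n \<inter> I m = {}"
  obtains c \<Omega> h where "infinite (c :: nat set)" "\<And>Z. Z \<subseteq> (\<Union>n\<in>c. I n) \<Longrightarrow>
      \<forall>\<^sub>F k in sequentially. k \<in> \<Psi> Z \<longleftrightarrow> k \<in> \<Omega> \<and> h k \<in> Z"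
proof (rule continuity_along_branch[where \<Psi> = \<Psi> and I = I, OF \<open>OCA\<close> hom finI disj])
  fix a :: "nat \<Rightarrow> bool" and Y :: "nat \<Rightarrow> (nat \<Rightarrow> 's set) set"
  assume Y: "Pi UNIV (\<lambda>n. Pow (I (nd a n))) \<subseteq> (\<Union>j. Y j)"
    "\<And>j y0 l k. \<lbrakk>y0 \<in> Pi UNIV (\<lambda>n. Pow (I (nd a n))); dense_above (\<lambda>n. Pow (I (nd a n))) (Y j) y0 l;
        k \<in> \<Psi> (\<Union>n. I (nd a n))\<rbrakk> \<Longrightarrow>
        \<exists>M. \<forall>y\<in>Pi UNIV (\<lambda>n. Pow (I (nd a n))) \<inter> Y j. \<forall>y'\<in>Pi UNIV (\<lambda>n. Pow (I (nd a n))) \<inter> Y j.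
        agree l y0 y \<longrightarrow> agree l y0 y' \<longrightarrow>
        agree M y y' \<longrightarrow> (k \<in> \<Psi> (\<Union>n. y n) \<longleftrightarrow> k \<in> \<Psi> (\<Union>n. y' n))"
  have disj': "I (nd a n) \<inter> I (nd a m) = {}" if "n \<noteq> m" for n m
    using disj that by (simp add: nd_eq_iff)
  obtain c \<Omega> h where c: "infinite (c :: nat set)" and h: "\<And>Z. Z \<subseteq> (\<Union>n\<in>c. I (nd a n)) \<Longrightarrow>
      \<forall>\<^sub>F k in sequentially. k \<in> \<Psi> Z \<longleftrightarrow> k \<in> \<Omega> \<and> h k \<in> Z"
    by (rule piecewise_continuous_lifting[of \<Psi> "\<lambda>n. I (nd a n)" Y, OF hom finI disj' Y]) blast+
  have "inj_on (nd a) c"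
    by (simp add: inj_on_def nd_eq_iff)
  with c have "infinite (nd a ` c)"
    by (simp add: finite_image_iff)
  with h that[of "nd a ` c" \<Omega> h] show thesis
    by simp
qed

text \<open>Ramsey's theorem for pairs, coloured according to whether \<open>u\<close> maps the
  smaller element to the larger, the larger to the smaller, or neither. A homogeneous triple of one
  of the first two colours would give \<open>u\<close> two values at one point.\<close>

lemma infinite_free_set:
  fixes u :: "nat \<Rightarrow> nat"
  assumes "infinite B" "\<And>n. n \<in> B \<Longrightarrow> u n \<noteq> n"
  obtains c where "c \<subseteq> B" "infinite c" "\<And>n. n \<in> c \<Longrightarrow> u n \<notin> c"
proof -
  define f where "f X = (if u (Min X) = Max X then 1 else if u (Max X) = Min X then 2 else 0 :: nat)" for X
  have f: "f {x, y} = (if u x = y then 1 else if u y = x then 2 else 0)" if "x < y" for x y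
    using that by (simp add: f_def min_def max_def)
  have "\<forall>x\<in>B. \<forall>y\<in>B. x \<noteq> y \<longrightarrow> f {x, y} < 3"
    by (simp add: f_def)
  from Ramsey2[OF assms(1) this] obtain c t where c: "c \<subseteq> B" "infinite c" "t < 3"
    "\<And>x y. \<lbrakk>x \<in> c; y \<in> c; x \<noteq> y\<rbrakk> \<Longrightarrow> f {x, y} = t"
    by blast
  have unb: "\<exists>z>x. z \<in> c" for x
    using c(2) infinite_nat_iff_unbounded by blast
  obtain x where "x \<in> c"
    using unb[of 0] by blast
  moreover obtain y where "y \<in> c" "x < y"
    using unb[of x] by blast
  moreover obtain z where "z \<in> c" "y < z"
    using unb[of y] by blast
  ultimately have xyz: "x \<in> c" "y \<in> c" "z \<in> c" "x < y" "y < z"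
    by simp_all
  have t: "f {x, y} = t" "f {x, z} = t" "f {y, z} = t"
    using xyz by (auto intro!: c(4))
  have "x < z"
    using xyz by simp
  note t' = t[unfolded f[OF xyz(4)] f[OF \<open>x < z\<close>] f[OF xyz(5)]]
  have "t = 0"
  proof (rule ccontr)
    assume "t \<noteq> 0"
    then have "u x = y \<and> t = 1 \<or> u y = x \<and> t = 2" "u x = z \<and> t = 1 \<or> u z = x \<and> t = 2"
      "u y = z \<and> t = 1 \<or> u z = y \<and> t = 2"
      using t' by (metis (full_types))+
    with xyz show False
      by linarith
  qed
  have "u n \<notin> c" if "n \<in> c" for n
  proof
    assume "u n \<in> c"
    moreover have "u n \<noteq> n"
      using assms(2) c(1) that by blast
    ultimately have "f {n, u n} = 0"
      using c(4)[OF that] \<open>t = 0\<close> by simp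
    then show False
      using f[of n "u n"] f[of "u n" n] \<open>u n \<noteq> n\<close>
      by (cases n "u n" rule: linorder_cases) (auto simp: insert_commute split: if_splits)
  qed
  with c that show thesis
    by blast
qed

section \<open>Dyadic intervals\<close>

text \<open>For \<open>s = (n, m)\<close> this is the interval [m/2^n, (m+1)/2^n). The form with
  floor reduces nesting and columns to integer division.\<close>

definition dyad :: "nat \<times> int \<Rightarrow> real set" where
  "dyad s = {y. \<lfloor>2 ^ fst s * y\<rfloor> = snd s}"

text \<open>The left end point of the unit interval, or column, that contains
  \<open>dyad s\<close>.\<close>

definition col :: "nat \<times> int \<Rightarrow> int" where
  "col s = snd s div 2 ^ fst s"

definition dyads :: "(nat \<times> int) set \<Rightarrow> real set" where
  "dyads Z = (\<Union>s\<in>Z. dyad s)"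

definition block :: "int \<Rightarrow> nat \<Rightarrow> (nat \<times> int) set" where
  "block p L = {s. fst s = L \<and> col s = p}"

lemma floor_dyadic:
  assumes "L \<le> L'"
  shows "\<lfloor>2 ^ L * y :: real\<rfloor> = \<lfloor>2 ^ L' * y\<rfloor> div 2 ^ (L' - L)"
proof -
  have "(2 :: real) ^ L' = 2 ^ L * 2 ^ (L' - L)"
    using assms by (simp flip: power_add)
  then have "2 ^ L * y = 2 ^ L' * y / real_of_int (2 ^ (L' - L))"
    by simp
  then show ?thesis
    by (metis floor_divide_real_eq_div zero_le_numeral zero_le_power)
qed

lemma floor_dyad: "y \<in> dyad s \<Longrightarrow> \<lfloor>y\<rfloor> = col s"
  using floor_dyadic[of 0 "fst s" y] by (simp add: dyad_def col_def)

lemma dyad_nonempty: "dyad s \<noteq> {}"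
proof -
  have "snd s / 2 ^ fst s \<in> dyad s"
    by (simp add: dyad_def)
  then show ?thesis
    by blast
qed

lemma dyad_nested:
  assumes "fst s \<le> fst t" "dyad s \<inter> dyad t \<noteq> {}"
  shows "dyad t \<subseteq> dyad s"
proof -
  obtain y where y: "y \<in> dyad s" "y \<in> dyad t"
    using assms(2) by blast
  then have "snd t div 2 ^ (fst t - fst s) = snd s"
    using floor_dyadic[OF assms(1), of y] by (simp add: dyad_def)
  then show ?thesis
    using floor_dyadic[OF assms(1)] by (auto simp: dyad_def)
qed

lemma dyad_disjoint:
  assumes "fst s = fst t \<and> s \<noteq> t \<or> col s \<noteq> col t"
  shows "dyad s \<inter> dyad t = {}"
proof (rule equals0I)
  fix y assume y: "y \<in> dyad s \<inter> dyad t"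
  then have "col s = col t"
    using floor_dyad[of y s] floor_dyad[of y t] by simp
  moreover have "snd s = snd t" if "fst s = fst t"
    using y that by (simp add: dyad_def)
  ultimately show False
    using assms by (auto simp: prod_eq_iff)
qed

lemma dyad_eq: "dyad s = {real_of_int (snd s) / 2 ^ fst s ..< (real_of_int (snd s) + 1) / 2 ^ fst s}"
proof -
  have "y \<in> dyad s \<longleftrightarrow> real_of_int (snd s) \<le> 2 ^ fst s * y \<and> 2 ^ fst s * y < real_of_int (snd s) + 1" for y :: real
    by (simp add: dyad_def floor_eq_iff)
  then show ?thesis
    by (intro set_eqI) (simp add: pos_divide_le_eq pos_less_divide_eq mult.commute)
qed

lemma dyad_borel [measurable]: "dyad s \<in> sets borel"
  by (simp add: dyad_eq)

lemma dyads_borel [measurable]: "dyads Z \<in> sets borel"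
  unfolding dyads_def by (intro sets.countable_UN'') auto

lemma emeasure_dyad: "emeasure lborel (dyad s) = ennreal (1 / 2 ^ fst s)"
  by (simp add: dyad_eq emeasure_lborel_Ico divide_right_mono diff_divide_distrib[symmetric])

lemma dyads_block: "dyads (block p L) = {y. \<lfloor>y\<rfloor> = p}"
proof
  show "dyads (block p L) \<subseteq> {y. \<lfloor>y\<rfloor> = p}"
    using floor_dyad by (auto simp: dyads_def block_def)
  show "{y. \<lfloor>y\<rfloor> = p} \<subseteq> dyads (block p L)"
  proof clarify
    fix y :: real
    have "y \<in> dyad (L, \<lfloor>2 ^ L * y\<rfloor>)"
      by (simp add: dyad_def)
    moreover from floor_dyad[OF this] have "(L, \<lfloor>2 ^ L * y\<rfloor>) \<in> block \<lfloor>y\<rfloor> L"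
      by (simp add: block_def)
    ultimately show "y \<in> dyads (block \<lfloor>y\<rfloor> L)"
      unfolding dyads_def by blast
  qed
qed

lemma finite_block: "finite (block p L)"
proof (rule finite_subset)
  show "block p L \<subseteq> {L} \<times> {p * 2 ^ L ..< (p + 1) * 2 ^ L}"
  proof
    fix s assume "s \<in> block p L"
    then have "fst s = L" "snd s div 2 ^ L = p"
      by (auto simp: block_def col_def)
    moreover define m where "m = snd s mod 2 ^ L"
    ultimately have "snd s = p * 2 ^ L + m"
      by (metis div_mult_mod_eq)
    moreover have "0 \<le> m" "m < 2 ^ L"
      by (simp_all add: m_def)
    ultimately have "p * 2 ^ L \<le> snd s" "snd s < p * 2 ^ L + 2 ^ L"
      by linarith+
    then show "s \<in> {L} \<times> {p * 2 ^ L ..< (p + 1) * 2 ^ L}"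
      using \<open>fst s = L\<close> by (simp add: mem_Times_iff distrib_right)
  qed
qed simp

lemma floor_eq_borel [measurable]: "{y :: real. \<lfloor>y\<rfloor> = p} \<in> sets borel"
  using dyads_borel[of "block p 0"] by (simp add: dyads_block)

lemma emeasure_floor_eq: "emeasure lborel {y :: real. \<lfloor>y\<rfloor> = p} = 1"
proof -
  have "{y :: real. \<lfloor>y\<rfloor> = p} = dyad (0, p)"
    by (simp add: dyad_def)
  then show ?thesis
    by (simp add: emeasure_dyad)
qed

section \<open>Liftings of embeddings of the measure algebra\<close>

text \<open>Representatives for the values of an embedding of the measure algebra. The first clause
  combines preservation of bottom with injectivity.\<close>

definition null_lifting :: "(real set \<Rightarrow> nat set) \<Rightarrow> bool" where
  "null_lifting \<Phi> \<longleftrightarrow>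
     (\<forall>A\<in>sets borel. finite (\<Phi> A) \<longleftrightarrow> A \<in> null_sets lborel) \<and>
     (\<forall>A\<in>sets borel. \<forall>B\<in>sets borel. (\<forall>\<^sub>F k in sequentially. k \<in> \<Phi> (A \<inter> B) \<longleftrightarrow> k \<in> \<Phi> A \<and> k \<in> \<Phi> B) \<and>
       (\<forall>\<^sub>F k in sequentially. k \<in> \<Phi> (A \<union> B) \<longleftrightarrow> k \<in> \<Phi> A \<or> k \<in> \<Phi> B))"

lemma eventually_notin_iff_finite: "(\<forall>\<^sub>F k in sequentially. k \<notin> X) \<longleftrightarrow> finite (X :: nat set)"
  by (simp add: cofinite_eq_sequentially[symmetric] eventually_cofinite)

lemma fin_eq_iff_eventually: "fin_eq X Y \<longleftrightarrow> (\<forall>\<^sub>F k in sequentially. k \<in> X \<longleftrightarrow> k \<in> Y)"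
  unfolding fin_eq_def eventually_notin_iff_finite[symmetric]
  by (intro arg_cong[where f = "\<lambda>P. eventually P sequentially"]) auto

lemma embedding_imp_null_lifting:
  assumes "boolean_algebra_embedding (e :: measure_algebra \<Rightarrow> pow_nat_mod_fin)"
  obtains \<Phi> where "null_lifting \<Phi>"
proof -
  define \<Phi> where "\<Phi> A = rep_pow_nat_mod_fin (e (abs_measure_algebra A))" for A
  have e: "e bot = bot" "\<And>a b. e (inf a b) = inf (e a) (e b)" "\<And>a b. e (sup a b) = sup (e a) (e b)" "inj e"
    using assms by (auto simp: boolean_algebra_embedding_def boolean_algebra_hom_def)
  have abs_\<Phi>: "abs_pow_nat_mod_fin (\<Phi> A) = e (abs_measure_algebra A)" for A
    by (simp add: \<Phi>_def Quotient_abs_rep[OF Quotient_pow_nat_mod_fin])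
  have refl: "borel_null_eq A A" if "A \<in> sets borel" for A
    using that by (simp add: borel_null_eq_def)
  have "finite (\<Phi> A) \<longleftrightarrow> A \<in> null_sets lborel" if A: "A \<in> sets borel" for A
  proof -
    have "finite (\<Phi> A) \<longleftrightarrow> fin_eq (\<Phi> A) {}"
      by (simp add: fin_eq_def)
    also have "\<dots> \<longleftrightarrow> e (abs_measure_algebra A) = e bot"
      unfolding e(1) abs_\<Phi>[symmetric] bot_pow_nat_mod_fin_def by (simp add: pow_nat_mod_fin.abs_eq_iff)
    also have "\<dots> \<longleftrightarrow> abs_measure_algebra A = abs_measure_algebra {}"
      using \<open>inj e\<close> by (simp add: inj_eq bot_measure_algebra_def)
    also have "\<dots> \<longleftrightarrow> borel_null_eq A {}"
      using Quotient_rel[OF Quotient_measure_algebra, of A "{}"] refl A by simp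
    also have "\<dots> \<longleftrightarrow> A \<in> null_sets lborel"
      using A by (simp add: borel_null_eq_def)
    finally show ?thesis .
  qed
  moreover have "fin_eq (\<Phi> (A \<inter> B)) (\<Phi> A \<inter> \<Phi> B)" "fin_eq (\<Phi> (A \<union> B)) (\<Phi> A \<union> \<Phi> B)"
    if "A \<in> sets borel" "B \<in> sets borel" for A B
  proof -
    have "abs_pow_nat_mod_fin (\<Phi> (A \<inter> B)) = abs_pow_nat_mod_fin (\<Phi> A \<inter> \<Phi> B)"
      unfolding abs_\<Phi> inf_pow_nat_mod_fin.abs_eq[symmetric] e(2)[symmetric]
      using inf_measure_algebra.abs_eq[OF refl[OF that(1)] refl[OF that(2)]] by simp
    moreover have "abs_pow_nat_mod_fin (\<Phi> (A \<union> B)) = abs_pow_nat_mod_fin (\<Phi> A \<union> \<Phi> B)"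
      unfolding abs_\<Phi> sup_pow_nat_mod_fin.abs_eq[symmetric] e(3)[symmetric]
      using sup_measure_algebra.abs_eq[OF refl[OF that(1)] refl[OF that(2)]] by simp
    ultimately show "fin_eq (\<Phi> (A \<inter> B)) (\<Phi> A \<inter> \<Phi> B)" "fin_eq (\<Phi> (A \<union> B)) (\<Phi> A \<union> \<Phi> B)"
      by (simp_all add: pow_nat_mod_fin.abs_eq_iff)
  qed
  ultimately have "null_lifting \<Phi>"
    by (simp add: null_lifting_def fin_eq_iff_eventually)
  then show thesis
    by (rule that)
qed

lemma null_liftingD:
  assumes "null_lifting \<Phi>" and A: "A \<in> sets borel" and B: "B \<in> sets borel"
  shows null_lifting_Int: "\<forall>\<^sub>F k in sequentially. k \<in> \<Phi> (A \<inter> B) \<longleftrightarrow> k \<in> \<Phi> A \<and> k \<in> \<Phi> B"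
    and null_lifting_Un: "\<forall>\<^sub>F k in sequentially. k \<in> \<Phi> (A \<union> B) \<longleftrightarrow> k \<in> \<Phi> A \<or> k \<in> \<Phi> B"
  using assms unfolding null_lifting_def by blast+

lemma null_lifting_finite_iff:
  "null_lifting \<Phi> \<Longrightarrow> A \<in> sets borel \<Longrightarrow> finite (\<Phi> A) \<longleftrightarrow> A \<in> null_sets lborel"
  unfolding null_lifting_def by blast

lemma null_lifting_empty: "null_lifting \<Phi> \<Longrightarrow> \<forall>\<^sub>F k in sequentially. k \<notin> \<Phi> {}"
  unfolding eventually_notin_iff_finite using null_lifting_finite_iff[of \<Phi> "{}"] by simp

lemma fin_hom_null_lifting:
  assumes \<Phi>: "null_lifting \<Phi>" and F: "\<And>x. F x \<in> sets borel" "F {} = {}"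
    "\<And>x y. F (x \<inter> y) = F x \<inter> F y" "\<And>x y. F (x \<union> y) = F x \<union> F y"
  shows "fin_hom (\<lambda>x. \<Phi> (F x))"
  unfolding fin_hom_def F(2-4)
  using null_lifting_empty[OF \<Phi>] null_liftingD[OF \<Phi> F(1) F(1)] by simp

text \<open>Nested dyadic intervals would spoil the preservation of intersections, so
  \<open>dyads\<close> is applied after cutting down to \<open>T\<close>, whose intervals are
  pairwise disjoint because the columns \<open>p n\<close> are distinct.\<close>

lemma local_additivity_dyads:
  fixes p :: "nat \<Rightarrow> int" and L :: "nat \<Rightarrow> nat"
  assumes OCA and \<Phi>: "null_lifting \<Phi>" and p: "inj p"
  obtains c \<Omega> h where "infinite (c :: nat set)" "\<And>k. k \<in> \<Omega> \<Longrightarrow> h k \<in> (\<Union>n\<in>c. block (p n) (L n))"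
    "\<And>Z. Z \<subseteq> (\<Union>n\<in>c. block (p n) (L n)) \<Longrightarrow>
      \<forall>\<^sub>F k in sequentially. k \<in> \<Phi> (dyads Z) \<longleftrightarrow> k \<in> \<Omega> \<and> h k \<in> Z"
proof -
  define T where "T = (\<Union>n. block (p n) (L n))"
  have disj: "dyad s \<inter> dyad t = {}" if "s \<in> T" "t \<in> T" "s \<noteq> t" for s t
  proof (rule dyad_disjoint)
    obtain n m where "s \<in> block (p n) (L n)" "t \<in> block (p m) (L m)"
      using \<open>s \<in> T\<close> \<open>t \<in> T\<close> by (auto simp: T_def)
    then show "fst s = fst t \<and> s \<noteq> t \<or> col s \<noteq> col t"
      using p \<open>s \<noteq> t\<close> by (cases "n = m") (auto simp: block_def inj_eq)
  qed
  have "fin_hom (\<lambda>x. \<Phi> (dyads (x \<inter> T)))"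
  proof (rule fin_hom_null_lifting[OF \<Phi>])
    show "dyads ((x \<inter> y) \<inter> T) = dyads (x \<inter> T) \<inter> dyads (y \<inter> T)" for x y
    proof
      show "dyads (x \<inter> T) \<inter> dyads (y \<inter> T) \<subseteq> dyads ((x \<inter> y) \<inter> T)"
      proof
        fix a assume "a \<in> dyads (x \<inter> T) \<inter> dyads (y \<inter> T)"
        then obtain s t where st: "s \<in> x" "s \<in> T" "a \<in> dyad s" "t \<in> y" "t \<in> T" "a \<in> dyad t"
          by (auto simp: dyads_def)
        then have "s = t"
          using disj[of s t] by blast
        with st show "a \<in> dyads ((x \<inter> y) \<inter> T)"
          by (auto simp: dyads_def)
      qed
    qed (auto simp: dyads_def)
  qed (auto simp: dyads_def Int_Un_distrib2 simp del: UN_simps intro: dyads_borel[unfolded dyads_def])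
  moreover have "block (p n) (L n) \<inter> block (p m) (L m) = {}" if "n \<noteq> m" for n m
    using that p by (auto simp: block_def inj_eq)
  ultimately show thesis
  proof (rule local_additivity[where I = "\<lambda>n. block (p n) (L n)", OF \<open>OCA\<close> _ finite_block])
    fix c \<Omega> and h :: "nat \<Rightarrow> nat \<times> int"
    assume c: "infinite c" and h: "\<And>Z. Z \<subseteq> (\<Union>n\<in>c. block (p n) (L n)) \<Longrightarrow>
      \<forall>\<^sub>F k in sequentially. k \<in> \<Phi> (dyads (Z \<inter> T)) \<longleftrightarrow> k \<in> \<Omega> \<and> h k \<in> Z"
    \<comment> \<open>Shrinking \<open>\<Omega>\<close> places every \<open>h k\<close> in the
      chosen blocks; the equivalence survives because \<open>Z\<close> lies there too.\<close>
    show thesis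
    proof (rule that[of c "\<Omega> \<inter> {k. h k \<in> (\<Union>n\<in>c. block (p n) (L n))}" h])
      fix Z assume Z: "Z \<subseteq> (\<Union>n\<in>c. block (p n) (L n))"
      then have ZT: "Z \<inter> T = Z"
        by (auto simp: T_def)
      show "\<forall>\<^sub>F k in sequentially. k \<in> \<Phi> (dyads Z) \<longleftrightarrow>
          k \<in> \<Omega> \<inter> {k. h k \<in> (\<Union>n\<in>c. block (p n) (L n))} \<and> h k \<in> Z"
        using h[OF Z] unfolding ZT by eventually_elim (use Z in auto)
    qed (use c in auto)
  qed
qed

section \<open>Comparing the liftings of different branches\<close>

lemma dyads_mono_floor:
  assumes "Z \<subseteq> block p L" "y \<in> dyads Z"
  shows "\<lfloor>y\<rfloor> = p"
  using assms floor_dyad by (fastforce simp: dyads_def block_def)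

text \<open>In a common column, this lets a branch with a finer division reproduce an interval of a
  branch with a coarser one.\<close>

lemma dyads_refine:
  assumes "fst s \<le> L"
  shows "dyads {t \<in> block (col s) L. dyad t \<subseteq> dyad s} = dyad s"
proof
  show "dyad s \<subseteq> dyads {t \<in> block (col s) L. dyad t \<subseteq> dyad s}"
  proof
    fix y assume y: "y \<in> dyad s"
    define t where "t = (L, \<lfloor>2 ^ L * y\<rfloor>)"
    have t: "y \<in> dyad t"
      by (simp add: dyad_def t_def)
    then have "t \<in> block (col s) L"
      using floor_dyad[OF y] floor_dyad[OF t] by (simp add: block_def t_def)
    moreover have "dyad t \<subseteq> dyad s"
      using dyad_nested[of s t] assms y t by (auto simp: t_def)
    ultimately show "y \<in> dyads {t \<in> block (col s) L. dyad t \<subseteq> dyad s}"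
      using t unfolding dyads_def by blast
  qed
qed (auto simp: dyads_def)

text \<open>The colouring is designed such that in an uncountable homogeneous set the liftings \<open>h f\<close> would
  have to disagree about \<open>\<Phi>\<close> of a single Borel set. If two functions with the same code assigned
  disjoint intervals to some \<open>k\<close>, then by density they would occur in a pair of the first colour.\<close>

lemma liftings_cohere:
  fixes p :: "(nat \<Rightarrow> nat) \<Rightarrow> nat \<Rightarrow> int" and L :: "nat \<Rightarrow> nat"
    and C \<Omega> :: "(nat \<Rightarrow> nat) \<Rightarrow> nat set" and h :: "(nat \<Rightarrow> nat) \<Rightarrow> nat \<Rightarrow> nat \<times> int"
  assumes OCA and \<Phi>: "null_lifting \<Phi>"
    and p: "\<And>f f' n m. p f n = p f' m \<longleftrightarrow> n = m \<and> (\<forall>i<n. f i = f' i)"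
    and h_block: "\<And>f k. k \<in> \<Omega> f \<Longrightarrow> h f k \<in> (\<Union>n\<in>C f. block (p f n) (L (f n)))"
    and h: "\<And>f Z. Z \<subseteq> (\<Union>n\<in>C f. block (p f n) (L (f n))) \<Longrightarrow>
      \<forall>\<^sub>F k in sequentially. k \<in> \<Phi> (dyads Z) \<longleftrightarrow> k \<in> \<Omega> f \<and> h f k \<in> Z"
  obtains code lf :: "(nat \<Rightarrow> nat) \<Rightarrow> nat" where
    "\<And>f f' k n. \<lbrakk>code f = code f'; k \<in> \<Omega> f; k \<in> \<Omega> f'; col (h f k) = p f n; col (h f' k) = p f n; lf f \<le> n\<rbrakk> \<Longrightarrow>
        dyad (h f k) \<inter> dyad (h f' k) \<noteq> {}"
proof -
  define T where "T f = (\<Union>n\<in>C f. block (p f n) (L (f n)))" for f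
  define A where "A f n = (if n \<in> C f then Pow (block (p f n) (L (f n))) else {{}})" for f n
  define U where "U x = (\<Union>n. x n)" for x :: "nat \<Rightarrow> (nat \<times> int) set"
  define X where "X = {(f, x). x \<in> Pi UNIV (A f)}"
  \<comment> \<open>Branches that split at level \<open>n\<close> may divide their common column
    there differently, so the sets of reals are compared rather than the sets of indices.\<close>
  define coh where "coh f f' x x' \<longleftrightarrow> (\<forall>n. (\<forall>i<n. f i = f' i) \<longrightarrow> n \<in> C f \<longrightarrow> n \<in> C f' \<longrightarrow> dyads (x n) = dyads (x' n))"
    for f f' and x x' :: "nat \<Rightarrow> (nat \<times> int) set"
  \<comment> \<open>A conflict: both branches assign to \<open>k\<close> an interval of the same
    column, but only one of the two intervals is selected by the point on its branch.\<close>
  define conf where "conf f f' x x' k \<longleftrightarrow> k \<in> \<Omega> f \<and> k \<in> \<Omega> f' \<and> col (h f k) = col (h f' k) \<and>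
      \<not> (h f k \<in> U x \<longleftrightarrow> h f' k \<in> U x')" for f f' x x' k
  define R where "R = (\<lambda>(f, x) (f', x'). f \<noteq> f' \<and> coh f f' x x' \<and> (\<exists>k. conf f f' x x' k))"
  define \<phi> where "\<phi> = (\<lambda>(f, x) i. (f i, i \<in> C f, i \<in> \<Omega> f, h f i, fcode (x i), h f i \<in> U x))"
  have xD: "x n \<subseteq> block (p f n) (L (f n))" "x n \<noteq> {} \<Longrightarrow> n \<in> C f" "finite (x n)"
    if "(f, x) \<in> X" for f x n
  proof -
    have "x n \<in> A f n"
      using that by (auto simp: X_def)
    then show "x n \<subseteq> block (p f n) (L (f n))" "x n \<noteq> {} \<Longrightarrow> n \<in> C f"
      by (auto simp: A_def split: if_splits)
    then show "finite (x n)"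
      using finite_block finite_subset by blast
  qed
  have U_T: "U x \<subseteq> T f" if "(f, x) \<in> X" for f x
    using xD(1,2)[OF that] unfolding U_def T_def by blast
  have hD: "n \<in> C f" "h f k \<in> block (p f n) (L (f n))" if k: "k \<in> \<Omega> f" "col (h f k) = p f n" for f k n
  proof -
    obtain m where "m \<in> C f" "h f k \<in> block (p f m) (L (f m))"
      using h_block[OF k(1)] by blast
    moreover from this k(2) have "m = n"
      using p[of f m f n] by (simp add: block_def)
    ultimately show "n \<in> C f" "h f k \<in> block (p f n) (L (f n))"
      by simp_all
  qed
  have inj: "inj_on \<phi> X"
  proof (rule inj_onI)
    fix q r assume qr: "q \<in> X" "r \<in> X" "\<phi> q = \<phi> r"
    obtain f x f' x' where eq: "q = (f, x)" "r = (f', x')"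
      by (cases q, cases r) auto
    have "f i = f' i" "fcode (x i) = fcode (x' i)" for i
      using fun_cong[OF qr(3), of i] by (simp_all add: eq \<phi>_def)
    moreover have "finite (x i)" "finite (x' i)" for i
      using xD(3) qr eq by blast+
    ultimately show "q = r"
      by (simp add: eq fun_eq_iff fcode_eq_iff)
  qed
  have sym: "R r q" if "R q r" for q r
    using that by (cases q, cases r) (auto simp: R_def coh_def conf_def eq_commute)
  have irr: "\<not> R q q" for q
    by (cases q) (simp add: R_def)
  have op: "\<exists>N. \<forall>q'\<in>X. \<forall>r'\<in>X. (\<forall>i\<le>N. \<phi> q' i = \<phi> q i) \<longrightarrow> (\<forall>i\<le>N. \<phi> r' i = \<phi> r i) \<longrightarrow> R q' r'"
    if qr: "q \<in> X" "r \<in> X" "R q r" for q r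
  proof -
    obtain f x f' x' where eq: "q = (f, x)" "r = (f', x')"
      by (cases q, cases r) auto
    with qr(3) have ne: "f \<noteq> f'" and coh: "coh f f' x x'" and ex: "\<exists>k. conf f f' x x' k"
      by (simp_all add: R_def)
    from ex obtain k where k: "conf f f' x x' k" ..
    obtain i0 where i0: "f i0 \<noteq> f' i0"
      by (rule least_difference[OF ne])
    show ?thesis
    proof (intro exI[of _ "max i0 k"] ballI impI)
      fix q' r' assume X': "q' \<in> X" "r' \<in> X" and
        eqs: "\<forall>i\<le>max i0 k. \<phi> q' i = \<phi> q i" "\<forall>i\<le>max i0 k. \<phi> r' i = \<phi> r i"
      obtain g w g' w' where eq': "q' = (g, w)" "r' = (g', w')"
        by (cases q', cases r') auto
      have fin: "finite (x i)" "finite (x' i)" "finite (w i)" "finite (w' i)" for i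
        using xD(3) qr eq X' eq' by blast+
      have E: "g i = f i" "g' i = f' i" "w i = x i" "w' i = x' i" "i \<in> C g \<longleftrightarrow> i \<in> C f" "i \<in> C g' \<longleftrightarrow> i \<in> C f'"
        if "i \<le> i0" for i
        using eqs that fin by (auto simp: \<phi>_def eq eq' fcode_eq_iff le_max_iff_disj)
      have "coh g g' w w'"
        unfolding coh_def
      proof (intro allI impI)
        fix n assume n: "\<forall>i<n. g i = g' i" "n \<in> C g" "n \<in> C g'"
        then have "n \<le> i0"
          using i0 E(1,2)[of i0] by (metis le_refl not_le)
        with n(1) E(1,2) have "\<forall>i<n. f i = f' i"
          by (metis less_le_trans less_imp_le)
        then have "dyads (x n) = dyads (x' n)"
          using coh n(2,3) E(5,6)[OF \<open>n \<le> i0\<close>] by (simp add: coh_def)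
        then show "dyads (w n) = dyads (w' n)"
          using E[OF \<open>n \<le> i0\<close>] by simp
      qed
      moreover have "g \<noteq> g'"
        using i0 E[of i0] by auto
      moreover have "\<phi> q' k = \<phi> q k" "\<phi> r' k = \<phi> r k"
        using eqs by simp_all
      then have "conf g g' w w' k"
        using k by (auto simp: \<phi>_def eq eq' conf_def)
      ultimately show "R q' r'"
        unfolding R_def eq' by auto
    qed
  qed
  have no_hom: False if Y: "Y \<subseteq> X" "uncountable Y" and RY: "\<And>q r. \<lbrakk>q \<in> Y; r \<in> Y; q \<noteq> r\<rbrakk> \<Longrightarrow> R q r" for Y
  proof -
    define D where "D = (\<Union>q\<in>Y. dyads (U (snd q)))"
    have D_col: "D \<inter> {y. \<lfloor>y\<rfloor> = p f n} = dyads (x n)" if fx: "(f, x) \<in> Y" and n: "n \<in> C f" for f x n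
    proof
      have "x n \<subseteq> U x"
        by (auto simp: U_def)
      then have "dyads (x n) \<subseteq> dyads (U x)"
        unfolding dyads_def by blast
      also have "\<dots> \<subseteq> D"
        using UN_upper[OF fx, of "\<lambda>q. dyads (U (snd q))"] by (simp add: D_def)
      finally show "dyads (x n) \<subseteq> D \<inter> {y. \<lfloor>y\<rfloor> = p f n}"
        using dyads_mono_floor[OF xD(1)] fx Y(1) by blast
      show "D \<inter> {y. \<lfloor>y\<rfloor> = p f n} \<subseteq> dyads (x n)"
      proof clarify
        fix y assume y: "y \<in> D" "\<lfloor>y\<rfloor> = p f n"
        then obtain f' x' m s where s: "(f', x') \<in> Y" "s \<in> x' m" "y \<in> dyad s"
          by (auto simp: D_def U_def dyads_def)
        then have X': "(f', x') \<in> X"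
          using Y(1) by blast
        have "y \<in> dyads (x' m)"
          using s unfolding dyads_def by blast
        then have "p f n = p f' m"
          using dyads_mono_floor[OF xD(1)[OF X']] y(2) by metis
        then have "n = m" "\<forall>i<n. f i = f' i"
          using p by blast+
        moreover have "m \<in> C f'"
          using xD(2)[OF X'] s(2) by blast
        moreover have "(f, x) = (f', x') \<or> coh f f' x x'"
          using RY[OF fx s(1)] by (auto simp: R_def)
        ultimately have "dyads (x n) = dyads (x' m)"
          using n by (auto simp: coh_def)
        with \<open>y \<in> dyads (x' m)\<close> show "y \<in> dyads (x n)"
          by simp
      qed
    qed
    \<comment> \<open>Although the union over \<open>Y\<close> is uncountable, coherence makes all
      contributions to one column coincide, and each is a union of dyadic intervals.\<close>
    have "D \<inter> {y. \<lfloor>y\<rfloor> = c} \<in> sets borel" for c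
    proof (cases "D \<inter> {y. \<lfloor>y\<rfloor> = c} = {}")
      case False
      then obtain y where y: "y \<in> D" "\<lfloor>y\<rfloor> = c"
        by blast
      then obtain f x n s where s: "(f, x) \<in> Y" "s \<in> x n" "y \<in> dyad s"
        by (auto simp: D_def U_def dyads_def)
      then have X': "(f, x) \<in> X"
        using Y(1) by blast
      have "y \<in> dyads (x n)"
        using s unfolding dyads_def by blast
      then have "c = p f n"
        using dyads_mono_floor[OF xD(1)[OF X']] y(2) by metis
      moreover have "n \<in> C f"
        using xD(2)[OF X'] s(2) by blast
      ultimately show ?thesis
        using D_col[OF s(1)] by simp
    qed (simp only: sets.empty_sets)
    then have "(\<Union>c. D \<inter> {y. \<lfloor>y\<rfloor> = c}) \<in> sets borel"
      by (intro sets.countable_UN) auto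
    moreover have "(\<Union>c. D \<inter> {y. \<lfloor>y\<rfloor> = c}) = D"
      by auto
    ultimately have D_borel: "D \<in> sets borel"
      by simp
    have D_T: "D \<inter> dyads (T f) = dyads (U x)" if fx: "(f, x) \<in> Y" for f x
    proof -
      have X': "(f, x) \<in> X"
        using fx Y(1) by blast
      have "D \<inter> dyads (T f) = (\<Union>n\<in>C f. D \<inter> dyads (block (p f n) (L (f n))))"
        by (auto simp: T_def dyads_def)
      also have "\<dots> = (\<Union>n\<in>C f. dyads (x n))"
        using D_col[OF fx] by (simp add: dyads_block)
      also have "\<dots> = dyads (U x)"
        using xD(2)[OF X'] by (fastforce simp: U_def dyads_def)
      finally show ?thesis .
    qed
    have "\<exists>m. \<forall>k\<ge>m. k \<in> \<Omega> (fst q) \<longrightarrow> (h (fst q) k \<in> U (snd q) \<longleftrightarrow> k \<in> \<Phi> D)" if "q \<in> Y" for q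
    proof -
      obtain f x where q: "q = (f, x)"
        by (cases q)
      with that Y(1) have fx: "(f, x) \<in> Y" "(f, x) \<in> X"
        by auto
      have "\<forall>\<^sub>F k in sequentially. k \<in> \<Omega> f \<longrightarrow> (h f k \<in> U x \<longleftrightarrow> k \<in> \<Phi> D)"
        using null_lifting_Int[OF \<Phi> D_borel dyads_borel, of "T f"] h[OF U_T[OF fx(2), unfolded T_def]]
          h[of "T f" f, unfolded T_def, OF subset_refl]
        unfolding D_T[OF fx(1)] T_def[symmetric]
      proof eventually_elim
        case (elim k)
        have "h f k \<in> T f" if "k \<in> \<Omega> f"
          using h_block[OF that] by (simp add: T_def)
        with elim show ?case
          by blast
      qed
      then show ?thesis
        by (simp add: q eventually_sequentially)
    qed
    then obtain m where m: "\<And>q k. \<lbrakk>q \<in> Y; k \<ge> m q; k \<in> \<Omega> (fst q)\<rbrakk> \<Longrightarrow> h (fst q) k \<in> U (snd q) \<longleftrightarrow> k \<in> \<Phi> D"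
      by metis
    \<comment> \<open>Pigeonhole again: below the common bound the values coincide, and above it
      membership in \<open>\<Phi> D\<close> decides both, so no conflict remains.\<close>
    define g where "g q = (m q, map (\<lambda>k. h (fst q) k \<in> U (snd q)) [0..<m q])" for q
    obtain q r where qr: "q \<in> Y" "r \<in> Y" "q \<noteq> r" "g q = g r"
      using uncountable_pigeonhole[OF Y(2)] by blast
    have mqr: "m q = m r" and
      lt: "\<And>k. k < m q \<Longrightarrow> h (fst q) k \<in> U (snd q) \<longleftrightarrow> h (fst r) k \<in> U (snd r)"
      using qr(4) by (auto simp: g_def map_upt_eq_iff)
    have "\<not> conf (fst q) (fst r) (snd q) (snd r) k" for k
      using lt[of k] m[OF qr(1), of k] m[OF qr(2), of k] mqr by (cases "k < m q") (auto simp: conf_def)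
    then show False
      using RY[OF qr(1-3)] by (auto simp: R_def split: prod.splits)
  qed
  have "\<exists>Z. X = (\<Union>j::nat. Z j) \<and> (\<forall>j q r. q \<in> Z j \<longrightarrow> r \<in> Z j \<longrightarrow> \<not> R q r)"
  proof (rule OCA_coding[OF \<open>OCA\<close> inj sym irr op no_hom])
    fix Z :: "nat \<Rightarrow> ((nat \<Rightarrow> nat) \<times> (nat \<Rightarrow> (nat \<times> int) set)) set"
    assume "X = (\<Union>j. Z j)" "\<And>j q r. \<lbrakk>q \<in> Z j; r \<in> Z j\<rbrakk> \<Longrightarrow> \<not> R q r"
    then show ?thesis
      by (intro exI[of _ Z]) simp
  qed
  then obtain Z where Z1: "X = (\<Union>j::nat. Z j)" and Z2: "\<forall>j q r. q \<in> Z j \<longrightarrow> r \<in> Z j \<longrightarrow> \<not> R q r"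
    by (elim exE conjE)
  note Z = Z1 Z2[rule_format]
  have "\<exists>j x l. x \<in> Pi UNIV (A f) \<and> dense_above (A f) {x. (f, x) \<in> Z j} x l" for f
  proof (rule somewhere_dense[of "A f" "\<lambda>j. {x. (f, x) \<in> Z j}"])
    show "finite (A f n)" for n
      by (simp add: A_def finite_block)
    have "(\<lambda>_. {}) \<in> Pi UNIV (A f)"
      by (simp add: A_def)
    then show "Pi UNIV (A f) \<noteq> {}"
      by blast
    show "Pi UNIV (A f) \<subseteq> (\<Union>j. {x. (f, x) \<in> Z j})"
    proof
      fix x assume "x \<in> Pi UNIV (A f)"
      then have "(f, x) \<in> (\<Union>j. Z j)"
        unfolding Z(1)[symmetric] by (simp add: X_def)
      then show "x \<in> (\<Union>j. {x. (f, x) \<in> Z j})"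
        by simp
    qed
  qed blast
  then obtain fj fx fl where dense: "\<And>f. fx f \<in> Pi UNIV (A f)"
    "\<And>f. dense_above (A f) {x. (f, x) \<in> Z (fj f)} (fx f) (fl f)"
    by metis
  \<comment> \<open>Equal codes mean that the branches agree below a common length and that their
    sections of the same piece are dense above the same initial part.\<close>
  define code where "code f = to_nat (fj f, fl f, map f [0..<fl f], map (\<lambda>n. fcode (fx f n)) [0..<fl f])" for f
  \<comment> \<open>By symmetry, \<open>f'\<close> may be taken to divide the column at least as
    finely as \<open>f\<close>.\<close>
  have key: False
    if code: "code f = code f'" and k: "k \<in> \<Omega> f" "k \<in> \<Omega> f'" and
      col: "col (h f k) = p f n" "col (h f' k) = p f n" and n: "fl f \<le> n" and
      disj: "dyad (h f k) \<inter> dyad (h f' k) = {}" and le: "L (f n) \<le> L (f' n)" for f f' k n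
  proof -
    obtain m where "col (h f' k) = p f' m"
      using h_block[OF k(2)] by (auto simp: block_def)
    with col(2) have "p f n = p f' m"
      by simp
    then have "n = m" and agree_n: "\<And>i. i < n \<Longrightarrow> f i = f' i"
      using p by blast+
    with \<open>col (h f' k) = p f' m\<close> have col': "col (h f' k) = p f' n" "p f n = p f' n"
      using col(2) by simp_all
    have block: "n \<in> C f" "h f k \<in> block (p f n) (L (f n))" "n \<in> C f'" "h f' k \<in> block (p f' n) (L (f' n))"
      using hD[OF k(1) col(1)] hD[OF k(2) col'(1)] by simp_all
    have "f \<noteq> f'"
      using disj dyad_nonempty[of "h f k"] by auto
    then obtain d where d: "f d \<noteq> f' d" "\<And>i. i < d \<Longrightarrow> f i = f' i"
      by (rule least_difference) blast
    have n_le: "i \<le> d" if "\<forall>j<i. f j = f' j" for i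
      using that d(1) not_le by blast
    have "n \<le> d"
      using n_le agree_n by blast
    have same: "fj f = fj f'" "fl f = fl f'" and fx_eq: "\<And>i. i < fl f \<Longrightarrow> fx f i = fx f' i"
    proof -
      show same: "fj f = fj f'" "fl f = fl f'"
        using code by (simp_all add: code_def)
      fix i assume "i < fl f"
      then have "fcode (fx f i) = fcode (fx f' i)"
        using code by (auto simp: code_def map_upt_eq_iff)
      moreover have "(f, fx f) \<in> X" "(f', fx f') \<in> X"
        using dense(1) by (simp_all add: X_def)
      ultimately show "fx f i = fx f' i"
        using xD(3) by (simp add: fcode_eq_iff)
    qed
    define s where "s = h f k"
    \<comment> \<open>In column \<open>n\<close>, \<open>x\<close> selects \<open>s\<close> and
      \<open>x'\<close> the finer intervals inside \<open>s\<close>. They agree as sets of reals,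
      but \<open>h f' k\<close>, disjoint from \<open>s\<close>, is not selected. Density then
      yields points of one piece with a conflict at \<open>k\<close>.\<close>
    define x where "x i = (if i < fl f then fx f i else if i = n then {s} else {})" for i
    define x' where "x' i = (if i < fl f then fx f' i else if i = n then {t \<in> block (col s) (L (f' n)). dyad t \<subseteq> dyad s} else {})" for i
    have fxA: "fx f i \<in> A f i" "fx f' i \<in> A f' i" for i
      using dense(1) by blast+
    have s_block: "col s = p f' n" "s \<in> block (p f n) (L (f n))"
      using col(1) col'(2) block(2) by (simp_all add: s_def)
    have "x i \<in> A f i" for i
    proof (cases "i < fl f")
      case False
      then show ?thesis
        using block(1) s_block(2) by (simp add: x_def A_def)
    qed (simp add: x_def fxA)
    moreover have "x' i \<in> A f' i" for i
    proof (cases "i < fl f")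
      case False
      then show ?thesis
        using block(3) s_block(1) by (auto simp add: x'_def A_def)
    qed (simp add: x'_def fxA)
    ultimately have "x \<in> Pi UNIV (A f)" "x' \<in> Pi UNIV (A f')"
      by blast+
    moreover have "agree (fl f) (fx f) x" "agree (fl f') (fx f') x'"
      by (simp_all add: agree_def x_def x'_def same(2)[symmetric])
    ultimately obtain y y' where y: "y \<in> Pi UNIV (A f)" "(f, y) \<in> Z (fj f)" "agree (Suc d) x y" and
      y': "y' \<in> Pi UNIV (A f')" "(f', y') \<in> Z (fj f')" "agree (Suc d) x' y'"
      using dense(2)[of f] dense(2)[of f'] unfolding dense_above_def by blast
    have yx: "y i = x i" "y' i = x' i" if "i \<le> d" for i
      using y(3) y'(3) that by (simp_all add: agree_def)
    have "fst s \<le> L (f' n)"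
      using block(2) le by (simp add: s_def block_def)
    then have dyads_x: "dyads (x i) = dyads (x' i)" for i
      using fx_eq[of i] dyads_refine[of s "L (f' n)"] by (auto simp: x_def x'_def dyads_def)
    have "coh f f' y y'"
      unfolding coh_def using dyads_x yx n_le by metis
    moreover have "conf f f' y y' k"
    proof -
      have "h f k \<in> U y"
        using yx(1)[OF \<open>n \<le> d\<close>] n by (auto simp: U_def x_def s_def)
      moreover have "h f' k \<notin> U y'"
      proof
        assume "h f' k \<in> U y'"
        then obtain i where i: "h f' k \<in> y' i"
          by (auto simp: U_def)
        moreover have "(f', y') \<in> X"
          using y'(1) by (simp add: X_def)
        ultimately have "col (h f' k) = p f' i"
          using xD(1)[of f' y' i] by (auto simp: block_def)
        with col'(1) have "i = n"
          using p[of f' i f' n] by simp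
        with i yx(2)[OF \<open>n \<le> d\<close>] n have "dyad (h f' k) \<subseteq> dyad s"
          by (simp add: x'_def)
        with disj dyad_nonempty[of "h f' k"] show False
          by (auto simp: s_def)
      qed
      ultimately show ?thesis
        using k col by (simp add: conf_def)
    qed
    ultimately have "R (f, y) (f', y')"
      using \<open>f \<noteq> f'\<close> by (auto simp: R_def)
    then show False
      using Z(2)[OF y(2)] y'(2) same(1) by simp
  qed
  show thesis
  proof (rule that[of code fl])
    fix f f' k n
    assume asm: "code f = code f'" "k \<in> \<Omega> f" "k \<in> \<Omega> f'" "col (h f k) = p f n" "col (h f' k) = p f n" "fl f \<le> n"
    show "dyad (h f k) \<inter> dyad (h f' k) \<noteq> {}"
    proof
      assume disj: "dyad (h f k) \<inter> dyad (h f' k) = {}"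
      obtain m where "col (h f' k) = p f' m"
        using h_block[OF asm(3)] by (auto simp: block_def)
      with asm(5) have pn: "p f n = p f' n"
        using p[of f n f' m] by simp
      have "fl f = fl f'"
        using asm(1) by (simp add: code_def)
      then show False
        using key[OF asm disj] key[OF asm(1)[symmetric] asm(3,2), of n] asm(4-6) pn disj
        by (metis Int_commute nle_le)
    qed
  qed
qed

section \<open>The theorem\<close>

lemma ex_recursive_choice:
  assumes "\<And>xs. \<exists>k. P xs k"
  obtains f :: "nat \<Rightarrow> 'a" where "\<And>n. P (map f [0..<n]) (f n)"
proof -
  define F where "F = rec_nat [] (\<lambda>_ xs. xs @ [SOME k. P xs k])"
  define f where "f n = (SOME k. P (F n) k)" for n
  have "map f [0..<n] = F n" for n
    by (induction n) (simp_all add: F_def f_def)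
  then have "P (map f [0..<n]) (f n)" for n
    using someI_ex[OF assms[of "F n"]] by (simp add: f_def)
  then show thesis
    by (rule that)
qed

text \<open>Stage \<open>k\<close> contributes \<open>k + 1\<close> sets of measure at most
  \<open>1 / 2 ^ (2 * k + 2)\<close>; as \<open>k + 1 \<le> 2 ^ k\<close>, their union has measure
  at most \<open>1 / 2 ^ (k + 2)\<close>, and these bounds add up to 1/2.\<close>

lemma emeasure_weighted_Un_le:
  assumes v: "\<And>q k. v q k \<in> sets lborel" and le: "\<And>q k. emeasure lborel (v q k) \<le> ennreal (1 / 2 ^ (2 * k + 2))"
  shows "emeasure lborel (\<Union>k. \<Union>q\<in>{..k::nat}. v q k) \<le> ennreal (1 / 2)"
proof -
  have "emeasure lborel (\<Union>q\<in>{..k}. v q k) \<le> ennreal ((1 / 2) ^ Suc (Suc k))" for k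
  proof -
    have "emeasure lborel (\<Union>q\<in>{..k}. v q k) \<le> (\<Sum>q\<in>{..k}. emeasure lborel (v q k))"
      using v by (intro emeasure_subadditive_finite) auto
    also have "\<dots> \<le> (\<Sum>q\<in>{..k}. ennreal (1 / 2 ^ (2 * k + 2)))"
      by (intro sum_mono le)
    also have "\<dots> = ennreal (real (Suc k) / 2 ^ (2 * k + 2))"
      by (simp add: ennreal_of_nat_eq_real_of_nat ennreal_mult'[symmetric] flip: of_nat_Suc)
    also have "\<dots> \<le> ennreal ((1 / 2) ^ Suc (Suc k))"
    proof (rule ennreal_leI)
      have "Suc k \<le> 2 ^ k"
        using less_exp[of k] by (rule Suc_leI)
      then have "real (Suc k) \<le> real (2 ^ k)"
        by (simp only: of_nat_le_iff)
      then have "real (Suc k) \<le> 2 ^ k"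
        by simp
      then have "real (Suc k) / 2 ^ (2 * k + 2) \<le> 2 ^ k / 2 ^ (2 * k + 2)"
        by (rule divide_right_mono) simp
      also have "\<dots> = (1 / 2) ^ Suc (Suc k)"
      proof -
        have "(2 :: real) ^ (2 * k + 2) = 2 ^ k * 2 ^ Suc (Suc k)"
          unfolding power_add[symmetric] by (rule arg_cong[where f = "power 2"]) simp
        then show ?thesis
          by (simp only: power_one_over) simp
      qed
      finally show "real (Suc k) / 2 ^ (2 * k + 2) \<le> (1 / 2) ^ Suc (Suc k)" .
    qed
    finally show ?thesis .
  qed
  then have "(\<Sum>k. emeasure lborel (\<Union>q\<in>{..k}. v q k)) \<le> (\<Sum>k. ennreal ((1 / 2) ^ Suc (Suc k)))"
    by (intro suminf_le) auto
  also have "\<dots> = ennreal (1 / 2)"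
  proof (rule suminf_ennreal_eq)
    show "(\<lambda>k. (1 / 2) ^ Suc (Suc k)) sums (1 / 2 :: real)"
      using sums_mult[OF power_half_series, of "1 / 2"] by (simp add: algebra_simps)
  qed simp
  finally show ?thesis
    using emeasure_subadditive_countably[of "\<lambda>k. \<Union>q\<in>{..k}. v q k" lborel] v
    by (force intro: order_trans)
qed

lemma no_null_lifting:
  assumes OCA and \<Phi>: "null_lifting \<Phi>"
  shows False
proof -
  \<comment> \<open>A first application of local additivity treats whole columns as points;
    \<open>h0 k\<close> will be the column to which \<open>k\<close> belongs.\<close>
  have hom0: "fin_hom (\<lambda>x. \<Phi> (dyads (\<Union>n\<in>x. block (int n) 0)))"
  proof (rule fin_hom_null_lifting[OF \<Phi>])
    have eq: "dyads (\<Union>n\<in>x. block (int n) 0) = {y. \<exists>n\<in>x. \<lfloor>y\<rfloor> = int n}" for x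
      using dyads_block[of _ 0] by (auto simp: dyads_def)
    show "dyads (\<Union>n\<in>x \<inter> y. block (int n) 0) =
        dyads (\<Union>n\<in>x. block (int n) 0) \<inter> dyads (\<Union>n\<in>y. block (int n) 0)" for x y
      unfolding eq by auto
  qed (auto simp: dyads_def intro: dyads_borel[unfolded dyads_def])
  have "\<exists>c0 \<Omega>0 h0. infinite (c0 :: nat set) \<and> (\<forall>Z. Z \<subseteq> c0 \<longrightarrow>
      (\<forall>\<^sub>F k in sequentially. k \<in> \<Phi> (dyads (\<Union>n\<in>Z. block (int n) 0)) \<longleftrightarrow> k \<in> \<Omega>0 \<and> h0 k \<in> Z))"
  proof (rule local_additivity[OF \<open>OCA\<close> hom0, of "\<lambda>n. {n}"])
    fix c \<Omega> h assume "infinite (c :: nat set)" "\<And>Z. Z \<subseteq> (\<Union>n\<in>c. {n}) \<Longrightarrow>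
      \<forall>\<^sub>F k in sequentially. k \<in> \<Phi> (dyads (\<Union>n\<in>Z. block (int n) 0)) \<longleftrightarrow> k \<in> \<Omega> \<and> h k \<in> Z"
    then show ?thesis
      by (intro exI[of _ c] exI[of _ \<Omega>] exI[of _ h]) simp
  qed auto
  then obtain c0 \<Omega>0 h0 where c0: "infinite c0" and h0_all: "\<forall>Z. Z \<subseteq> c0 \<longrightarrow>
      (\<forall>\<^sub>F k in sequentially. k \<in> \<Phi> (dyads (\<Union>n\<in>Z. block (int n) 0)) \<longleftrightarrow> k \<in> \<Omega>0 \<and> h0 k \<in> Z)"
    by (elim exE conjE)
  note h0 = h0_all[rule_format]
  define cc where "cc = enumerate c0"
  have cc: "inj cc" "range cc = c0"
    using strict_mono_enumerate[OF c0] range_enumerate[OF c0] by (auto simp: cc_def strict_mono_imp_inj_on)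
  \<comment> \<open>This is the level required by \<open>emeasure_weighted_Un_le\<close>.\<close>
  define L where "L k = 2 * k + 2" for k :: nat
  \<comment> \<open>The column placed at the node of \<open>f\<close> at level \<open>n\<close>;
    distinct nodes receive distinct columns.\<close>
  define p where "p f n = int (cc (nd f n))" for f :: "nat \<Rightarrow> nat" and n
  have p: "p f n = p f' m \<longleftrightarrow> n = m \<and> (\<forall>i<n. f i = f' i)" for f f' n m
    using cc(1) by (simp add: p_def inj_eq nd_eq_iff)
  define Q where "Q f c \<Omega> h \<longleftrightarrow> infinite (c :: nat set) \<and>
      (\<forall>k. k \<in> \<Omega> \<longrightarrow> h k \<in> (\<Union>n\<in>c. block (p f n) (L (f n)))) \<and>
      (\<forall>Z. Z \<subseteq> (\<Union>n\<in>c. block (p f n) (L (f n))) \<longrightarrow>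
        (\<forall>\<^sub>F k in sequentially. k \<in> \<Phi> (dyads Z) \<longleftrightarrow> k \<in> \<Omega> \<and> h k \<in> Z))" for f c \<Omega> h
  have "\<exists>c \<Omega> h. Q f c \<Omega> h" for f
  proof (rule local_additivity_dyads[OF \<open>OCA\<close> \<Phi>, of "p f" "\<lambda>n. L (f n)"])
    show "inj (p f)"
      by (simp add: inj_def p)
    fix c \<Omega> h
    assume "infinite (c :: nat set)" "\<And>k. k \<in> \<Omega> \<Longrightarrow> h k \<in> (\<Union>n\<in>c. block (p f n) (L (f n)))"
      "\<And>Z. Z \<subseteq> (\<Union>n\<in>c. block (p f n) (L (f n))) \<Longrightarrow>
        \<forall>\<^sub>F k in sequentially. k \<in> \<Phi> (dyads Z) \<longleftrightarrow> k \<in> \<Omega> \<and> h k \<in> Z"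
    then have "Q f c \<Omega> h"
      unfolding Q_def by (intro conjI allI impI)
    then show ?thesis
      by blast
  qed
  then obtain C \<Omega> h where CQ: "\<And>f. Q f (C f) (\<Omega> f) (h f)"
    by metis
  have C: "infinite (C f)"
    and h_block: "k \<in> \<Omega> f \<Longrightarrow> h f k \<in> (\<Union>n\<in>C f. block (p f n) (L (f n)))"
    and h: "Z \<subseteq> (\<Union>n\<in>C f. block (p f n) (L (f n))) \<Longrightarrow>
      \<forall>\<^sub>F k in sequentially. k \<in> \<Phi> (dyads Z) \<longleftrightarrow> k \<in> \<Omega> f \<and> h f k \<in> Z" for f k Z
    using CQ[of f] unfolding Q_def by simp_all
  have "\<exists>(code :: (nat \<Rightarrow> nat) \<Rightarrow> nat) lf. \<forall>f f' k n. code f = code f' \<longrightarrow> k \<in> \<Omega> f \<longrightarrow> k \<in> \<Omega> f' \<longrightarrow>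
      col (h f k) = p f n \<longrightarrow> col (h f' k) = p f n \<longrightarrow> lf f \<le> n \<longrightarrow> dyad (h f k) \<inter> dyad (h f' k) \<noteq> {}"
  proof (rule liftings_cohere[OF \<open>OCA\<close> \<Phi> p h_block h])
    fix code lf :: "(nat \<Rightarrow> nat) \<Rightarrow> nat"
    assume "\<And>f f' k n. \<lbrakk>code f = code f'; k \<in> \<Omega> f; k \<in> \<Omega> f'; col (h f k) = p f n;
      col (h f' k) = p f n; lf f \<le> n\<rbrakk> \<Longrightarrow> dyad (h f k) \<inter> dyad (h f' k) \<noteq> {}"
    then show ?thesis
      by (intro exI[of _ code] exI[of _ lf] allI impI)
  qed
  then obtain code :: "(nat \<Rightarrow> nat) \<Rightarrow> nat" and lf where
    cohere_all: "\<forall>f f' k n. code f = code f' \<longrightarrow> k \<in> \<Omega> f \<longrightarrow> k \<in> \<Omega> f' \<longrightarrow>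
      col (h f k) = p f n \<longrightarrow> col (h f' k) = p f n \<longrightarrow> lf f \<le> n \<longrightarrow> dyad (h f k) \<inter> dyad (h f' k) \<noteq> {}"
    by (elim exE)
  note cohere = cohere_all[rule_format]
  \<comment> \<open>The short intervals in column \<open>c\<close> that branches of code
    \<open>q\<close> assign to \<open>k\<close>. By coherence they all meet any one of them, so all
    lie in the same dyadic interval of level \<open>L k\<close>.\<close>
  define G where "G q k c = {h f k | f n. code f = q \<and> k \<in> \<Omega> f \<and> col (h f k) = c \<and> p f n = c \<and> lf f \<le> n \<and>
      L k \<le> fst (h f k)}" for q k :: nat and c
  have G_meas: "emeasure lborel (dyads (G q k c)) \<le> ennreal (1 / 2 ^ (2 * k + 2))" for q k c
  proof (cases "G q k c = {}")
    case False
    then obtain f n where f: "code f = q" "k \<in> \<Omega> f" "col (h f k) = c" "p f n = c" "lf f \<le> n" "L k \<le> fst (h f k)"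
      by (auto simp: G_def)
    obtain y where y: "y \<in> dyad (h f k)"
      using dyad_nonempty by blast
    define t where "t = (L k, \<lfloor>2 ^ L k * y\<rfloor>)"
    have t: "y \<in> dyad t" "fst t = L k"
      by (simp_all add: dyad_def t_def)
    have ht: "dyad (h f k) \<subseteq> dyad t"
      using dyad_nested[of t "h f k"] t y f(6) by auto
    have "dyad s \<subseteq> dyad t" if s: "s \<in> G q k c" for s
    proof -
      obtain f' where "s = h f' k" "code f' = q" "k \<in> \<Omega> f'" "col (h f' k) = c" "L k \<le> fst (h f' k)"
        using s by (auto simp: G_def)
      moreover from this have "dyad (h f k) \<inter> dyad (h f' k) \<noteq> {}"
        using cohere[of f f' k n] f by simp
      ultimately show ?thesis
        using dyad_nested[of t s] t(2) ht by auto
    qed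
    then have "dyads (G q k c) \<subseteq> dyad t"
      unfolding dyads_def by (rule UN_least)
    then have "emeasure lborel (dyads (G q k c)) \<le> emeasure lborel (dyad t)"
      by (rule emeasure_mono) simp
    then show ?thesis
      by (simp add: emeasure_dyad t(2) L_def)
  qed (simp add: dyads_def)
  \<comment> \<open>Admitting only codes up to \<open>k\<close> leaves \<open>k + 1\<close> sets for
    each \<open>k\<close>, while a given code \<open>q\<close> still enters for all
    \<open>k \<ge> q\<close>.\<close>
  define V where "V c = (\<Union>k. \<Union>q\<in>{..k}. dyads (G q k c))" for c
  have V_borel: "V c \<in> sets borel" for c
    unfolding V_def by (intro sets.countable_UN sets.finite_UN) auto
  have V_le: "emeasure lborel (V c) \<le> ennreal (1 / 2)" for c
    unfolding V_def by (rule emeasure_weighted_Un_le[OF _ G_meas]) simp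
  define K where "K = - (\<Union>c. V c)"
  have K_borel: "K \<in> sets borel"
    unfolding K_def using V_borel by (intro borel_comp sets.countable_UN) auto
  define E where "E = \<Phi> K"
  have V_col: "V c \<subseteq> {y. \<lfloor>y\<rfloor> = c}" for c
    using floor_dyad by (fastforce simp: V_def dyads_def G_def)
  have K_col: "infinite (\<Phi> (K \<inter> {y. \<lfloor>y\<rfloor> = c}))" for c
  proof
    assume "finite (\<Phi> (K \<inter> {y. \<lfloor>y\<rfloor> = c}))"
    then have null: "K \<inter> {y. \<lfloor>y\<rfloor> = c} \<in> null_sets lborel"
      using null_lifting_finite_iff[OF \<Phi>, of "K \<inter> {y. \<lfloor>y\<rfloor> = c}"] K_borel by simp
    have "{y. \<lfloor>y\<rfloor> = c} \<subseteq> V c \<union> (K \<inter> {y. \<lfloor>y\<rfloor> = c})"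
      using V_col by (auto simp: K_def)
    then have "emeasure lborel {y :: real. \<lfloor>y\<rfloor> = c} \<le> emeasure lborel (V c \<union> (K \<inter> {y. \<lfloor>y\<rfloor> = c}))"
      by (rule emeasure_mono) (use V_borel K_borel in simp)
    also have "\<dots> = emeasure lborel (V c)"
      using emeasure_Un_null_set[OF _ null] V_borel by simp
    finally have "1 \<le> ennreal (1 / 2)"
      using V_le[of c] by (simp add: emeasure_floor_eq)
    moreover have "ennreal (1 / 2) < ennreal 1"
      by (rule ennreal_lessI) simp_all
    ultimately show False
      unfolding ennreal_1 by (rule leD[THEN notE])
  qed
  \<comment> \<open>As \<open>K\<close> has positive measure in every column,
    \<open>\<Phi> K\<close> contains infinitely many \<open>k\<close> that belong to the column of
    the node \<open>xs\<close>.\<close>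
  have pick: "\<exists>k. k \<in> E \<and> k \<in> \<Omega>0 \<and> h0 k = cc (to_nat xs)" for xs :: "nat list"
  proof -
    define c where "c = cc (to_nat xs)"
    have "c \<in> c0"
      using cc(2) by (auto simp: c_def)
    have "\<exists>\<^sub>F k in sequentially. k \<in> \<Phi> (K \<inter> {y. \<lfloor>y\<rfloor> = int c})"
      using K_col[of "int c"] by (simp add: frequently_def eventually_notin_iff_finite)
    moreover have "\<forall>\<^sub>F k in sequentially. k \<in> \<Phi> (K \<inter> {y. \<lfloor>y\<rfloor> = int c}) \<longrightarrow> k \<in> E \<and> k \<in> \<Omega>0 \<and> h0 k = c"
      using null_lifting_Int[OF \<Phi> K_borel floor_eq_borel, of "int c"] h0[of "{c}"] \<open>c \<in> c0\<close>
      by (auto simp: dyads_block E_def elim: eventually_elim2)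
    ultimately have "\<exists>\<^sub>F k in sequentially. k \<in> E \<and> k \<in> \<Omega>0 \<and> h0 k = c"
      by (rule frequently_rev_mp)
    then show ?thesis
      unfolding c_def by (rule frequently_ex)
  qed
  \<comment> \<open>The number \<open>f n\<close> has two roles: it is an element of
    \<open>E\<close> belonging to the column at level \<open>n\<close>, and as the next value of the
    branch it determines how finely that column is divided.\<close>
  obtain f :: "nat \<Rightarrow> nat" where f: "\<And>n. f n \<in> E \<and> f n \<in> \<Omega>0 \<and> h0 (f n) = cc (to_nat (map f [0..<n]))"
    by (rule ex_recursive_choice[of "\<lambda>xs k. k \<in> E \<and> k \<in> \<Omega>0 \<and> h0 k = cc (to_nat xs)", OF pick]) blast
  have fE: "f n \<in> E" "f n \<in> \<Omega>0" "int (h0 (f n)) = p f n" for n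
    using f[of n] by (simp_all add: p_def nd_def)
  have "inj f"
    using fE(3) p by (metis injI)
  have fin_f: "finite {n. f n < m}" for m
    using finite_vimageI[OF _ \<open>inj f\<close>, of "{..<m}"] by (simp add: vimage_def)
  \<comment> \<open>The image of the union of the columns at levels in \<open>c\<close> is computed
    in two ways, through \<open>h0\<close> and through \<open>h f\<close>.\<close>
  have link: "finite {n \<in> c. \<not> (f n \<in> \<Omega> f \<and> (\<exists>m\<in>c. h f (f n) \<in> block (p f m) (L (f m))))}"
    if c: "c \<subseteq> C f" for c
  proof -
    define Z where "Z = (\<Union>m\<in>c. block (p f m) (L (f m)))"
    define c' where "c' = (\<lambda>m. cc (nd f m)) ` c"
    have "dyads Z = {y. \<exists>m\<in>c. \<lfloor>y\<rfloor> = p f m}"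
      using dyads_block by (auto simp: Z_def dyads_def)
    also have "\<dots> = {y. \<exists>m\<in>c'. \<lfloor>y\<rfloor> = int m}"
      by (auto simp: c'_def p_def)
    also have "\<dots> = dyads (\<Union>m\<in>c'. block (int m) 0)"
      using dyads_block[of _ 0] by (auto simp: dyads_def)
    finally have eq: "dyads Z = dyads (\<Union>m\<in>c'. block (int m) 0)" .
    have "Z \<subseteq> (\<Union>m\<in>C f. block (p f m) (L (f m)))"
      using c by (auto simp: Z_def)
    moreover have "c' \<subseteq> c0"
      using cc(2) by (auto simp: c'_def)
    ultimately have "\<forall>\<^sub>F k in sequentially. k \<in> \<Omega>0 \<and> h0 k \<in> c' \<longrightarrow> k \<in> \<Omega> f \<and> h f k \<in> Z"
      using h[of Z f] h0[of c'] unfolding eq by (auto elim: eventually_elim2)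
    then obtain m where m: "\<And>k. \<lbrakk>k \<ge> m; k \<in> \<Omega>0; h0 k \<in> c'\<rbrakk> \<Longrightarrow> k \<in> \<Omega> f \<and> h f k \<in> Z"
      by (auto simp: eventually_sequentially)
    have "f n \<in> \<Omega> f \<and> (\<exists>m\<in>c. h f (f n) \<in> block (p f m) (L (f m)))" if "n \<in> c" "m \<le> f n" for n
    proof -
      have "h0 (f n) \<in> c'"
        using fE(3)[of n] \<open>n \<in> c\<close> by (auto simp: c'_def p_def)
      then show ?thesis
        using m[OF that(2) fE(2)] by (auto simp: Z_def)
    qed
    then have "{n \<in> c. \<not> (f n \<in> \<Omega> f \<and> (\<exists>m\<in>c. h f (f n) \<in> block (p f m) (L (f m))))} \<subseteq> {n. f n < m}"
      by (auto simp: not_le[symmetric])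
    then show ?thesis
      using fin_f finite_subset by blast
  qed
  define W where "W = {n \<in> C f. f n \<in> \<Omega> f \<and> h f (f n) \<in> block (p f n) (L (f n))}"
  \<comment> \<open>Otherwise, for infinitely many \<open>n\<close>, \<open>h f (f n)\<close> would
    lie in the column of another level \<open>u n\<close>. A free set for \<open>u\<close> is an
    infinite set \<open>c\<close> whose members are all sent to levels outside \<open>c\<close>,
    against \<open>link\<close>.\<close>
  have "finite (C f - W)"
  proof (rule ccontr)
    assume inf: "infinite (C f - W)"
    define B where "B = {n \<in> C f - W. f n \<in> \<Omega> f \<and> (\<exists>m\<in>C f. h f (f n) \<in> block (p f m) (L (f m)))}"
    have "C f - W - B \<subseteq> {n \<in> C f. \<not> (f n \<in> \<Omega> f \<and> (\<exists>m\<in>C f. h f (f n) \<in> block (p f m) (L (f m))))}"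
      by (auto simp: B_def)
    then have "finite (C f - W - B)"
      using link[OF subset_refl] by (rule finite_subset)
    with inf have "infinite B"
      using finite_Diff2 by blast
    have "\<forall>n\<in>B. \<exists>m. h f (f n) \<in> block (p f m) (L (f m))"
      unfolding B_def by blast
    from bchoice[OF this] obtain u where u: "\<And>n. n \<in> B \<Longrightarrow> h f (f n) \<in> block (p f (u n)) (L (f (u n)))"
      by blast
    have u_ne: "u n \<noteq> n" if "n \<in> B" for n
      using u[OF that] that by (auto simp: B_def W_def)
    obtain c where c: "c \<subseteq> B" "infinite c" "\<And>n. n \<in> c \<Longrightarrow> u n \<notin> c"
      by (rule infinite_free_set[OF \<open>infinite B\<close> u_ne]) blast+
    have "\<not> (\<exists>m\<in>c. h f (f n) \<in> block (p f m) (L (f m)))" if "n \<in> c" for n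
    proof
      assume "\<exists>m\<in>c. h f (f n) \<in> block (p f m) (L (f m))"
      then obtain m where "m \<in> c" "h f (f n) \<in> block (p f m) (L (f m))" ..
      moreover have "h f (f n) \<in> block (p f (u n)) (L (f (u n)))"
        using u c(1) that by blast
      ultimately have "p f m = p f (u n)"
        by (simp add: block_def)
      then have "m = u n"
        using p by blast
      with c(3)[OF that] \<open>m \<in> c\<close> show False
        by simp
    qed
    then have "c \<subseteq> {n \<in> c. \<not> (f n \<in> \<Omega> f \<and> (\<exists>m\<in>c. h f (f n) \<in> block (p f m) (L (f m))))}"
      by blast
    moreover have "c \<subseteq> C f"
      using c(1) by (auto simp: B_def)
    ultimately show False
      using link c(2) finite_subset by blast
  qed
  define q where "q = code f"
  define W' where "W' = {n \<in> W. lf f \<le> n \<and> q \<le> f n}"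
  have "C f \<subseteq> W' \<union> ((C f - W) \<union> {..<lf f} \<union> {n. f n < q})"
    by (auto simp: W'_def)
  moreover have "finite ((C f - W) \<union> {..<lf f} \<union> {n. f n < q})"
    using \<open>finite (C f - W)\<close> fin_f[of q] by simp
  ultimately have "infinite W'"
    using C[of f] finite_subset finite_UnI by metis
  define Z where "Z = (\<lambda>n. h f (f n)) ` W'"
  have "dyads Z \<subseteq> (\<Union>c. V c)"
  proof -
    have "dyad (h f (f n)) \<subseteq> V (p f n)" if n: "n \<in> W'" for n
    proof -
      \<comment> \<open>The division at level \<open>n\<close> is exactly as fine as
        \<open>G\<close> demands for \<open>k = f n\<close>.\<close>
      have "h f (f n) \<in> G q (f n) (p f n)"
        using n unfolding G_def mem_Collect_eq
        by (intro exI[of _ f] exI[of _ n]) (simp add: W'_def W_def q_def block_def)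
      then have "dyad (h f (f n)) \<subseteq> dyads (G q (f n) (p f n))"
        unfolding dyads_def by blast
      also have "\<dots> \<subseteq> V (p f n)"
        using n unfolding V_def W'_def by blast
      finally show ?thesis .
    qed
    then show ?thesis
      unfolding dyads_def Z_def by blast
  qed
  then have disj: "dyads Z \<inter> K = {}"
    by (auto simp: K_def)
  have "Z \<subseteq> (\<Union>n\<in>C f. block (p f n) (L (f n)))"
    by (auto simp: Z_def W'_def W_def)
  then have "\<forall>\<^sub>F k in sequentially. \<not> (k \<in> \<Omega> f \<and> h f k \<in> Z \<and> k \<in> E)"
    using h[of Z f] null_lifting_Int[OF \<Phi> dyads_borel[of Z] K_borel] null_lifting_empty[OF \<Phi>]
    unfolding disj E_def by (auto elim: eventually_elim2[OF eventually_conj])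
  then have "finite {k. k \<in> \<Omega> f \<and> h f k \<in> Z \<and> k \<in> E}"
    using eventually_notin_iff_finite[of "{k. k \<in> \<Omega> f \<and> h f k \<in> Z \<and> k \<in> E}"] by simp
  moreover have "f ` W' \<subseteq> {k. k \<in> \<Omega> f \<and> h f k \<in> Z \<and> k \<in> E}"
    using fE(1) by (auto simp: Z_def W'_def W_def)
  ultimately have "finite (f ` W')"
    using finite_subset by blast
  with \<open>infinite W'\<close> \<open>inj f\<close> show False
    by (simp add: finite_image_iff inj_on_subset)
qed

theorem mainTheorem1:
  assumes OCA
  shows "\<not> (\<exists>h :: measure_algebra \<Rightarrow> pow_nat_mod_fin. boolean_algebra_embedding h)"
proof
  assume "\<exists>h :: measure_algebra \<Rightarrow> pow_nat_mod_fin. boolean_algebra_embedding h"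
  then obtain h :: "measure_algebra \<Rightarrow> pow_nat_mod_fin" where "boolean_algebra_embedding h" ..
  then obtain \<Phi> where "null_lifting \<Phi>"
    by (rule embedding_imp_null_lifting)
  with \<open>OCA\<close> show False
    by (rule no_null_lifting)
qed

end
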